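(* Let $d\ge2$ and let $\widehat{\boldsymbol S}^{\rm eig}=[\widehat{\boldsymbol S}_1^{\mathrm{eig}\top},\ldots,\widehat{\boldsymbol S}_n^{\mathrm{eig}\top}]^\top\in\mathbb R^{nd\times d}$ be the solution of $$\min_{\boldsymbol S\in\mathbb R^{nd\times d}} -\langle\boldsymbol C,\boldsymbol S\boldsymbol S^\top\rangle\quad\text{s.t.}\quad \boldsymbol S^\top\boldsymbol S=n\boldsymbol I_d.$$ Suppose $\mathrm{SNR}\gtrsim\sqrt\kappa(\sqrt d+\sqrt{\log n})$, where $\kappa$ is the condition number defined below. Then for $1\le i\le n$, each $\widehat{\boldsymbol Z}_i^{\rm eig}:=\mathcal P(\widehat{\boldsymbol S}_i^{\rm eig})$ satisfies the decomposition $$\widehat{\boldsymbol Z}_i^{\rm eig}=\left(\boldsymbol I_d+\frac{\sigma\sqrt{n-1}}{2n}(\boldsymbol G_i-\boldsymbol G_i^\top)\right)\boldsymbol Z_i\boldsymbol Q^{\rm eig}+\boldsymbol E_i^{\rm eig},$$ where $\boldsymbol G_i$ is a $d\times d$ Gaussian random matrix with i.i.d. $\mathcal N(0,1)$ entries, $\boldsymbol Q^{\rm eig}=\mathcal P(\boldsymbol Z^\top\widehat{\boldsymbol Z}^{\rm eig})$ with $\widehat{\boldsymbol Z}^{\rm eig}=[\widehat{\boldsymbol Z}_1^{\mathrm{eig}\top},\ldots,\widehat{\boldsymbol Z}_n^{\mathrm{eig}\top}]^\top$, and $\boldsymbol E_i^{\rm eig}$ satisfies with high probability that $$\|\boldsymbol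 E_i^{\rm eig}\|_F\lesssim\kappa^{1/2}\,\mathrm{SNR}^{-2}(\sqrt d+\sqrt{\log n})^2,\qquad 1\le i\le n,$$ where $\kappa$ is the condition number of $\widehat{\boldsymbol S}_i^{\mathrm{eig}\top}\widehat{\boldsymbol S}_i^{\rm eig}$: $$\kappa=\max_{1\le i\le n}\frac{\lambda_{\max}(\widehat{\boldsymbol S}_i^{\mathrm{eig}\top}\widehat{\boldsymbol S}_i^{\rm eig})}{\lambda_{\min}(\widehat{\boldsymbol S}_i^{\mathrm{eig}\top}\widehat{\boldsymbol S}_i^{\rm eig})}\le\frac{1+c'\,\mathrm{SNR}^{-1}}{1-c'\,\mathrm{SNR}^{-1}}$$ for some constant $c'>0$.
   Context: $\mathrm{O}(d)=\{\boldsymbol O\in\mathbb R^{d\times d}:\boldsymbol O\boldsymbol O^\top=\boldsymbol O^\top\boldsymbol O=\boldsymbol I_d\}$, and $\mathrm{O}(d)^{\otimes n}$ is the set of $nd\times d$ matrices obtained by stacking $n$ elements of $\mathrm{O}(d)$ vertically. The unknown ground truth is a fixed $\boldsymbol Z\in \mathrm{O}(d)^{\otimes n}$, $\boldsymbol Z^\top=[\boldsymbol Z_1^\top,\ldots,\boldsymbol Z_n^\top]$. The observation is $\boldsymbol C=\boldsymbol Z\boldsymbol Z^\top+\sigma\boldsymbol W\in\mathbb R^{nd\times nd}$ with $\sigma>0$, where $\boldsymbol W$ is a symmetric random matrix with $d\times d$ blocks $\boldsymbol W_{ij}$: $\boldsymbol W_{ii}=0$, $\boldsymbol W_{ij}^\top=\boldsymbol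 W_{ji}$, and the blocks $\boldsymbol W_{ij}$, $i<j$, are independent with i.i.d. $\mathcal N(0,1)$ entries. $\mathrm{SNR}:=\sigma^{-1}\sqrt{n/d}$. $\langle\boldsymbol X,\boldsymbol Y\rangle=\sum_{i,j}X_{ij}Y_{ij}$; $\|\cdot\|_F$ is the Frobenius norm; $\lambda_{\max},\lambda_{\min}$ are the largest and smallest eigenvalues. The polar retraction is $\mathcal P(\boldsymbol Y)\in\mathrm{argmin}_{\boldsymbol O\in \mathrm{O}(d)}\|\boldsymbol O-\boldsymbol Y\|_F^2$ for $\boldsymbol Y\in\mathbb R^{d\times d}$, equal to $(\boldsymbol Y\boldsymbol Y^\top)^{-1/2}\boldsymbol Y$ if $\boldsymbol Y$ has full rank. $f\lesssim g$ (resp. $f\gtrsim g$) means $f\le Cg$ (resp. $f\ge Cg$) for some universal constant $C>0$. The columns of $\widehat{\boldsymbol S}^{\rm eig}$ span the eigenspace of the top $d$ eigenvalues of $\boldsymbol C$; the solution is determined only up to right multiplication by an element of $\mathrm{O}(d)$. Blocks $\widehat{\boldsymbol S}_i^{\rm eig}$ are $d\times d$.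
   Formalization: In the bound on κ, c' may depend on n and d, with c' ≤ K(1+√(log n/d)), K constant: for d=2, n→∞, SNR=L√(log n), κ−1 stays bounded away from 0 while the bound with a universal c' tends to 1. For log n ≲ d, c' is universal. *)

theory Defs
  imports
    "HOL-Probability.Probability"
    "Jordan_Normal_Form.Spectral_Radius"
begin

text \<open>
  All matrices are real matrices with explicit dimensions, since the constants in the theorem must
  be uniform in the sizes \<open>n\<close> and \<open>d\<close>.  Indices start at 0, so that \<open>1 \<le> i \<le> n\<close> becomes \<open>i < n\<close>.
\<close>

text \<open>The \<open>(i, j)\<close>-th \<open>d \<times> d\<close> block; the blocks of an \<open>nd \<times> d\<close> matrix have \<open>j = 0\<close>.\<close>

definition block :: "nat \<Rightarrow> real mat \<Rightarrow> nat \<Rightarrow> nat \<Rightarrow> real mat" where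
  "block d A i j = mat d d (\<lambda>(a, b). A $$ (i * d + a, j * d + b))"

abbreviation row_block :: "nat \<Rightarrow> real mat \<Rightarrow> nat \<Rightarrow> real mat" where
  "row_block d S i \<equiv> block d S i 0"

definition stack :: "nat \<Rightarrow> nat \<Rightarrow> (nat \<Rightarrow> real mat) \<Rightarrow> real mat" where
  "stack n d B = mat (n * d) d (\<lambda>(r, c). B (r div d) $$ (r mod d, c))"

definition orth :: "nat \<Rightarrow> real mat set" where
  "orth d = {U \<in> carrier_mat d d. U * U\<^sup>T = 1\<^sub>m d \<and> U\<^sup>T * U = 1\<^sub>m d}"

definition orth_stack :: "nat \<Rightarrow> nat \<Rightarrow> real mat set" where
  "orth_stack n d = {Z \<in> carrier_mat (n * d) d. \<forall>i<n. row_block d Z i \<in> orth d}"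

definition frob_inner :: "real mat \<Rightarrow> real mat \<Rightarrow> real" where
  "frob_inner A B = (\<Sum>i<dim_row A. \<Sum>j<dim_col A. A $$ (i, j) * B $$ (i, j))"

definition frob_norm :: "real mat \<Rightarrow> real" where
  "frob_norm A = sqrt (frob_inner A A)"

text \<open>Only used for nonempty symmetric matrices, whose spectrum is finite, nonempty and real.\<close>

definition lambda_max :: "real mat \<Rightarrow> real" where
  "lambda_max A = Max (spectrum A)"

definition lambda_min :: "real mat \<Rightarrow> real" where
  "lambda_min A = Min (spectrum A)"

definition snr :: "nat \<Rightarrow> nat \<Rightarrow> real \<Rightarrow> real" where
  "snr n d \<sigma> = inverse \<sigma> * sqrt (real n / real d)"

definition gaussian_matrix :: "'w measure \<Rightarrow> nat \<Rightarrow> ('w \<Rightarrow> real mat) \<Rightarrow> bool" where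
  "gaussian_matrix M d G \<longleftrightarrow>
     (\<forall>\<omega>\<in>space M. G \<omega> \<in> carrier_mat d d) \<and>
     prob_space.indep_vars M (\<lambda>_. borel) (\<lambda>(a, b) \<omega>. G \<omega> $$ (a, b)) ({..<d} \<times> {..<d}) \<and>
     (\<forall>a<d. \<forall>b<d. distributed M lborel (\<lambda>\<omega>. G \<omega> $$ (a, b)) std_normal_density)"

text \<open>
  Independence of the blocks above the diagonal together with independence of the entries inside
  each block amounts to joint independence of all entries of these blocks.
\<close>

definition noise_matrix :: "'w measure \<Rightarrow> nat \<Rightarrow> nat \<Rightarrow> ('w \<Rightarrow> real mat) \<Rightarrow> bool" where
  "noise_matrix M n d W \<longleftrightarrow>
     (\<forall>\<omega>\<in>space M. W \<omega> \<in> carrier_mat (n * d) (n * d) \<and>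
        (\<forall>i<n. block d (W \<omega>) i i = 0\<^sub>m d d) \<and>
        (\<forall>i<n. \<forall>j<n. (block d (W \<omega>) i j)\<^sup>T = block d (W \<omega>) j i)) \<and>
     prob_space.indep_vars M (\<lambda>_. borel) (\<lambda>(i, j, a, b) \<omega>. block d (W \<omega>) i j $$ (a, b))
        {(i, j, a, b). i < j \<and> j < n \<and> a < d \<and> b < d} \<and>
     (\<forall>i j. i < j \<and> j < n \<longrightarrow> (\<forall>a<d. \<forall>b<d.
        distributed M lborel (\<lambda>\<omega>. block d (W \<omega>) i j $$ (a, b)) std_normal_density))"

definition observation :: "real \<Rightarrow> real mat \<Rightarrow> real mat \<Rightarrow> real mat" where
  "observation \<sigma> Z W = Z * Z\<^sup>T + \<sigma> \<cdot>\<^sub>m W"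

definition eig_solution :: "nat \<Rightarrow> nat \<Rightarrow> real mat \<Rightarrow> real mat \<Rightarrow> bool" where
  "eig_solution n d C S \<longleftrightarrow>
     is_arg_min (\<lambda>S. - frob_inner C (S * S\<^sup>T))
       (\<lambda>S. S \<in> carrier_mat (n * d) d \<and> S\<^sup>T * S = real n \<cdot>\<^sub>m 1\<^sub>m d) S"

text \<open>The polar retraction is any selection of nearest orthogonal matrices.\<close>

definition polar_retraction :: "nat \<Rightarrow> (real mat \<Rightarrow> real mat) \<Rightarrow> bool" where
  "polar_retraction d P \<longleftrightarrow>
     (\<forall>Y\<in>carrier_mat d d. is_arg_min (\<lambda>U. (frob_norm (U - Y))\<^sup>2) (\<lambda>U. U \<in> orth d) (P Y))"

definition gram :: "nat \<Rightarrow> real mat \<Rightarrow> nat \<Rightarrow> real mat" where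
  "gram d S i = (row_block d S i)\<^sup>T * row_block d S i"

text \<open>
  The condition number is finite iff every denominator is positive; as division by 0 yields 0 in
  HOL, \<open>cond_number\<close> is meaningful only together with \<open>cond_finite\<close>.
\<close>

definition cond_finite :: "nat \<Rightarrow> nat \<Rightarrow> real mat \<Rightarrow> bool" where
  "cond_finite n d S \<longleftrightarrow> (\<forall>i<n. 0 < lambda_min (gram d S i))"

definition cond_number :: "nat \<Rightarrow> nat \<Rightarrow> real mat \<Rightarrow> real" where
  "cond_number n d S = Max ((\<lambda>i. lambda_max (gram d S i) / lambda_min (gram d S i)) ` {..<n})"

end

theory Submission
  imports Defs
begin

text \<open>
  The proof is a leave-one-out perturbation analysis, organised around one quadratic equation.

  Write \<open>W\<^sub>i\<close> for the \<open>i\<close>-th block row of the noise. The maximiser \<open>S\<close> spans the top eigenspace of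
  \<open>C = Z Z\<^sup>T + \<sigma> W\<close>: first-order variations give \<open>C S = S \<Lambda>\<close>, and a min-max argument bounds \<open>\<Lambda>\<close> below
  by \<open>n - \<sigma> \<parallel>W\<parallel>\<close>. Hence \<open>H = Z\<^sup>T S / n\<close> is invertible, and the renormalised basis \<open>V = S H\<inverse>\<close>, for which
  \<open>Z\<^sup>T V = n\<close>, solves
  \<open>V = Z + (\<sigma>/n) (W V - V Z\<^sup>T W V / n)\<close> (\<open>eigenspace_graph\<close>). The right-hand side \<open>gmap\<close> is a
  contraction that depends on the noise in a Lipschitz way, so the equation takes over the role of eigenvector
  perturbation theorems.

  The difficulty is that \<open>V\<close> depends on \<open>W\<^sub>i\<close>, while \<open>W\<^sub>i (V - Z)\<close> must be small to second order. Let \<open>U\<^sub>i\<close> be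
  the \<open>n\<close>-th iterate of \<open>gmap\<close> for the noise with block row and block column \<open>i\<close> deleted. It is a polynomial
  in entries that are independent of \<open>W\<^sub>i\<close>, so conditionally on \<open>U\<^sub>i\<close> the matrix \<open>W\<^sub>i (U\<^sub>i - Z)\<close> has Gaussian
  bilinear forms, and a union bound over nets of the unit ball controls its norm (\<open>block_event\<close>). The
  contraction property shows that \<open>V - U\<^sub>i\<close> is small (\<open>leave_one_out\<close>), because deleting the block row changes
  \<open>gmap\<close> at \<open>U\<^sub>i\<close> only through \<open>W\<^sub>i U\<^sub>i\<close> and through the \<open>i\<close>-th block of \<open>U\<^sub>i\<close>.

  Let \<open>h\<close> be a constant multiple of \<open>SNR\<inverse> (sqrt d + sqrt (log n)) / sqrt d\<close>, the operator norm scale of one block.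
  The above gives \<open>S\<^sub>i = (I + X\<^sub>i) Z\<^sub>i Q\<^sub>0\<close> with a fixed orthogonal \<open>Q\<^sub>0\<close>, where \<open>X\<^sub>i\<close> has norm \<open>O(h)\<close> and equals
  \<open>(\<sigma>/n) W\<^sub>i Z Z\<^sub>i\<^sup>T\<close> up to a symmetric matrix and an error \<open>O(h\<^sup>2)\<close>. Taking the polar factor keeps only the
  skew part of \<open>X\<^sub>i\<close> to first order (\<open>polar_factor_expansion\<close>); since \<open>W\<^sub>i Z Z\<^sub>i\<^sup>T = sqrt (n - 1) G\<^sub>i\<close> with
  \<open>G\<^sub>i\<close> standard Gaussian, this is the asserted main term with \<open>Q\<^sub>0\<close> in place of \<open>Q\<close>. Summing over \<open>i\<close>, the
  skew parts cancel exactly because \<open>Z\<^sup>T W Z\<close> is symmetric, so that \<open>Q = Q\<^sub>0 + O(h\<^sup>2)\<close>. Passing from the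
  operator norm to the Frobenius norm costs a factor \<open>sqrt d\<close>, which the target
  \<open>SNR^(-2) (sqrt d + sqrt (log n))\<^sup>2\<close>, of order \<open>d h\<^sup>2\<close>, can absorb. The bound on \<open>\<kappa>\<close> follows from
  \<open>S\<^sub>i\<^sup>T S\<^sub>i = I + O(h)\<close>.
\<close>

section \<open>Matrices of all sizes in one normed algebra\<close>

text \<open>
  Keeping matrices of every size in a single type makes it a normed algebra, so that perturbation estimates
  need no side conditions on dimensions. With \<open>idm\<close> for the truncated identity, having \<open>m\<close> rows becomes the
  equation \<open>idm m * A = A\<close>. The algebra has no unit.
\<close>

typedef fmat = "{f :: nat \<Rightarrow> nat \<Rightarrow> real. \<exists>N. \<forall>i j. N \<le> i \<or> N \<le> j \<longrightarrow> f i j = 0}"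
  morphisms ent Abs_fmat
  by (rule exI[of _ "\<lambda>_ _. 0"]) simp

definition supp_le :: "nat \<Rightarrow> fmat \<Rightarrow> bool" where
  "supp_le N A \<longleftrightarrow> (\<forall>i j. N \<le> i \<or> N \<le> j \<longrightarrow> ent A i j = 0)"

lemma supp_le_ex: "\<exists>N. supp_le N A"
  using ent[of A] by (auto simp: supp_le_def)

definition bd :: "fmat \<Rightarrow> nat" where "bd A = (SOME N. supp_le N A)"

lemma supp_le_bd: "supp_le (bd A) A"
  unfolding bd_def using supp_le_ex by (rule someI_ex)

lemma supp_le_mono: "supp_le N A \<Longrightarrow> N \<le> N' \<Longrightarrow> supp_le N' A"
  by (auto simp: supp_le_def)

lemma supp_le_obtain:
  obtains N where "supp_le N A" "supp_le N B" "supp_le N C"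
  by (rule that[of "max (bd A) (max (bd B) (bd C))"])
     (auto intro: supp_le_mono[OF supp_le_bd])

lemma ent_Abs: "(\<And>i j. N \<le> i \<or> N \<le> j \<Longrightarrow> f i j = 0) \<Longrightarrow> ent (Abs_fmat f) = f"
  by (rule Abs_fmat_inverse) auto

lemma fmat_eqI: "(\<And>i j. ent A i j = ent B i j) \<Longrightarrow> A = B"
  by (metis ent_inject ext)

instantiation fmat :: real_vector
begin
definition zero_fmat where "0 = Abs_fmat (\<lambda>_ _. 0)"
definition plus_fmat where "A + B = Abs_fmat (\<lambda>i j. ent A i j + ent B i j)"
definition uminus_fmat where "- A = Abs_fmat (\<lambda>i j. - ent A i j)"
definition minus_fmat where "A - B = Abs_fmat (\<lambda>i j. ent A i j - ent B i j)"
definition scaleR_fmat where "r *\<^sub>R A = Abs_fmat (\<lambda>i j. r * ent A i j)"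

lemma ent_zero [simp]: "ent 0 i j = 0"
  by (simp add: zero_fmat_def ent_Abs)
lemma ent_plus [simp]: "ent (A + B) i j = ent A i j + ent B i j"
proof -
  obtain N where "supp_le N A" "supp_le N B" by (rule supp_le_obtain[of A B B])
  then show ?thesis unfolding plus_fmat_def by (subst ent_Abs[of N]) (auto simp: supp_le_def)
qed
lemma ent_minus [simp]: "ent (A - B) i j = ent A i j - ent B i j"
proof -
  obtain N where "supp_le N A" "supp_le N B" by (rule supp_le_obtain[of A B B])
  then show ?thesis unfolding minus_fmat_def by (subst ent_Abs[of N]) (auto simp: supp_le_def)
qed
lemma ent_uminus [simp]: "ent (- A) i j = - ent A i j"
  using supp_le_bd[of A] unfolding uminus_fmat_def by (subst ent_Abs[of "bd A"]) (auto simp: supp_le_def)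
lemma ent_scaleR [simp]: "ent (r *\<^sub>R A) i j = r * ent A i j"
  using supp_le_bd[of A] unfolding scaleR_fmat_def by (subst ent_Abs[of "bd A"]) (auto simp: supp_le_def)

instance
  by standard (auto intro!: fmat_eqI simp: algebra_simps)
end

text \<open>
  The Frobenius inner product and norm are plain functions, because the class operation \<open>norm\<close> is reserved for
  the operator norm.
\<close>

definition ip :: "fmat \<Rightarrow> fmat \<Rightarrow> real" where
  "ip A B = (\<Sum>i<bd A. \<Sum>j<bd A. ent A i j * ent B i j)"

lemma ip_eq: assumes "supp_le N A \<or> supp_le N B"
  shows "ip A B = (\<Sum>i<N. \<Sum>j<N. ent A i j * ent B i j)"
proof -
  define L where "L = max N (bd A)"
  have *: "(\<Sum>i<K. \<Sum>j<K. ent A i j * ent B i j) = (\<Sum>i<L. \<Sum>j<L. ent A i j * ent B i j)"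
    if "K \<le> L" "supp_le K A \<or> supp_le K B" for K
  proof -
    have "(\<Sum>i<K. \<Sum>j<K. ent A i j * ent B i j) = (\<Sum>i<K. \<Sum>j<L. ent A i j * ent B i j)"
      using that by (intro sum.cong sum.mono_neutral_left) (auto simp: supp_le_def)
    also have "\<dots> = (\<Sum>i<L. \<Sum>j<L. ent A i j * ent B i j)"
      using that by (intro sum.mono_neutral_left) (auto simp: supp_le_def)
    finally show ?thesis .
  qed
  show ?thesis unfolding ip_def
    using *[of N] *[of "bd A"] assms supp_le_bd by (auto simp: L_def)
qed

definition fr :: "fmat \<Rightarrow> real" where "fr A = sqrt (ip A A)"

lemma ip_commute: "ip A B = ip B A"
proof -
  obtain N where "supp_le N A" "supp_le N B" by (rule supp_le_obtain[of A B B])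
  then show ?thesis by (simp add: ip_eq[of N] mult.commute)
qed

lemma ip_add_left: "ip (A + B) C = ip A C + ip B C"
  by (simp add: ip_eq[OF disjI2[OF supp_le_bd[of C]]] sum.distrib algebra_simps)
lemma ip_add_right: "ip C (A + B) = ip C A + ip C B"
  by (metis ip_add_left ip_commute)
lemma ip_scaleR_left [simp]: "ip (r *\<^sub>R A) C = r * ip A C"
  by (simp add: ip_eq[OF disjI2[OF supp_le_bd[of C]]] sum_distrib_left algebra_simps)
lemma ip_scaleR_right [simp]: "ip C (r *\<^sub>R A) = r * ip C A"
  by (metis ip_scaleR_left ip_commute)
lemma ip_diff_left: "ip (A - B) C = ip A C - ip B C"
  by (simp add: ip_eq[OF disjI2[OF supp_le_bd[of C]]] sum_subtractf algebra_simps)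
lemma ip_diff_right: "ip C (A - B) = ip C A - ip C B"
  by (metis ip_diff_left ip_commute)
lemma ip_zero [simp]: "ip 0 A = 0" "ip A 0 = 0"
  using ip_scaleR_left[of 0 A A] ip_scaleR_right[of A 0 A] by auto
lemma ip_nonneg [simp]: "ip A A \<ge> 0"
  by (simp add: ip_def sum_nonneg)

lemmas ip_distribs = ip_add_left ip_add_right ip_diff_left ip_diff_right

lemma fr_nonneg [simp]: "fr A \<ge> 0" by (simp add: fr_def)
lemma fr_square: "(fr A)\<^sup>2 = ip A A" by (simp add: fr_def)
lemma fr_zero [simp]: "fr 0 = 0" by (simp add: fr_def)
lemma fr_scaleR [simp]: "fr (r *\<^sub>R A) = \<bar>r\<bar> * fr A"
  by (simp add: fr_def real_sqrt_mult flip: mult.assoc)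

lemma ip_CS: "\<bar>ip A B\<bar> \<le> fr A * fr B"
proof -
  have "0 \<le> ip (ip B B *\<^sub>R A - ip A B *\<^sub>R B) (ip B B *\<^sub>R A - ip A B *\<^sub>R B)" by (rule ip_nonneg)
  also have "\<dots> = ip B B * (ip A A * ip B B - (ip A B)\<^sup>2)"
    by (simp add: ip_distribs ip_commute[of B A] algebra_simps power2_eq_square)
  finally have 1: "0 \<le> ip B B * (ip A A * ip B B - (ip A B)\<^sup>2)" .
  have "(ip A B)\<^sup>2 \<le> ip A A * ip B B"
  proof (cases "ip B B = 0")
    case False
    then have "ip B B > 0" using ip_nonneg[of B] by linarith
    then show ?thesis using 1 by (simp add: zero_le_mult_iff)
  next
    case True
    have "0 \<le> ip (A - t *\<^sub>R B) (A - t *\<^sub>R B)" for t by (rule ip_nonneg)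
    then have q: "0 \<le> ip A A - 2 * t * ip A B" for t
      using True by (simp add: ip_distribs ip_commute[of B A] algebra_simps)
    have "ip A B = 0"
    proof (rule ccontr)
      assume "ip A B \<noteq> 0"
      then show False using q[of "(ip A A + 1) / (2 * ip A B)"] by simp
    qed
    then show ?thesis by (simp add: True)
  qed
  then have "sqrt ((ip A B)\<^sup>2) \<le> sqrt (ip A A * ip B B)" by (rule real_sqrt_le_mono)
  then show ?thesis by (simp add: fr_def real_sqrt_mult)
qed

lemma fr_triangle: "fr (A + B) \<le> fr A + fr B"
proof (rule power2_le_imp_le)
  have "(fr (A + B))\<^sup>2 = (fr A)\<^sup>2 + 2 * ip A B + (fr B)\<^sup>2"
    by (simp add: fr_square ip_distribs ip_commute[of B A])
  also have "\<dots> \<le> (fr A + fr B)\<^sup>2"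
    using ip_CS[of A B] by (simp add: power2_eq_square algebra_simps)
  finally show "(fr (A + B))\<^sup>2 \<le> (fr A + fr B)\<^sup>2" .
qed simp

lemma ent_le_fr: "\<bar>ent A i j\<bar> \<le> fr A"
proof (cases "i < bd A \<and> j < bd A")
  case True
  have "(ent A i j)\<^sup>2 \<le> (\<Sum>j<bd A. ent A i j * ent A i j)"
    unfolding power2_eq_square
    using True by (intro member_le_sum[of _ _ "\<lambda>j. ent A i j * ent A i j"]) auto
  also have "\<dots> \<le> ip A A" unfolding ip_def
    using True by (intro member_le_sum[of _ _ "\<lambda>i. \<Sum>j<bd A. ent A i j * ent A i j"])
      (auto intro!: sum_nonneg)
  finally have "sqrt ((ent A i j)\<^sup>2) \<le> fr A" unfolding fr_def by (rule real_sqrt_le_mono)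
  then show ?thesis by simp
next
  case False
  then show ?thesis using supp_le_bd[of A] by (auto simp: supp_le_def not_less)
qed

lemma fr_eq_0 [simp]: "fr A = 0 \<longleftrightarrow> A = 0"
proof
  assume "fr A = 0"
  then show "A = 0" using ent_le_fr[of A] by (auto intro!: fmat_eqI)
qed simp

lemma ip_eq_0 [simp]: "ip A A = 0 \<longleftrightarrow> A = 0"
  by (metis fr_def fr_eq_0 real_sqrt_eq_zero_cancel_iff)

instantiation fmat :: ring
begin
definition times_fmat where
  "A * B = Abs_fmat (\<lambda>i k. \<Sum>j<bd A. ent A i j * ent B j k)"

lemma ent_times_bd: "ent (A * B) i k = (\<Sum>j<bd A. ent A i j * ent B j k)"
proof -
  obtain N where "supp_le N A" "supp_le N B" by (rule supp_le_obtain[of A B B])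
  then show ?thesis unfolding times_fmat_def by (subst ent_Abs[of N]) (auto simp: supp_le_def)
qed

lemma ent_times: assumes "supp_le N A \<or> supp_le N B"
  shows "ent (A * B) i k = (\<Sum>j<N. ent A i j * ent B j k)"
proof -
  define L where "L = max N (bd A)"
  have "(\<Sum>j<K. ent A i j * ent B j k) = (\<Sum>j<L. ent A i j * ent B j k)"
    if "K \<le> L" "supp_le K A \<or> supp_le K B" for K
    using that by (intro sum.mono_neutral_left) (auto simp: supp_le_def)
  from this[of N] this[of "bd A"] assms supp_le_bd show ?thesis
    by (auto simp: ent_times_bd L_def)
qed

lemma supp_le_times: "supp_le N A \<Longrightarrow> supp_le N B \<Longrightarrow> supp_le N (A * B)"
  by (auto simp: supp_le_def ent_times_bd)

instance
proof
  fix A B C :: fmat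
  obtain N where N: "supp_le N A" "supp_le N B" "supp_le N C" by (rule supp_le_obtain)
  have "ent (A * B * C) i k = ent (A * (B * C)) i k" for i k
  proof -
    have "ent (A * B * C) i k = (\<Sum>j<N. \<Sum>l<N. ent A i l * ent B l j * ent C j k)"
      using N by (simp add: ent_times[of N] supp_le_times sum_distrib_right)
    also have "\<dots> = (\<Sum>l<N. \<Sum>j<N. ent A i l * ent B l j * ent C j k)" by (rule sum.swap)
    also have "\<dots> = ent (A * (B * C)) i k"
      using N by (simp add: ent_times[of N] supp_le_times sum_distrib_left mult.assoc)
    finally show ?thesis .
  qed
  then show "A * B * C = A * (B * C)" by (rule fmat_eqI)
  show "(A + B) * C = A * C + B * C" using N
    by (intro fmat_eqI) (simp add: ent_times[OF disjI2[OF N(3)]] sum.distrib algebra_simps)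
  show "A * (B + C) = A * B + A * C" using N
    by (intro fmat_eqI) (simp add: ent_times[OF disjI1[OF N(1)]] sum.distrib algebra_simps)
qed
end

lemma fr_times_le: "fr (A * B) \<le> fr A * fr B"
proof -
  obtain N where N: "supp_le N A" "supp_le N B" by (rule supp_le_obtain[of A B B])
  have "ip (A * B) (A * B) = (\<Sum>i<N. \<Sum>k<N. (\<Sum>j<N. ent A i j * ent B j k)\<^sup>2)"
    using N by (simp add: ip_eq[of N] supp_le_times ent_times[of N] power2_eq_square)
  also have "\<dots> \<le> (\<Sum>i<N. \<Sum>k<N. (\<Sum>j<N. (ent A i j)\<^sup>2) * (\<Sum>j<N. (ent B j k)\<^sup>2))"
    by (intro sum_mono Cauchy_Schwarz_ineq_sum)
  also have "\<dots> = ip A A * (\<Sum>k<N. \<Sum>j<N. (ent B j k)\<^sup>2)"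
    using N by (simp add: ip_eq[of N] power2_eq_square flip: sum_product)
  also have "(\<Sum>k<N. \<Sum>j<N. (ent B j k)\<^sup>2) = ip B B"
    using N sum.swap[of "\<lambda>k j. (ent B j k)\<^sup>2" "{..<N}" "{..<N}"] by (simp add: ip_eq[of N] power2_eq_square)
  finally have "sqrt (ip (A * B) (A * B)) \<le> sqrt (ip A A * ip B B)" by (rule real_sqrt_le_mono)
  then show ?thesis by (simp add: fr_def real_sqrt_mult)
qed

text \<open>Matrix units.\<close>

definition mu :: "nat \<Rightarrow> nat \<Rightarrow> fmat" where
  "mu i j = Abs_fmat (\<lambda>a b. if a = i \<and> b = j then 1 else 0)"

lemma ent_mu [simp]: "ent (mu i j) a b = (if a = i \<and> b = j then 1 else 0)"
  unfolding mu_def by (subst ent_Abs[of "Suc (max i j)"]) auto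

lemma ent_times_mu [simp]: "ent (A * mu i j) a b = (if b = j then ent A a i else 0)"
proof -
  obtain N where N: "supp_le N A" by (rule supp_le_obtain[of A A A])
  have "ent (A * mu i j) a b = (\<Sum>k<N. if k = i then (if b = j then ent A a i else 0) else 0)"
    unfolding ent_times[of N, OF disjI1[OF N]] by (intro sum.cong) auto
  also have "\<dots> = (if b = j then ent A a i else 0)"
    using N by (auto simp: sum.delta supp_le_def)
  finally show ?thesis .
qed

text \<open>
  The operator norm, with matrices in place of vectors as arguments. Left multiplication acts on each
  column separately, so this supremum is the usual one (\<open>norm_leI_col\<close>), and the adjoint of left
  multiplication by \<open>A\<close> is left multiplication by the transpose of \<open>A\<close>.
\<close>

instantiation fmat :: real_normed_vector
begin
definition norm_fmat :: "fmat \<Rightarrow> real" where "norm A = (SUP X\<in>{X. fr X \<le> 1}. fr (A * X))"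
definition sgn_fmat :: "fmat \<Rightarrow> fmat" where "sgn (A::fmat) = A /\<^sub>R norm A"
definition dist_fmat :: "fmat \<Rightarrow> fmat \<Rightarrow> real" where "dist (A::fmat) B = norm (A - B)"
definition uniformity_fmat :: "(fmat \<times> fmat) filter" where
  "uniformity_fmat = (INF e\<in>{0<..}. principal {(x, y). dist x y < e})"
definition open_fmat :: "fmat set \<Rightarrow> bool" where
  "open_fmat U = (\<forall>x\<in>U. eventually (\<lambda>(x', y). x' = x \<longrightarrow> y \<in> U) uniformity)"

lemma mult_scaleR_fmat: "(r *\<^sub>R A) * B = r *\<^sub>R (A * B)" "A * (r *\<^sub>R B) = r *\<^sub>R (A * (B::fmat))"
proof -
  obtain N where N: "supp_le N A" "supp_le N B" by (rule supp_le_obtain[of A B B])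
  show "(r *\<^sub>R A) * B = r *\<^sub>R (A * B)" "A * (r *\<^sub>R B) = r *\<^sub>R (A * B)"
    by (intro fmat_eqI; simp add: ent_times[OF disjI2[OF N(2)]] sum_distrib_left algebra_simps)
       (intro fmat_eqI; simp add: ent_times[OF disjI1[OF N(1)]] sum_distrib_left algebra_simps)
qed

lemma fr_bdd: "bdd_above ((\<lambda>X. fr (A * X)) ` {X. fr X \<le> 1})"
proof (rule bdd_aboveI2)
  fix X assume "X \<in> {X. fr X \<le> 1}"
  then show "fr (A * X) \<le> fr A"
    using fr_times_le[of A X] mult_left_le[of "fr X" "fr A"] by simp
qed

lemma fr_times_le_norm: "fr (A * X) \<le> norm A * fr X"
proof (cases "X = 0")
  case False
  then have p: "fr X > 0" using fr_nonneg[of X] by (metis fr_eq_0 less_eq_real_def)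
  have "fr (A * (X /\<^sub>R fr X)) \<le> norm A"
    unfolding norm_fmat_def using p by (intro cSUP_upper fr_bdd) (auto simp: field_simps)
  then show ?thesis using p by (simp add: mult_scaleR_fmat field_simps)
qed simp

lemma norm_fmat_nonneg: "0 \<le> norm (A::fmat)"
proof -
  have "fr (A * 0) \<le> norm A" unfolding norm_fmat_def by (intro cSUP_upper fr_bdd) auto
  then show ?thesis by simp
qed

lemma norm_fmat_leI: "(\<And>X. fr X \<le> 1 \<Longrightarrow> fr (A * X) \<le> c) \<Longrightarrow> norm A \<le> c"
  unfolding norm_fmat_def by (rule cSUP_least) (auto intro!: exI[of _ 0])

lemma norm_fmat_eq_0: "norm (A::fmat) = 0 \<longleftrightarrow> A = 0"
proof
  assume "norm A = 0"
  then have "fr (A * X) = 0" for X using fr_times_le_norm[of A X] fr_nonneg[of "A * X"] by simp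
  then have z: "A * X = 0" for X by simp
  have "ent A i j = ent (A * mu j j) i j" for i j by simp
  then show "A = 0" using z by (intro fmat_eqI) simp
next
  assume "A = 0" then show "norm A = 0"
    using norm_fmat_leI[of "0::fmat" 0] norm_fmat_nonneg[of "0::fmat"] by simp
qed

instance
proof
  fix A B :: fmat and r :: real
  show "dist A B = norm (A - B)" by (rule dist_fmat_def)
  show "sgn A = A /\<^sub>R norm A" by (rule sgn_fmat_def)
  show "(uniformity :: (fmat \<times> fmat) filter) = (INF e\<in>{0<..}. principal {(x, y). dist x y < e})"
    by (rule uniformity_fmat_def)
  show "open U \<longleftrightarrow> (\<forall>x\<in>U. eventually (\<lambda>(x', y). x' = x \<longrightarrow> y \<in> U) uniformity)" for U :: "fmat set"
    by (rule open_fmat_def)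
  show "norm A = 0 \<longleftrightarrow> A = 0" by (rule norm_fmat_eq_0)
  show "norm (A + B) \<le> norm A + norm B"
  proof (rule norm_fmat_leI)
    fix X :: fmat assume X: "fr X \<le> 1"
    have "fr ((A + B) * X) \<le> fr (A * X) + fr (B * X)"
      by (simp add: distrib_right fr_triangle)
    also have "\<dots> \<le> norm A * fr X + norm B * fr X" by (intro add_mono fr_times_le_norm)
    also have "\<dots> \<le> norm A * 1 + norm B * 1"
      using X by (intro add_mono mult_left_mono norm_fmat_nonneg)
    finally show "fr ((A + B) * X) \<le> norm A + norm B" by simp
  qed
  have le: "norm (r *\<^sub>R A) \<le> \<bar>r\<bar> * norm A" for r and A :: fmat
  proof (rule norm_fmat_leI)
    fix X :: fmat assume X: "fr X \<le> 1"
    have "fr (A * X) \<le> norm A * fr X" by (rule fr_times_le_norm)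
    also have "\<dots> \<le> norm A * 1" using X by (intro mult_left_mono norm_fmat_nonneg)
    finally show "fr (r *\<^sub>R A * X) \<le> \<bar>r\<bar> * norm A"
      by (simp add: mult_scaleR_fmat mult_left_mono)
  qed
  show "norm (r *\<^sub>R A) = \<bar>r\<bar> * norm A"
  proof (cases "r = 0")
    case True then show ?thesis by (simp add: norm_fmat_eq_0)
  next
    case False
    have "norm A = norm (inverse r *\<^sub>R (r *\<^sub>R A))" using False by simp
    also have "\<dots> \<le> \<bar>inverse r\<bar> * norm (r *\<^sub>R A)" by (rule le)
    finally have "\<bar>r\<bar> * norm A \<le> norm (r *\<^sub>R A)" using False by (simp add: field_simps)
    then show ?thesis using le[of r A] by simp
  qed
qed
end

instance fmat :: real_normed_algebra
proof
  fix A B :: fmat and r :: real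
  show "(r *\<^sub>R A) * B = r *\<^sub>R (A * B)" "A * (r *\<^sub>R B) = r *\<^sub>R (A * B)"
    by (rule mult_scaleR_fmat)+
  show "norm (A * B) \<le> norm A * norm B"
  proof (rule norm_fmat_leI)
    fix X :: fmat assume X: "fr X \<le> 1"
    have "fr (A * B * X) \<le> norm A * fr (B * X)" by (simp add: mult.assoc fr_times_le_norm)
    also have "\<dots> \<le> norm A * (norm B * fr X)"
      by (intro mult_left_mono fr_times_le_norm norm_fmat_nonneg)
    also have "\<dots> \<le> norm A * (norm B * 1)"
      using X by (intro mult_left_mono norm_fmat_nonneg)
    finally show "fr (A * B * X) \<le> norm A * norm B" by simp
  qed
qed

definition tp :: "fmat \<Rightarrow> fmat" where "tp A = Abs_fmat (\<lambda>i j. ent A j i)"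

lemma ent_tp [simp]: "ent (tp A) i j = ent A j i"
  using supp_le_bd[of A] unfolding tp_def by (subst ent_Abs[of "bd A"]) (auto simp: supp_le_def)

lemma supp_le_tp: "supp_le N A \<Longrightarrow> supp_le N (tp A)" by (auto simp: supp_le_def)

lemma tp_simps [simp]:
  "tp (tp A) = A" "tp (A + B) = tp A + tp B" "tp (A - B) = tp A - tp B" "tp (- A) = - tp A"
  "tp (r *\<^sub>R A) = r *\<^sub>R tp A" "tp 0 = 0" "tp (mu i j) = mu j i"
  by (auto intro!: fmat_eqI)

lemma tp_times [simp]: "tp (A * B) = tp B * tp A"
proof (rule fmat_eqI)
  fix i j
  obtain N where N: "supp_le N A" "supp_le N B" by (rule supp_le_obtain[of A B B])
  then show "ent (tp (A * B)) i j = ent (tp B * tp A) i j"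
    by (simp add: ent_times[of N] supp_le_tp mult.commute)
qed

lemma ip_tp_tp [simp]: "ip (tp A) (tp B) = ip A B"
proof -
  obtain N where N: "supp_le N A" "supp_le N B" by (rule supp_le_obtain[of A B B])
  then show ?thesis
    using sum.swap[of "\<lambda>i j. ent A j i * ent B j i" "{..<N}" "{..<N}"]
    by (simp add: ip_eq[of N] supp_le_tp)
qed

lemma ip_times_left: "ip (A * B) C = ip B (tp A * C)"
proof -
  obtain N where N: "supp_le N A" "supp_le N B" "supp_le N C" by (rule supp_le_obtain)
  have "ip (A * B) C = (\<Sum>i<N. \<Sum>k<N. \<Sum>j<N. ent A i j * ent B j k * ent C i k)"
    using N by (simp add: ip_eq[of N] ent_times[of N] sum_distrib_right)
  also have "\<dots> = (\<Sum>i<N. \<Sum>j<N. \<Sum>k<N. ent A i j * ent B j k * ent C i k)"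
    by (intro sum.cong sum.swap refl)
  also have "\<dots> = (\<Sum>j<N. \<Sum>i<N. \<Sum>k<N. ent A i j * ent B j k * ent C i k)"
    by (rule sum.swap)
  also have "\<dots> = (\<Sum>j<N. \<Sum>k<N. \<Sum>i<N. ent A i j * ent B j k * ent C i k)"
    by (intro sum.cong sum.swap refl)
  also have "\<dots> = ip B (tp A * C)"
    using N by (simp add: ip_eq[of N] ent_times[of N] supp_le_tp sum_distrib_left algebra_simps)
  finally show ?thesis .
qed

lemma ip_times_right: "ip (A * B) C = ip A (C * tp B)"
proof -
  have "ip (A * B) C = ip (tp B * tp A) (tp C)" by (metis ip_tp_tp tp_times)
  also have "\<dots> = ip (tp A) (B * tp C)" by (simp add: ip_times_left)
  also have "\<dots> = ip A (C * tp B)" by (metis ip_tp_tp tp_times tp_simps(1))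
  finally show ?thesis .
qed

lemma norm_leI:
  assumes "0 \<le> c" "\<And>X. fr (A * X) \<le> c * fr X" shows "norm (A::fmat) \<le> c"
proof (rule norm_fmat_leI)
  fix X :: fmat assume "fr X \<le> 1"
  then show "fr (A * X) \<le> c" using assms(2)[of X] mult_left_le[of "fr X" c] assms(1) by linarith
qed

lemma norm_tp [simp]: "norm (tp A) = norm A"
proof -
  have le: "norm (tp A) \<le> norm A" for A :: fmat
  proof (rule norm_leI)
    fix X
    have "(fr (tp A * X))\<^sup>2 = ip X (A * (tp A * X))"
      by (simp add: fr_square ip_times_left)
    also have "\<dots> \<le> fr X * fr (A * (tp A * X))" using ip_CS by (meson abs_le_D1)
    also have "\<dots> \<le> fr X * (norm A * fr (tp A * X))"
      by (intro mult_left_mono fr_times_le_norm) simp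
    finally have "fr (tp A * X) * fr (tp A * X) \<le> (norm A * fr X) * fr (tp A * X)"
      by (simp add: power2_eq_square mult_ac)
    then show "fr (tp A * X) \<le> norm A * fr X"
      by (cases "fr (tp A * X) = 0") (auto simp: mult_le_cancel_right less_le)
  qed simp
  from le[of A] le[of "tp A"] show ?thesis by simp
qed

lemma abs_ip_le_norm: "\<bar>ip X (A * Y)\<bar> \<le> norm A * fr X * fr Y"
proof -
  have "\<bar>ip X (A * Y)\<bar> \<le> fr X * fr (A * Y)" by (rule ip_CS)
  also have "\<dots> \<le> fr X * (norm A * fr Y)" by (intro mult_left_mono fr_times_le_norm) simp
  finally show ?thesis by (simp add: mult_ac)
qed

lemma norm_tp_self: "norm (tp A * A) = (norm A)\<^sup>2"
proof (rule antisym)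
  show "norm (tp A * A) \<le> (norm A)\<^sup>2"
    using norm_mult_ineq[of "tp A" A] by (simp add: power2_eq_square)
  have "norm A \<le> sqrt (norm (tp A * A))"
  proof (rule norm_leI)
    fix X
    have "(fr (A * X))\<^sup>2 = ip X ((tp A * A) * X)" by (simp add: fr_square ip_times_left mult.assoc)
    also have "\<dots> \<le> norm (tp A * A) * fr X * fr X" using abs_ip_le_norm by (meson abs_le_D1)
    finally have "(fr (A * X))\<^sup>2 \<le> (sqrt (norm (tp A * A)) * fr X)\<^sup>2"
      by (simp add: power_mult_distrib power2_eq_square[of "fr X"])
    then show "fr (A * X) \<le> sqrt (norm (tp A * A)) * fr X"
      by (rule power2_le_imp_le) simp
  qed simp
  then have "(norm A)\<^sup>2 \<le> (sqrt (norm (tp A * A)))\<^sup>2" by (intro power_mono) auto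
  then show "(norm A)\<^sup>2 \<le> norm (tp A * A)" by simp
qed

definition idm :: "nat \<Rightarrow> fmat" where "idm d = Abs_fmat (\<lambda>i j. if i = j \<and> i < d then 1 else 0)"

lemma ent_idm [simp]: "ent (idm d) i j = (if i = j \<and> i < d then 1 else 0)"
  unfolding idm_def by (subst ent_Abs[of d]) auto

lemma tp_idm [simp]: "tp (idm d) = idm d" by (auto intro!: fmat_eqI)

lemma supp_le_idm: "supp_le d (idm d)" by (auto simp: supp_le_def)

lemma ent_idm_times [simp]: "ent (idm d * A) i j = (if i < d then ent A i j else 0)"
proof -
  have "ent (idm d * A) i j = (\<Sum>k<d. if k = i then ent A i j else 0)"
    unfolding ent_times[of d, OF disjI1[OF supp_le_idm]] by (intro sum.cong) auto
  then show ?thesis by (simp add: sum.delta)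
qed

lemma ent_times_idm [simp]: "ent (A * idm d) i j = (if j < d then ent A i j else 0)"
  by (metis (no_types) ent_idm_times ent_tp tp_idm tp_times)

lemma idm_times_iff: "idm d * A = A \<longleftrightarrow> (\<forall>i j. d \<le> i \<longrightarrow> ent A i j = 0)"
proof
  assume *: "idm d * A = A"
  have "ent (idm d * A) i j = 0" if "d \<le> i" for i j using that by simp
  then show "\<forall>i j. d \<le> i \<longrightarrow> ent A i j = 0" using * by simp
qed (auto intro!: fmat_eqI)

lemma times_idm_iff: "A * idm d = A \<longleftrightarrow> (\<forall>i j. d \<le> j \<longrightarrow> ent A i j = 0)"
proof
  assume *: "A * idm d = A"
  have "ent (A * idm d) i j = 0" if "d \<le> j" for i j using that by simp
  then show "\<forall>i j. d \<le> j \<longrightarrow> ent A i j = 0" using * by simp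
qed (auto intro!: fmat_eqI)

lemma idm_idm [simp]: "idm d * idm d = idm d" by (auto intro!: fmat_eqI)

lemma fr_idm: "fr (idm d) = sqrt d"
proof -
  have "ip (idm d) (idm d) = (\<Sum>i<d. \<Sum>j<d. if j = i then 1 else 0)"
    unfolding ip_eq[of d, OF disjI1[OF supp_le_idm]] by (intro sum.cong) auto
  then show ?thesis by (simp add: fr_def sum.delta)
qed

lemma norm_proj_le_1: assumes "tp A * A = idm d" shows "norm A \<le> 1"
proof -
  have "norm (idm d) = (norm (idm d))\<^sup>2" using norm_tp_self[of "idm d"] by simp
  then have "norm (idm d) * (norm (idm d) - 1) = 0" by (simp add: algebra_simps power2_eq_square)
  then have "norm (idm d) \<le> 1" by auto
  then have "(norm A)\<^sup>2 \<le> 1" using norm_tp_self[of A] assms by simp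
  then show ?thesis using power2_le_imp_le[of "norm A" 1] by simp
qed

lemma norm_idm_le_1: "norm (idm d) \<le> 1" by (rule norm_proj_le_1[of _ d]) simp

lemma norm_le_sqrt_gram: assumes "tp A * A = m *\<^sub>R idm d" "0 \<le> m" shows "norm A \<le> sqrt m"
proof (rule real_le_rsqrt)
  have "(norm A)\<^sup>2 = m * norm (idm d)" using norm_tp_self[of A] assms by simp
  also have "\<dots> \<le> m" using norm_idm_le_1[of d] assms(2) by (simp add: mult_left_le)
  finally show "(norm A)\<^sup>2 \<le> m" .
qed

lemma fr_le_sqrt_norm: assumes "A * idm d = A" shows "fr A \<le> sqrt d * norm A"
  using fr_times_le_norm[of A "idm d"] assms by (simp add: fr_idm mult.commute)

text \<open>Vectors are represented by matrices supported in column 0.\<close>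

definition is_col :: "fmat \<Rightarrow> bool" where "is_col x \<longleftrightarrow> x * mu 0 0 = x"

lemma col_times: "is_col x \<Longrightarrow> is_col (A * x)" by (simp add: is_col_def mult.assoc)
lemma col_add: "is_col x \<Longrightarrow> is_col y \<Longrightarrow> is_col (x + y)" by (simp add: is_col_def distrib_right)
lemma col_diff: "is_col x \<Longrightarrow> is_col y \<Longrightarrow> is_col (x - y)" by (simp add: is_col_def left_diff_distrib)
lemma col_scaleR: "is_col x \<Longrightarrow> is_col (r *\<^sub>R x)" by (simp add: is_col_def)
lemma col_mu: "is_col (A * mu j 0)" unfolding is_col_def by (rule fmat_eqI) auto

lemma col_ent: "is_col x \<longleftrightarrow> (\<forall>i j. j \<noteq> 0 \<longrightarrow> ent x i j = 0)"
proof
  assume c: "is_col x"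
  have "ent (x * mu 0 0) i j = 0" if "j \<noteq> 0" for i j using that by simp
  with c show "\<forall>i j. j \<noteq> 0 \<longrightarrow> ent x i j = 0" by (simp add: is_col_def)
qed (auto simp: is_col_def intro!: fmat_eqI)

lemma col_ip: assumes "is_col x" "supp_le N x \<or> supp_le N y"
  shows "ip x y = (\<Sum>i<N. ent x i 0 * ent y i 0)"
proof (cases "N = 0")
  case False
  have "(\<Sum>j<N. ent x i j * ent y i j) = ent x i 0 * ent y i 0" for i
  proof -
    have "(\<Sum>j<N. ent x i j * ent y i j) = (\<Sum>j<N. if j = 0 then ent x i 0 * ent y i 0 else 0)"
      using assms(1) by (intro sum.cong) (auto simp: col_ent)
    then show ?thesis using False by (simp add: sum.delta)
  qed
  then show ?thesis using assms by (simp add: ip_eq[of N])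
qed (use assms in \<open>simp add: ip_eq[of N]\<close>)

lemma col_tp_times: assumes x: "is_col x" and y: "is_col y" shows "tp x * y = ip x y *\<^sub>R mu 0 0"
proof (rule fmat_eqI)
  fix i j
  obtain N where N: "supp_le N x" "supp_le N y" by (rule supp_le_obtain[of x y y])
  have "ent (tp x * y) i j = (\<Sum>k<N. ent x k i * ent y k j)"
    using N by (simp add: ent_times[of N] supp_le_tp)
  also have "\<dots> = ent (ip x y *\<^sub>R mu 0 0) i j"
    using x y N by (auto simp: col_ip[of x N] col_ent)
  finally show "ent (tp x * y) i j = ent (ip x y *\<^sub>R mu 0 0) i j" .
qed

lemma ip_columns: assumes "supp_le N X \<or> supp_le N Y"
  shows "ip X Y = (\<Sum>j<N. ip (X * mu j 0) (Y * mu j 0))"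
proof -
  have "ip (X * mu j 0) (Y * mu j 0) = (\<Sum>i<N. ent X i j * ent Y i j)" if "j < N" for j
  proof -
    have "supp_le N (X * mu j 0) \<or> supp_le N (Y * mu j 0)"
      using assms that by (auto simp: supp_le_def)
    then show ?thesis by (subst col_ip[of _ N]) (auto simp: col_mu)
  qed
  then show ?thesis using assms
    sum.swap[of "\<lambda>i j. ent X i j * ent Y i j" "{..<N}" "{..<N}"] by (simp add: ip_eq[of N])
qed

text \<open>
  A quadratic form of a matrix is the sum of its values at the columns.
\<close>

lemma quadratic_form_columns:
  assumes "\<And>x. is_col x \<Longrightarrow> idm d * x = x \<Longrightarrow> c * ip x x \<le> ip x (B * x)" and "idm d * X = X"
  shows "c * ip X X \<le> ip X (B * X)"
proof -
  obtain N where N: "supp_le N X" by (rule supp_le_obtain[of X X X])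
  have "c * ip (X * mu j 0) (X * mu j 0) \<le> ip (X * mu j 0) (B * X * mu j 0)" for j
    using assms(1)[of "X * mu j 0"] assms(2) by (simp add: col_mu mult.assoc[symmetric])
  then have "(\<Sum>j<N. c * ip (X * mu j 0) (X * mu j 0)) \<le> (\<Sum>j<N. ip (X * mu j 0) (B * X * mu j 0))"
    by (intro sum_mono)
  then show ?thesis using N by (simp add: ip_columns[of N] sum_distrib_left)
qed

lemma norm_leI_col:
  assumes "0 \<le> c" "\<And>x. is_col x \<Longrightarrow> fr (A * x) \<le> c * fr x" shows "norm (A::fmat) \<le> c"
proof (rule norm_leI[OF assms(1)])
  fix X
  obtain N where N: "supp_le N X" "supp_le N A" by (rule supp_le_obtain[of X A X])
  have "(fr (A * X))\<^sup>2 = (\<Sum>j<N. (fr (A * (X * mu j 0)))\<^sup>2)"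
    unfolding fr_square using N by (simp add: ip_columns[of N "A * X"] supp_le_times mult.assoc)
  also have "\<dots> \<le> (\<Sum>j<N. (c * fr (X * mu j 0))\<^sup>2)"
    using assms col_mu by (intro sum_mono power_mono) auto
  also have "\<dots> = (c * fr X)\<^sup>2"
    unfolding power_mult_distrib fr_square
    using N by (simp add: ip_columns[of N X] sum_distrib_left)
  finally show "fr (A * X) \<le> c * fr X"
    by (rule power2_le_imp_le) (simp add: assms)
qed

section \<open>Polar factors of perturbed orthogonal matrices\<close>

definition orthf :: "nat \<Rightarrow> fmat \<Rightarrow> bool" where
  "orthf d U \<longleftrightarrow> idm d * U = U \<and> U * idm d = U \<and> tp U * U = idm d \<and> U * tp U = idm d"

lemma orthfD:
  assumes "orthf d U"
  shows "idm d * U = U" "U * idm d = U" "tp U * U = idm d" "U * tp U = idm d"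
    "idm d * tp U = tp U" "tp U * idm d = tp U" "norm U \<le> 1"
proof -
  show 1: "idm d * U = U" "U * idm d = U" "tp U * U = idm d" "U * tp U = idm d"
    using assms by (auto simp: orthf_def)
  show "idm d * tp U = tp U" using 1(2) by (metis tp_idm tp_times)
  show "tp U * idm d = tp U" using 1(1) by (metis tp_idm tp_times)
  show "norm U \<le> 1" by (rule norm_proj_le_1[OF 1(3)])
qed

lemma orthf_mult: assumes "orthf d U" "orthf d V" shows "orthf d (U * V)"
proof -
  note U = orthfD[OF assms(1)] and V = orthfD[OF assms(2)]
  have "tp V * tp U * (U * V) = tp V * (tp U * U) * V" by (simp add: mult.assoc)
  also have "\<dots> = idm d" by (simp add: U V)
  finally have 1: "tp V * tp U * (U * V) = idm d" .
  have "U * V * (tp V * tp U) = U * (V * tp V) * tp U" by (simp add: mult.assoc)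
  also have "\<dots> = idm d" by (simp add: U V)
  finally show ?thesis
    using 1 U V by (simp add: orthf_def mult.assoc[of U V "idm d"] flip: mult.assoc[of "idm d" U V])
qed

lemma orthf_tp: assumes "orthf d U" shows "orthf d (tp U)"
  using orthfD[OF assms] by (simp add: orthf_def)

lemma norm_tp_orthf: "orthf d U \<Longrightarrow> norm (tp U) \<le> 1"
  using orthfD(7)[OF orthf_tp] by simp

definition reflection :: "nat \<Rightarrow> fmat \<Rightarrow> fmat" where
  "reflection d v = idm d - 2 *\<^sub>R (v * tp v)"

lemma col_right: "is_col v \<Longrightarrow> is_col w \<Longrightarrow> v * tp v' * (w * A) = ip v' w *\<^sub>R (v * A)" if "is_col v'"
proof -
  assume v: "is_col v" and w: "is_col w"
  have "v * tp v' * (w * A) = v * (tp v' * w) * A" by (simp add: mult.assoc)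
  also have "\<dots> = ip v' w *\<^sub>R (v * mu 0 0 * A)" by (simp add: col_tp_times that w)
  also have "v * mu 0 0 = v" using v by (simp add: is_col_def)
  finally show ?thesis .
qed

lemma reflection_orthf:
  assumes "is_col v" "idm d * v = v" "ip v v = 1" shows "orthf d (reflection d v)"
proof -
  have 1: "v * tp v * (v * tp v) = v * tp v" using col_right[OF assms(1) assms(1) assms(1)] assms(3) by simp
  have 2: "tp v * idm d = tp v" using assms(2) by (metis tp_idm tp_times)
  have 3: "v * tp v * idm d = v * tp v" by (simp add: mult.assoc 2)
  have 4: "idm d * (v * tp v) = v * tp v" by (simp add: assms(2) flip: mult.assoc)
  show ?thesis
    by (simp add: orthf_def reflection_def left_diff_distrib right_diff_distrib 1 3 4)
       (rule fmat_eqI, simp)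
qed

lemma ip_outer: "ip (u * tp v) B = ip u (B * v)"
  by (simp add: ip_times_right)

lemma linear_le_quadratic_imp_zero:
  fixes p q :: real assumes "\<And>t. t * p \<le> t\<^sup>2 * q" shows "p = 0"
proof -
  define t where "t = p / (\<bar>q\<bar> + 1)"
  have tq: "t * (\<bar>q\<bar> + 1) = p" by (simp add: t_def)
  have "t * (t * (\<bar>q\<bar> + 1)) \<le> t\<^sup>2 * q" using assms[of t] by (simp add: tq)
  then have "t\<^sup>2 * (\<bar>q\<bar> + 1 - q) \<le> 0" by (simp add: algebra_simps power2_eq_square)
  moreover have "\<bar>q\<bar> + 1 - q > 0" by linarith
  ultimately have "t = 0" by (simp add: mult_le_0_iff not_le)
  then show ?thesis using tq by simp
qed

lemma ip_mu: "ip (mu a 0) Y = ent Y a 0"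
proof -
  have "ip (mu a 0) Y = (\<Sum>i<Suc a. ent (mu a 0) i 0 * ent Y i 0)"
    using col_mu[of "mu a a" a] by (intro col_ip) (auto simp: supp_le_def col_ent)
  also have "\<dots> = (\<Sum>i<Suc a. if i = a then ent Y a 0 else 0)" by (intro sum.cong) auto
  finally show ?thesis by (simp add: sum.delta)
qed

text \<open>
  Test the maximality at a reflection in a unit vector \<open>v\<close>: this decreases the trace form by twice the
  value of \<open>B\<close> at \<open>v\<close>, which is therefore nonnegative. A product of reflections in two nearly parallel unit
  vectors is a rotation by a small angle in their plane; to first order in the angle it changes the trace
  form by the antisymmetric part of \<open>B\<close> in that plane, which must vanish.
\<close>

lemma trace_maximal_imp_psd:
  assumes B: "idm d * B = B" "B * idm d = B"
    and max: "\<And>U. orthf d U \<Longrightarrow> ip U B \<le> ip (idm d) B"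
  shows "tp B = B" "0 \<le> ip X (B * X)"
proof -
  have psd: "0 * ip x x \<le> ip x (B * x)" if x: "is_col x" "idm d * x = x" for x
  proof (cases "x = 0")
    case False
    then have p: "fr x > 0" using fr_nonneg[of x] by (metis fr_eq_0 less_eq_real_def)
    define v where "v = x /\<^sub>R fr x"
    have v: "is_col v" "idm d * v = v" "ip v v = 1"
      using x p by (auto simp: v_def col_scaleR fr_square[symmetric] power2_eq_square field_simps)
    have "ip (reflection d v) B = ip (idm d) B - 2 * ip v (B * v)"
      by (simp add: reflection_def ip_distribs ip_outer)
    then have "0 \<le> ip v (B * v)" using max[OF reflection_orthf[OF v]] by simp
    moreover have "ip v (B * v) = ip x (B * x) / (fr x)\<^sup>2"
      by (simp add: v_def power2_eq_square field_simps)
    ultimately show ?thesis using p by (auto simp: zero_le_divide_iff)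
  qed simp
  have "0 * ip (idm d * X) (idm d * X) \<le> ip (idm d * X) (B * (idm d * X))"
    by (rule quadratic_form_columns[OF psd]) (assumption+, metis idm_idm mult.assoc)
  moreover have "ip (idm d * X) (B * (idm d * X)) = ip X (idm d * (B * idm d) * X)"
    by (simp add: ip_times_left mult.assoc)
  ultimately show "0 \<le> ip X (B * X)" by (simp add: B)
  have sym: "ent B a b = ent B b a" if ab: "a < d" "b < d" "a \<noteq> b" for a b
  proof -
    define v where "v = mu a 0"
    define x where "x = mu b 0"
    have c: "is_col v" "is_col x" by (auto simp: v_def x_def col_ent)
    have e: "idm d * v = v" "idm d * x = x" using ab by (auto simp: v_def x_def intro!: fmat_eqI)
    have i: "ip v v = 1" "ip x x = 1" "ip v x = 0" "ip x v = 0" using ab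
      by (auto simp: v_def x_def ip_mu)
    have "t * (ip v (B * x) - ip x (B * v)) \<le> t\<^sup>2 * (ip v (B * v) + ip x (B * x))" for t
    proof -
      define s where "s = 1 / sqrt (1 + t\<^sup>2)"
      have pos: "1 + t\<^sup>2 > 0" by (simp add: add_pos_nonneg)
      have s2: "s * s * (1 + t\<^sup>2) = 1" using pos by (simp add: s_def)
      \<comment> \<open>The second reflection direction, at an angle with tangent \<open>t\<close> to \<open>v\<close>.\<close>
      define w where "w = s *\<^sub>R (v + t *\<^sub>R x)"
      have w: "is_col w" "idm d * w = w" "ip w w = 1"
        using s2 by (simp_all add: w_def c e i col_scaleR col_add distrib_left ip_distribs algebra_simps power2_eq_square)
      have "reflection d v * reflection d w
          = idm d - 2 *\<^sub>R (v * tp v) - 2 *\<^sub>R (w * tp w) + (4 * ip v w) *\<^sub>R (v * tp w)"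
      proof -
        have "tp v * idm d = tp v" using e(1) by (metis tp_idm tp_times)
        then have "v * tp v * idm d = v * tp v" by (simp add: mult.assoc)
        moreover have "idm d * (w * tp w) = w * tp w" by (simp add: w flip: mult.assoc)
        ultimately show ?thesis
          using col_right[OF c(1) c(1) w(1), of "tp w"]
          by (simp add: reflection_def left_diff_distrib right_diff_distrib scaleR_diff_right)
      qed
      then have "ip (reflection d v * reflection d w) B
          = ip (idm d) B - 2 * ip v (B * v) - 2 * ip w (B * w) + 4 * ip v w * ip v (B * w)"
        by (simp add: ip_distribs ip_outer)
      then have le: "- 2 * ip v (B * v) - 2 * ip w (B * w) + 4 * ip v w * ip v (B * w) \<le> 0"
        using max[OF orthf_mult[OF reflection_orthf reflection_orthf], of v w] c(1) e(1) i(1) w by simp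
      have vw: "ip v w = s" by (simp add: w_def ip_distribs i)
      have vBw: "ip v (B * w) = s * (ip v (B * v) + t * ip v (B * x))"
        by (simp add: w_def ip_distribs distrib_left)
      have wBw: "ip w (B * w) = s * s * (ip v (B * v) + t * (ip v (B * x) + ip x (B * v)) + t\<^sup>2 * ip x (B * x))"
        by (simp add: w_def ip_distribs distrib_left algebra_simps power2_eq_square)
      define q where "q = s * s"
      have q: "q * (1 + t\<^sup>2) = 1" "q > 0" using s2 pos by (auto simp: q_def s_def)
      have "- 2 * ip v (B * v) * (q * (1 + t\<^sup>2)) - 2 * (q * (ip v (B * v) + t * (ip v (B * x) + ip x (B * v)) + t\<^sup>2 * ip x (B * x)))
           + 4 * (q * (ip v (B * v) + t * ip v (B * x))) \<le> 0"
        using le unfolding vw vBw wBw q(1) by (simp add: q_def algebra_simps)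
      then have "2 * q * (t * (ip v (B * x) - ip x (B * v)) - t\<^sup>2 * (ip v (B * v) + ip x (B * x))) \<le> 0"
        by (simp add: algebra_simps)
      then show ?thesis using q(2) by (simp add: mult_le_0_iff)
    qed
    then have "ip v (B * x) - ip x (B * v) = 0" by (rule linear_le_quadratic_imp_zero)
    then show ?thesis by (simp add: v_def x_def ip_mu)
  qed
  show "tp B = B"
  proof (rule fmat_eqI)
    fix a b
    have z: "ent B i j = 0" if "d \<le> i \<or> d \<le> j" for i j
      using that B idm_times_iff[of d B] times_idm_iff[of B d] by auto
    show "ent (tp B) a b = ent B a b"
      using sym[of b a] z[of a b] z[of b a] by (cases "a < d \<and> b < d"; cases "a = b") auto
  qed
qed

text \<open>
  These conditions hold for every nearest orthogonal matrix, also when \<open>Y\<close> is singular and there are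
  several of them, so results about \<open>polar_factor\<close> do not depend on the selection.
\<close>

definition polar_factor :: "nat \<Rightarrow> fmat \<Rightarrow> fmat \<Rightarrow> bool" where
  "polar_factor d Y P \<longleftrightarrow>
     orthf d P \<and> tp (tp P * Y) = tp P * Y \<and> (\<forall>X. 0 \<le> ip X (tp P * Y * X))"

lemma polar_factorI:
  assumes P: "orthf d P" and Y: "idm d * Y = Y" "Y * idm d = Y"
    and max: "\<And>U. orthf d U \<Longrightarrow> ip U Y \<le> ip P Y"
  shows "polar_factor d Y P"
proof -
  note P' = orthfD[OF P]
  have B: "idm d * (tp P * Y) = tp P * Y" "tp P * Y * idm d = tp P * Y"
    by (simp_all add: P' flip: mult.assoc) (simp add: mult.assoc Y)
  have "ip U (tp P * Y) \<le> ip (idm d) (tp P * Y)" if "orthf d U" for U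
  proof -
    have "ip U (tp P * Y) = ip (P * U) Y" by (simp add: ip_times_left)
    also have "\<dots> \<le> ip P Y" using max[OF orthf_mult[OF P that]] .
    also have "\<dots> = ip (idm d) (tp P * Y)" using P' by (simp flip: ip_times_left)
    finally show ?thesis .
  qed
  from trace_maximal_imp_psd[OF B this] show ?thesis using P by (simp add: polar_factor_def)
qed

text \<open>
  The product of \<open>B + I\<close> and \<open>B - I\<close> is \<open>B\<^sup>2 - I\<close>, and the first factor expands lengths.
\<close>

lemma psd_near_id:
  assumes "idm d * B = B" "B * idm d = B" "\<And>X. 0 \<le> ip X (B * X)"
  shows "norm (B - idm d) \<le> norm (B * B - idm d)"
proof (rule norm_leI)
  fix Y
  define w where "w = (B - idm d) * Y"
  have ew: "idm d * w = w" using assms by (simp add: w_def right_diff_distrib flip: mult.assoc)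
  have "(B * B - idm d) * Y = B * w + w"
    by (simp add: w_def algebra_simps assms flip: mult.assoc)
  then have "(fr ((B * B - idm d) * Y))\<^sup>2 = ip (B * w) (B * w) + 2 * ip w (B * w) + ip w w"
    by (simp add: fr_square ip_distribs ip_commute[of "B * w" w])
  then have "(fr w)\<^sup>2 \<le> (fr ((B * B - idm d) * Y))\<^sup>2"
    using assms(3)[of w] by (simp add: fr_square)
  then have "fr w \<le> fr ((B * B - idm d) * Y)" by (rule power2_le_imp_le) simp
  also have "\<dots> \<le> norm (B * B - idm d) * fr Y" by (rule fr_times_le_norm)
  finally show "fr ((B - idm d) * Y) \<le> norm (B * B - idm d) * fr Y" by (simp add: w_def)
qed simp

lemma norm_mult_le: "norm (A::fmat) \<le> a \<Longrightarrow> norm B \<le> b \<Longrightarrow> norm (A * B) \<le> a * b"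
  by (meson mult_mono norm_ge_zero norm_mult_ineq order_trans)

lemma norm_mult_le_left: "norm (A::fmat) \<le> a \<Longrightarrow> norm B \<le> 1 \<Longrightarrow> norm (A * B) \<le> a"
  using norm_mult_le[of A a B 1] by simp
lemma norm_mult_le_right: "norm (A::fmat) \<le> 1 \<Longrightarrow> norm B \<le> b \<Longrightarrow> norm (A * B) \<le> b"
  using norm_mult_le[of A 1 B b] by simp

lemma norm_add_le: "norm (A::fmat) \<le> a \<Longrightarrow> norm B \<le> b \<Longrightarrow> norm (A + B) \<le> a + b"
  by (rule norm_triangle_mono)
lemma norm_diff_le: "norm (A::fmat) \<le> a \<Longrightarrow> norm B \<le> b \<Longrightarrow> norm (A - B) \<le> a + b"
  by (meson add_mono norm_triangle_ineq4 order_trans)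

text \<open>
  Take \<open>R = I\<close>. The symmetric factor \<open>B = P\<^sup>T Y\<close> satisfies \<open>B\<^sup>2 = Y\<^sup>T Y = I + X + X\<^sup>T + X\<^sup>T X\<close>. With
  \<open>D = B - I\<close> this gives \<open>D = (X + X\<^sup>T)/2\<close> to first order, and then \<open>P B = I + X\<close> gives \<open>P = I + X - D\<close>
  to first order. As \<open>P\<close> is orthogonal, the remainder is explicit and \<open>Y\<close> need not be inverted.
\<close>

lemma polar_factor_expansion:
  assumes P: "polar_factor d Y P" and Y: "Y = (idm d + X) * R" and R: "orthf d R"
    and X: "idm d * X = X" "X * idm d = X" "norm X \<le> r" "r \<le> 1"
  shows "norm (P - (idm d + (1/2) *\<^sub>R (X - tp X)) * R) \<le> 17 * r\<^sup>2"
proof -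
  have Po: "orthf d P" and sym: "tp (tp P * Y) = tp P * Y" and psd: "\<And>X. 0 \<le> ip X (tp P * Y * X)"
    using P by (auto simp: polar_factor_def)
  note R' = orthfD[OF R]
  have r0: "0 \<le> r" using X(3) norm_ge_zero[of X] by linarith
  define e where "e = idm d"
  define A where "A = P * tp R"
  have Ao: "orthf d A" unfolding A_def by (intro orthf_mult Po orthf_tp R)
  note A' = orthfD[OF Ao]
  define B where "B = tp A * (e + X)"
  have ee: "e * e = e" by (simp add: e_def)
  have eX: "e * X = X" "X * e = X" using X by (auto simp: e_def)
  have teX: "tp X * e = tp X" "e * tp X = tp X" using eX by (metis e_def tp_idm tp_times)+
  have B1: "B = R * (tp P * Y) * tp R"
  proof -
    have "R * (tp P * Y) * tp R = R * tp P * (e + X) * (R * tp R)"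
      by (simp add: Y e_def mult.assoc)
    also have "\<dots> = R * tp P * (e + X)"
      by (simp add: R' mult.assoc distrib_right eX flip: e_def) (simp add: ee)
    finally show ?thesis by (simp add: B_def A_def)
  qed
  have Bsym: "tp B = B" using sym by (simp add: B1 mult.assoc)
  have Bpsd: "0 \<le> ip T (B * T)" for T
  proof -
    have "ip T (B * T) = ip (tp R * T) (tp P * Y * (tp R * T))"
      by (simp add: B1 ip_times_left mult.assoc)
    then show ?thesis using psd by simp
  qed
  have Be: "e * B = B" "B * e = B"
    by (simp_all add: B_def e_def A' flip: mult.assoc) (simp add: mult.assoc distrib_right X)
  have AB: "A * B = e + X"
    by (simp add: B_def mult.assoc[symmetric] A' distrib_left flip: e_def) (simp add: ee eX)
  have BB: "B * B = e + X + tp X + tp X * X"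
  proof -
    have "B * B = tp B * B" by (simp add: Bsym)
    also have "\<dots> = (e + tp X) * (A * B)" by (simp add: B_def mult.assoc e_def)
    also have "\<dots> = e + X + tp X + tp X * X" by (simp add: AB algebra_simps ee eX teX)
    finally show ?thesis .
  qed
  define D where "D = B - e"
  have "norm (B * B - e) \<le> r + r + r * r"
  proof -
    have "B * B - e = X + tp X + tp X * X" by (simp add: BB)
    then show ?thesis using X by (metis norm_add_le norm_mult_le norm_tp)
  qed
  also have "\<dots> \<le> 3 * r" using mult_left_mono[OF \<open>r \<le> 1\<close> r0] by simp
  finally have D: "norm D \<le> 3 * r"
    using psd_near_id[of d B] Be Bpsd by (simp add: D_def e_def)
  have DD: "D + D + D * D = X + tp X + tp X * X"
  proof -
    have "D + D + D * D = B * B - e" by (simp add: D_def algebra_simps Be ee)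
    then show ?thesis by (simp add: BB)
  qed
  have AD: "A * D = e + X - A" by (simp add: D_def right_diff_distrib AB) (simp add: e_def A')
  have Ae: "norm (A - e) \<le> r + 3 * r"
  proof -
    have "A - e = X - A * D" by (simp add: AD)
    then show ?thesis using X D A' by (metis norm_diff_le norm_mult_le_right)
  qed
  have "A - (e + (1/2) *\<^sub>R (X - tp X)) = (1/2) *\<^sub>R (D * D - tp X * X) - (A - e) * D"
  proof -
    have "e * D = D" by (simp add: D_def right_diff_distrib Be ee)
    then have 1: "(A - e) * D = e + X - A - D" by (simp add: left_diff_distrib AD)
    have 2: "D * D - tp X * X = X + tp X - D - D" using DD by (simp add: algebra_simps)
    have 3: "(1/2) *\<^sub>R (X + tp X - D - D) = (1/2) *\<^sub>R (X + tp X) - D"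
      by (intro fmat_eqI) (simp add: field_simps)
    have 4: "(1/2) *\<^sub>R (X - tp X) = X - (1/2) *\<^sub>R (X + tp X)"
      by (intro fmat_eqI) (simp add: field_simps)
    show ?thesis unfolding 1 2 3 4 by (simp add: algebra_simps)
  qed
  also have "norm \<dots> \<le> (1/2) * (3 * r * (3 * r) + r * r) + (r + 3 * r) * (3 * r)"
  proof (rule norm_diff_le)
    have "norm (D * D - tp X * X) \<le> 3 * r * (3 * r) + r * r"
      using X(3) D by (intro norm_diff_le norm_mult_le) auto
    then show "norm ((1/2) *\<^sub>R (D * D - tp X * X)) \<le> (1/2) * (3 * r * (3 * r) + r * r)" by simp
    show "norm ((A - e) * D) \<le> (r + 3 * r) * (3 * r)" using Ae D by (rule norm_mult_le)
  qed
  also have "\<dots> = 17 * r\<^sup>2" by (simp add: power2_eq_square)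
  finally have fin: "norm (A - (e + (1/2) *\<^sub>R (X - tp X))) \<le> 17 * r\<^sup>2" .
  have "P = A * R" by (simp add: A_def mult.assoc R') (simp add: orthfD[OF Po])
  then have "P - (idm d + (1/2) *\<^sub>R (X - tp X)) * R = (A - (e + (1/2) *\<^sub>R (X - tp X))) * R"
    by (simp add: e_def algebra_simps)
  then show ?thesis using norm_mult_le_left[OF fin R'(7)] by simp
qed

section \<open>Blocks, and transfer from carrier-based matrices\<close>

definition of_mat :: "real mat \<Rightarrow> fmat" where
  "of_mat A = Abs_fmat (\<lambda>i j. if i < dim_row A \<and> j < dim_col A then A $$ (i, j) else 0)"

definition to_mat :: "nat \<Rightarrow> nat \<Rightarrow> fmat \<Rightarrow> real mat" where
  "to_mat m n A = mat m n (\<lambda>(i, j). ent A i j)"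

definition of_vec :: "real vec \<Rightarrow> fmat" where
  "of_vec v = Abs_fmat (\<lambda>i j. if i < dim_vec v \<and> j = 0 then v $ i else 0)"

lemma ent_of_mat [simp]:
  "ent (of_mat A) i j = (if i < dim_row A \<and> j < dim_col A then A $$ (i, j) else 0)"
  unfolding of_mat_def by (subst ent_Abs[of "max (dim_row A) (dim_col A)"]) auto

lemma ent_of_vec [simp]: "ent (of_vec v) i j = (if i < dim_vec v \<and> j = 0 then v $ i else 0)"
  unfolding of_vec_def by (subst ent_Abs[of "max 1 (dim_vec v)"]) auto

lemma col_of_vec: "is_col (of_vec v)" by (simp add: col_ent)

lemma to_mat_carrier [simp]: "to_mat m n A \<in> carrier_mat m n"
  "dim_row (to_mat m n A) = m" "dim_col (to_mat m n A) = n" by (auto simp: to_mat_def)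

lemma of_mat_to_mat: "of_mat (to_mat m n A) = idm m * A * idm n"
  by (rule fmat_eqI) (simp add: to_mat_def)

lemma of_mat_dims: assumes "A \<in> carrier_mat m n"
  shows "idm m * of_mat A = of_mat A" "of_mat A * idm n = of_mat A"
  using assms by (auto simp: idm_times_iff times_idm_iff)

lemma of_mat_inj: assumes "A \<in> carrier_mat m n" "B \<in> carrier_mat m n" "of_mat A = of_mat B"
  shows "A = B"
proof (rule eq_matI)
  fix i j assume "i < dim_row B" "j < dim_col B"
  then have "ent (of_mat A) i j = A $$ (i, j)" "ent (of_mat B) i j = B $$ (i, j)"
    using assms(1,2) by auto
  then show "A $$ (i, j) = B $$ (i, j)" using assms(3) by simp
qed (use assms in auto)

lemma of_mat_simps [simp]:
  "of_mat (1\<^sub>m d) = idm d" "of_mat (0\<^sub>m m n) = 0" "of_mat (A\<^sup>T) = tp (of_mat A)"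
  "of_mat (c \<cdot>\<^sub>m A) = c *\<^sub>R of_mat A"
  by (auto intro!: fmat_eqI)

lemma of_mat_add: "A \<in> carrier_mat m n \<Longrightarrow> B \<in> carrier_mat m n \<Longrightarrow> of_mat (A + B) = of_mat A + of_mat B"
  by (rule fmat_eqI) auto

lemma of_mat_minus: "A \<in> carrier_mat m n \<Longrightarrow> B \<in> carrier_mat m n \<Longrightarrow> of_mat (A - B) = of_mat A - of_mat B"
  by (rule fmat_eqI) auto

lemma of_mat_mult:
  assumes A: "A \<in> carrier_mat m l" and B: "B \<in> carrier_mat l n"
  shows "of_mat (A * B) = of_mat A * of_mat B"
proof (rule fmat_eqI)
  fix i j
  have "ent (of_mat A * of_mat B) i j = ent (of_mat A * idm l * of_mat B) i j"
    using of_mat_dims(2)[OF A] by simp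
  also have "\<dots> = (\<Sum>k<l. ent (of_mat A) i k * ent (of_mat B) k j)"
  proof -
    obtain N where N: "supp_le N (of_mat A)" "supp_le N (of_mat B)" "supp_le N (idm l)"
      by (rule supp_le_obtain)
    have "l \<le> N" using N(3) unfolding supp_le_def
      by (metis ent_idm not_less not_less_eq order_refl zero_neq_one less_or_eq_imp_le linorder_neqE_nat)
    have "ent (of_mat A * idm l * of_mat B) i j = (\<Sum>k<N. ent (of_mat A * idm l) i k * ent (of_mat B) k j)"
      using N by (simp add: ent_times[of N])
    also have "\<dots> = (\<Sum>k<l. ent (of_mat A) i k * ent (of_mat B) k j)"
      using \<open>l \<le> N\<close> by (intro sum.mono_neutral_cong_right) (auto simp del: ent_of_mat)
    finally show ?thesis .
  qed
  also have "\<dots> = ent (of_mat (A * B)) i j"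
    using A B by (auto simp: scalar_prod_def atLeast0LessThan)
  finally show "ent (of_mat (A * B)) i j = ent (of_mat A * of_mat B) i j" by simp
qed

lemma of_mat_mult_vec:
  assumes A: "A \<in> carrier_mat m n" and v: "v \<in> carrier_vec n"
  shows "of_vec (A *\<^sub>v v) = of_mat A * of_vec v"
proof -
  have 1: "of_vec u = of_mat (mat (dim_vec u) 1 (\<lambda>(i, j). u $ i))" for u
    by (rule fmat_eqI) auto
  have "of_mat A * of_vec v = of_mat (A * mat n 1 (\<lambda>(i, j). v $ i))"
    using A v by (subst of_mat_mult[OF A]) (auto simp: 1)
  also have "A * mat n 1 (\<lambda>(i, j). v $ i) = mat m 1 (\<lambda>(i, j). (A *\<^sub>v v) $ i)"
    using A v by (intro eq_matI) (auto simp: scalar_prod_def)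
  finally show ?thesis using A v by (simp add: 1)
qed

lemma frob_inner_eq_ip:
  assumes "A \<in> carrier_mat m n" "B \<in> carrier_mat m n"
  shows "frob_inner A B = ip (of_mat A) (of_mat B)"
proof -
  have "ip (of_mat A) (of_mat B) = (\<Sum>i<max m n. \<Sum>j<max m n. ent (of_mat A) i j * ent (of_mat B) i j)"
    using assms by (intro ip_eq) (auto simp: supp_le_def)
  also have "\<dots> = (\<Sum>i<m. \<Sum>j<max m n. ent (of_mat A) i j * ent (of_mat B) i j)"
    using assms by (intro sum.mono_neutral_right) auto
  also have "\<dots> = (\<Sum>i<m. \<Sum>j<n. A $$ (i, j) * B $$ (i, j))"
    using assms by (intro sum.cong sum.mono_neutral_cong_right) auto
  finally show ?thesis using assms by (simp add: frob_inner_def)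
qed

lemma frob_norm_eq_fr: "frob_norm A = fr (of_mat A)"
  unfolding frob_norm_def fr_def by (subst frob_inner_eq_ip[of A "dim_row A" "dim_col A" A]) auto

lemma invertible_or_kernel:
  assumes B: "idm d * B = B" "B * idm d = B"
  obtains (inverse) B' where "idm d * B' = B'" "B' * idm d = B'" "B * B' = idm d" "B' * B = idm d"
    | (kernel) x where "is_col x" "idm d * x = x" "x \<noteq> 0" "B * x = 0"
proof (cases "det (to_mat d d B) = 0")
  case True
  then obtain v where v: "v \<in> carrier_vec d" "v \<noteq> 0\<^sub>v d" "to_mat d d B *\<^sub>v v = 0\<^sub>v d"
    using det_0_iff_vec_prod_zero_field[of "to_mat d d B" d] by auto
  have "B * of_vec v = of_vec (to_mat d d B *\<^sub>v v)"
    using of_mat_mult_vec[of "to_mat d d B" d d v] v B by (simp add: of_mat_to_mat)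
  also have "\<dots> = 0" by (simp add: v(3)) (rule fmat_eqI, simp)
  finally have 1: "B * of_vec v = 0" .
  have "of_vec v \<noteq> 0"
  proof
    assume z: "of_vec v = 0"
    have "v $ i = 0" if "i < d" for i
      using arg_cong[OF z, of "\<lambda>x. ent x i 0"] that v(1) by simp
    then have "v = 0\<^sub>v d" using v(1) by (intro eq_vecI) auto
    then show False using v(2) by simp
  qed
  moreover have "idm d * of_vec v = of_vec v" using v(1) by (auto simp: idm_times_iff)
  ultimately show ?thesis using 1 col_of_vec kernel by blast
next
  case False
  have "to_mat d d B \<in> Units (ring_mat TYPE(real) d ())"
    by (rule det_non_zero_imp_unit[OF _ False]) simp
  then obtain M where M: "M \<in> carrier_mat d d" "M * to_mat d d B = 1\<^sub>m d" "to_mat d d B * M = 1\<^sub>m d"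
    by (auto simp: Units_def ring_mat_def)
  have "of_mat M * B = idm d" "B * of_mat M = idm d"
    using of_mat_mult[OF M(1), of "to_mat d d B" d] of_mat_mult[of "to_mat d d B" d d M d] M B
    by (simp_all add: of_mat_to_mat)
  then show ?thesis using inverse[of "of_mat M"] of_mat_dims[OF M(1)] by simp
qed

text \<open>
  The \<open>i\<close>-th block column of the identity: multiplication by it or its transpose selects blocks.
\<close>

definition sel :: "nat \<Rightarrow> nat \<Rightarrow> fmat" where
  "sel d i = Abs_fmat (\<lambda>r c. if r = i * d + c \<and> c < d then 1 else 0)"

lemma ent_sel [simp]: "ent (sel d i) r c = (if r = i * d + c \<and> c < d then 1 else 0)"
  unfolding sel_def by (subst ent_Abs[of "i * d + d"]) auto

lemma supp_le_sel: "supp_le (i * d + d) (sel d i)" by (auto simp: supp_le_def)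

definition blk :: "nat \<Rightarrow> nat \<Rightarrow> fmat \<Rightarrow> fmat" where "blk d i A = tp (sel d i) * A"

lemma ent_blk [simp]: "ent (blk d i A) a b = (if a < d then ent A (i * d + a) b else 0)"
proof -
  have "ent (blk d i A) a b = (\<Sum>k<i*d+d. (if k = i * d + a \<and> a < d then 1 else 0) * ent A k b)"
    unfolding blk_def by (subst ent_times[OF disjI1[OF supp_le_tp[OF supp_le_sel]]]) simp
  also have "\<dots> = (\<Sum>k<i*d+d. if k = i * d + a then (if a < d then ent A k b else 0) else 0)"
    by (intro sum.cong) auto
  finally show ?thesis by (simp add: sum.delta)
qed

lemma ent_tp_sel_times [simp]: "ent (tp (sel d i) * A) a b = (if a < d then ent A (i * d + a) b else 0)"
  using ent_blk[of d i A] by (simp add: blk_def)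

lemma ent_times_sel [simp]: "ent (A * sel d i) a b = (if b < d then ent A a (i * d + b) else 0)"
  using ent_tp_sel_times[of d i "tp A" b a] by (metis ent_tp tp_simps(1) tp_times)

lemma block_index: "(i::nat) * d + a = j * d + b \<longleftrightarrow> i = j \<and> a = b" if "a < d" "b < d"
proof
  assume *: "i * d + a = j * d + b"
  have "(i * d + a) div d = i" "(j * d + b) div d = j" using that by auto
  with * show "i = j \<and> a = b" by auto
qed simp

lemma block_bound: "i < n \<Longrightarrow> a < d \<Longrightarrow> i * d + a < n * (d::nat)"
proof -
  assume "i < n" "a < d"
  then have "i * d + a < (i + 1) * d" by simp
  also have "\<dots> \<le> n * d" using \<open>i < n\<close> by (intro mult_right_mono) auto
  finally show ?thesis .
qed

lemma sel_sel: "tp (sel d i) * sel d j = (if i = j then idm d else 0)"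
  by (rule fmat_eqI) (auto simp: block_index)

lemma sel_dims: "sel d i * idm d = sel d i" "i < n \<Longrightarrow> idm (n * d) * sel d i = sel d i"
  "idm d * tp (sel d i) = tp (sel d i)" "i < n \<Longrightarrow> tp (sel d i) * idm (n * d) = tp (sel d i)"
  using block_bound by (fastforce intro!: fmat_eqI)+

lemma norm_sel: "norm (sel d i) \<le> 1" "norm (tp (sel d i)) \<le> 1"
  using norm_proj_le_1[of "sel d i" d] by (simp_all add: sel_sel)

lemma norm_blk: "norm (blk d i A) \<le> norm A"
  unfolding blk_def using norm_mult_le_right[OF norm_sel(2) order_refl] .

lemma ent_sum: "ent (sum f I) a b = (\<Sum>i\<in>I. ent (f i) a b)"
  by (induction I rule: infinite_finite_induct) auto

lemma ent_proj: assumes d: "0 < d"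
  shows "ent (sel d i * tp (sel d i)) r c = (if r = c \<and> r div d = i then 1 else 0)"
proof -
  have "ent (sel d i * tp (sel d i)) r c
      = (\<Sum>k<i*d+d. (if r = i * d + k \<and> k < d then 1 else 0) * (if c = i * d + k \<and> k < d then 1 else 0))"
    by (subst ent_times[OF disjI1[OF supp_le_sel]]) simp
  also have "\<dots> = (\<Sum>k<i*d+d. if k = r mod d then (if i = r div d \<and> r = c then 1 else 0) else 0)"
  proof (intro sum.cong refl)
    fix k
    have "r = i * d + k \<and> k < d \<longleftrightarrow> i = r div d \<and> k = r mod d"
      using d by auto
    then show "(if r = i * d + k \<and> k < d then 1 else 0) * (if c = i * d + k \<and> k < d then 1 else 0)
        = (if k = r mod d then (if i = r div d \<and> r = c then 1 else 0) else (0::real))" by auto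
  qed
  also have "\<dots> = (if r = c \<and> r div d = i then 1 else 0)"
    using mod_less_divisor[of d r] d by (auto simp: sum.delta trans_less_add2)
  finally show ?thesis .
qed

lemma sum_sel: assumes d: "0 < d" shows "(\<Sum>i<n. sel d i * tp (sel d i)) = idm (n * d)"
proof (rule fmat_eqI)
  fix r c
  have "r div d < n \<longleftrightarrow> r < n * d" using d by (simp add: div_less_iff_less_mult)
  then show "ent (\<Sum>i<n. sel d i * tp (sel d i)) r c = ent (idm (n * d)) r c"
    by (cases "r = c") (simp_all add: ent_sum ent_proj[OF d])
qed

lemma tp_times_blocks:
  assumes d: "0 < d" and "idm (n * d) * B = B" shows "tp A * B = (\<Sum>i<n. tp (blk d i A) * blk d i B)"
proof -
  have "tp A * B = tp A * (idm (n * d) * B)" by (simp add: assms)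
  also have "\<dots> = (\<Sum>i<n. tp (blk d i A) * blk d i B)"
    unfolding sum_sel[OF d, symmetric] blk_def sum_distrib_right sum_distrib_left by (simp add: mult.assoc)
  finally show ?thesis .
qed

lemma of_mat_row_block:
  assumes "A \<in> carrier_mat (n * d) d" "i < n"
  shows "of_mat (row_block d A i) = blk d i (of_mat A)"
  using assms block_bound[of i n _ d] by (intro fmat_eqI) (auto simp: block_def)

lemma orth_iff_orthf: assumes "U \<in> carrier_mat d d"
  shows "U \<in> orth d \<longleftrightarrow> orthf d (of_mat U)"
proof -
  have "U * U\<^sup>T = 1\<^sub>m d \<longleftrightarrow> of_mat U * tp (of_mat U) = idm d"
    using of_mat_mult[of U d d "U\<^sup>T" d] of_mat_inj[of "U * U\<^sup>T" d d "1\<^sub>m d"] assms by auto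
  moreover have "U\<^sup>T * U = 1\<^sub>m d \<longleftrightarrow> tp (of_mat U) * of_mat U = idm d"
    using of_mat_mult[of "U\<^sup>T" d d U d] of_mat_inj[of "U\<^sup>T * U" d d "1\<^sub>m d"] assms by auto
  ultimately show ?thesis using assms of_mat_dims[OF assms] by (auto simp: orth_def orthf_def)
qed

lemma ip_orthf_self: assumes "orthf d U" shows "ip U U = d"
  using ip_times_left[of U "idm d" U] orthfD[OF assms] fr_square[of "idm d"] by (simp add: fr_idm)

text \<open>
  Orthogonal matrices have the same Frobenius norm, so minimising the distance to \<open>Y\<close> is the same as
  maximising the inner product with \<open>Y\<close>.
\<close>

lemma polar_retraction_polar_factor:
  assumes P: "polar_retraction d P" and Y: "Y \<in> carrier_mat d d"
  shows "P Y \<in> carrier_mat d d" "polar_factor d (of_mat Y) (of_mat (P Y))"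
proof -
  have arg: "is_arg_min (\<lambda>U. (frob_norm (U - Y))\<^sup>2) (\<lambda>U. U \<in> orth d) (P Y)"
    using P Y by (auto simp: polar_retraction_def)
  then have o: "P Y \<in> orth d" by (auto simp: is_arg_min_def)
  then show c: "P Y \<in> carrier_mat d d" by (auto simp: orth_def)
  have of: "orthf d (of_mat (P Y))" using o orth_iff_orthf[OF c] by simp
  have e: "(frob_norm (U - Y))\<^sup>2 = d - 2 * ip (of_mat U) (of_mat Y) + ip (of_mat Y) (of_mat Y)"
    if "U \<in> orth d" for U
  proof -
    have U: "U \<in> carrier_mat d d" using that by (auto simp: orth_def)
    have "orthf d (of_mat U)" using that orth_iff_orthf[OF U] by simp
    then have "ip (of_mat U) (of_mat U) = d" by (rule ip_orthf_self)
    then show ?thesis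
      using ip_commute[of "of_mat Y" "of_mat U"]
      by (simp add: frob_norm_eq_fr fr_square of_mat_minus[OF U Y] ip_distribs)
  qed
  show "polar_factor d (of_mat Y) (of_mat (P Y))"
  proof (rule polar_factorI[OF of of_mat_dims[OF Y]])
    fix U assume U: "orthf d U"
    have U': "of_mat (to_mat d d U) = U" using orthfD[OF U] by (simp add: of_mat_to_mat)
    have "to_mat d d U \<in> orth d" using U by (simp add: orth_iff_orthf U')
    then have "\<not> (frob_norm (to_mat d d U - Y))\<^sup>2 < (frob_norm (P Y - Y))\<^sup>2"
      using arg by (auto simp: is_arg_min_def)
    then show "ip U (of_mat Y) \<le> ip (of_mat (P Y)) (of_mat Y)"
      unfolding e[OF o] e[OF \<open>to_mat d d U \<in> orth d\<close>] U' by simp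
  qed
qed

text \<open>
  Apply \<open>A - I\<close> to an eigenvector.
\<close>

lemma eigenvalue_near_1:
  assumes A: "A \<in> carrier_mat d d" and l: "l \<in> spectrum A"
  shows "\<bar>l - 1\<bar> \<le> norm (of_mat A - idm d)"
proof -
  obtain v where v: "v \<in> carrier_vec d" "v \<noteq> 0\<^sub>v d" "A *\<^sub>v v = l \<cdot>\<^sub>v v"
    using l A by (auto simp: spectrum_def eigenvalue_def eigenvector_def)
  have "of_mat A * of_vec v = of_vec (l \<cdot>\<^sub>v v)" using of_mat_mult_vec[OF A v(1)] v(3) by simp
  also have "\<dots> = l *\<^sub>R of_vec v" by (rule fmat_eqI) auto
  finally have 1: "of_mat A * of_vec v = l *\<^sub>R of_vec v" .
  have "idm d * of_vec v = of_vec v" using v(1) by (auto simp: idm_times_iff)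
  then have "(of_mat A - idm d) * of_vec v = (l - 1) *\<^sub>R of_vec v"
    by (simp add: left_diff_distrib 1 scaleR_left_diff_distrib)
  then have 2: "\<bar>l - 1\<bar> * fr (of_vec v) \<le> norm (of_mat A - idm d) * fr (of_vec v)"
    using fr_times_le_norm[of "of_mat A - idm d" "of_vec v"] by simp
  have "of_vec v \<noteq> 0"
  proof
    assume z: "of_vec v = 0"
    have "v $ i = 0" if "i < d" for i
      using arg_cong[OF z, of "\<lambda>x. ent x i 0"] that v(1) by simp
    then have "v = 0\<^sub>v d" using v(1) by (intro eq_vecI) auto
    then show False using v(2) by simp
  qed
  then have "fr (of_vec v) > 0" using fr_nonneg[of "of_vec v"] fr_eq_0[of "of_vec v"] by linarith
  then show ?thesis using 2 by simp
qed

text \<open>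
  A complex eigenvalue exists; it is real because the Hermitian form of a real symmetric matrix is real,
  and then it is a root of the real characteristic polynomial.
\<close>

lemma symmetric_spectrum:
  fixes A :: "real mat"
  assumes A: "A \<in> carrier_mat d d" and sym: "A\<^sup>T = A" and d: "0 < d"
  shows "finite (spectrum A)" "spectrum A \<noteq> {}"
proof -
  show "finite (spectrum A)" using card_finite_spectrum[OF A] by simp
  let ?A = "map_mat complex_of_real A"
  have A': "?A \<in> carrier_mat d d" using A by simp
  obtain k where "k \<in> spectrum ?A" using spectrum_non_empty[OF A' d] by blast
  then have ev: "eigenvalue ?A k" by (simp add: spectrum_def)
  then obtain v where v: "v \<in> carrier_vec d" "v \<noteq> 0\<^sub>v d" "?A *\<^sub>v v = k \<cdot>\<^sub>v v"
    using A by (auto simp: eigenvalue_def eigenvector_def)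
  define s where "s = (\<Sum>i<d. cnj (v $ i) * v $ i)"
  have Av: "(\<Sum>j<d. of_real (A $$ (i, j)) * v $ j) = k * v $ i" if "i < d" for i
    using arg_cong[OF v(3), of "\<lambda>u. u $ i"] that v(1) A
    by (simp add: scalar_prod_def atLeast0LessThan)
  have symA: "A $$ (i, j) = A $$ (j, i)" if "i < d" "j < d" for i j
    using arg_cong[OF sym, of "\<lambda>M. M $$ (j, i)"] that A by simp
  have "k * s = (\<Sum>i<d. cnj (v $ i) * (\<Sum>j<d. of_real (A $$ (i, j)) * v $ j))"
    unfolding s_def sum_distrib_left[of k] by (intro sum.cong refl) (simp add: Av)
  also have "\<dots> = (\<Sum>i<d. \<Sum>j<d. cnj (v $ i) * of_real (A $$ (i, j)) * v $ j)"
    by (simp add: sum_distrib_left mult.assoc)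
  finally have ks: "k * s = (\<Sum>i<d. \<Sum>j<d. cnj (v $ i) * of_real (A $$ (i, j)) * v $ j)" .
  have "cnj (k * s) = (\<Sum>i<d. \<Sum>j<d. cnj (v $ j) * of_real (A $$ (j, i)) * v $ i)"
    unfolding ks cnj_sum by (intro sum.cong refl) (simp add: symA mult_ac)
  also have "\<dots> = k * s" unfolding ks by (rule sum.swap)
  finally have 1: "cnj (k * s) = k * s" .
  have s_re: "s = of_real (\<Sum>i<d. (cmod (v $ i))\<^sup>2)"
    unfolding s_def of_real_sum by (intro sum.cong refl) (metis complex_norm_square mult.commute of_real_power)
  have "s \<noteq> 0"
  proof
    assume "s = 0"
    then have "(\<Sum>i<d. (cmod (v $ i))\<^sup>2) = 0" unfolding s_re by (simp only: of_real_eq_0_iff)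
    then have "\<forall>i<d. v $ i = 0" by (subst (asm) sum_nonneg_eq_0_iff) auto
    then have "v = 0\<^sub>v d" using v(1) by (intro eq_vecI) auto
    then show False using v(2) by simp
  qed
  moreover have "cnj s = s" by (simp add: s_re)
  ultimately have "cnj k = k" using 1 by simp
  then obtain r where r: "k = complex_of_real r" by (metis Reals_cnj_iff Reals_cases)
  have "poly (char_poly ?A) k = 0" using ev eigenvalue_root_char_poly[OF A'] by simp
  then have "poly (map_poly complex_of_real (char_poly A)) (complex_of_real r) = 0"
    by (simp add: r of_real_hom.char_poly_hom[OF A])
  then have "poly (char_poly A) r = 0" by simp
  then show "spectrum A \<noteq> {}" using eigenvalue_root_char_poly[OF A] by (auto simp: spectrum_def)
qed

lemma orthogonal_blocks_gram:
  assumes d: "0 < d" and Z: "idm (n * d) * Z = Z" "\<And>i. i < n \<Longrightarrow> orthf d (blk d i Z)"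
  shows "tp Z * Z = real n *\<^sub>R idm d"
proof -
  have "tp Z * Z = (\<Sum>i<n. tp (blk d i Z) * blk d i Z)" by (rule tp_times_blocks[OF d Z(1)])
  also have "\<dots> = (\<Sum>i<n. idm d)" using Z(2) by (intro sum.cong) (auto dest: orthfD)
  finally show ?thesis by (simp add: sum_constant_scaleR)
qed

section \<open>The top eigenspace as a graph over the signal\<close>

lemma fmat_eq_columns:
  assumes "M * idm d = M" "\<And>j. j < d \<Longrightarrow> M * mu j 0 = 0" shows "M = 0"
proof (rule fmat_eqI)
  fix a b
  show "ent M a b = ent 0 a b"
  proof (cases "b < d")
    case True
    have "ent M a b = ent (M * mu b 0) a 0" by simp
    then show ?thesis using assms(2)[OF True] by simp
  next
    case False
    then show ?thesis using assms(1) times_idm_iff[of M d] by simp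
  qed
qed

text \<open>
  Dividing by \<open>c\<^sup>2\<close> turns the hypothesis into a quadratic inequality in the tangent \<open>t\<close> of the angle, whose
  linear term must vanish.
\<close>

lemma rotation_quadratic:
  fixes p b :: real
  assumes "\<And>c s. c\<^sup>2 + s\<^sup>2 = 1 \<Longrightarrow> s\<^sup>2 * p + 2 * s * c * b \<le> 0"
  shows "p \<le> 0" "b = 0"
proof -
  show p: "p \<le> 0" using assms[of 0 1] by simp
  have "t * (- 2 * b) \<le> t\<^sup>2 * (- p)" for t
  proof -
    define c where "c = 1 / sqrt (1 + t\<^sup>2)"
    have pos: "1 + t\<^sup>2 > 0" by (simp add: add_pos_nonneg)
    have c2: "c\<^sup>2 * (1 + t\<^sup>2) = 1" using pos by (simp add: c_def power_divide)
    have "c\<^sup>2 + (- (c * t))\<^sup>2 = 1" using c2 by (simp add: algebra_simps power_mult_distrib)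
    from assms[OF this] have "c\<^sup>2 * (t\<^sup>2 * p - 2 * t * b) \<le> 0"
      by (simp add: algebra_simps power2_eq_square)
    moreover have "c\<^sup>2 > 0" using pos by (simp add: c_def)
    ultimately show ?thesis by (simp add: mult_le_0_iff)
  qed
  then have "- 2 * b = 0" by (rule linear_le_quadratic_imp_zero)
  then show "b = 0" by simp
qed

lemma ip_ge_0_pos: "x \<noteq> 0 \<Longrightarrow> ip x x > 0"
  using ip_nonneg[of x] ip_eq_0[of x] by linarith

text \<open>
  The spectral theorem is avoided: all that is needed about \<open>S\<close> is derived from its maximality.
\<close>

locale top_eigenspace =
  fixes N d :: nat and m :: real and C S :: fmat
  assumes m: "0 < m" and symC: "tp C = C"
    and S: "idm N * S = S" "S * idm d = S" "tp S * S = m *\<^sub>R idm d"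
    and max: "\<And>S'. idm N * S' = S' \<Longrightarrow> S' * idm d = S' \<Longrightarrow> tp S' * S' = m *\<^sub>R idm d \<Longrightarrow>
      ip C (S' * tp S') \<le> ip C (S * tp S)"
begin

lemma ip_S: "idm d * x = x \<Longrightarrow> ip (S * x) (S * y) = m * ip x y"
proof -
  assume x: "idm d * x = x"
  have "ip (S * x) (S * y) = ip (tp S * S * x) y"
    by (metis ip_commute ip_times_left mult.assoc)
  then show ?thesis using x by (simp add: S)
qed

text \<open>
  Replacing \<open>S x\<close> by \<open>c S x + s w\<close>, where \<open>c\<^sup>2 + s\<^sup>2 = 1\<close>, and leaving \<open>S\<close> unchanged on the orthogonal
  complement of \<open>x\<close> is a feasible variation. The gain in the objective is a quadratic form in \<open>(c, s)\<close>.
\<close>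

lemma first_order:
  assumes x: "is_col x" "idm d * x = x" "ip x x = 1"
    and w: "is_col w" "idm N * w = w" "tp S * w = 0" "ip w w = m"
  shows "ip w (C * w) \<le> ip (S * x) (C * (S * x))" "ip (S * x) (C * w) = 0"
proof -
  let ?u = "S * x"
  have uu: "ip ?u ?u = m" using ip_S[OF x(2)] x(3) by simp
  have uw: "ip ?u w = 0" by (simp add: ip_times_left w)
  have colu: "is_col ?u" by (rule col_times[OF x(1)])
  have Ceq: "ip v (C * u) = ip u (C * v)" for u v
    by (metis ip_commute ip_times_left symC)
  have "s\<^sup>2 * (ip w (C * w) - ip ?u (C * ?u)) + 2 * s * c * ip ?u (C * w) \<le> 0"
    if cs: "c\<^sup>2 + s\<^sup>2 = 1" for c s
  proof -
    define q where "q = (c - 1) *\<^sub>R ?u + s *\<^sub>R w"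
    have colq: "is_col q" by (simp add: q_def col_add col_scaleR colu w)
    have qq: "ip q q = 2 * m * (1 - c)"
    proof -
      have "ip q q = m * (c\<^sup>2 + s\<^sup>2 + 1 - 2 * c)"
        by (simp add: q_def ip_distribs uu uw ip_commute[of w ?u] w) (simp add: algebra_simps power2_eq_square)
      then show ?thesis by (simp add: cs algebra_simps)
    qed
    have Sq: "tp S * q = ((c - 1) * m) *\<^sub>R x"
    proof -
      have "tp S * q = (c - 1) *\<^sub>R (tp S * S * x) + s *\<^sub>R (tp S * w)"
        by (simp add: q_def distrib_left mult.assoc)
      then show ?thesis by (simp add: S x w)
    qed
    have qS: "tp q * S = ((c - 1) * m) *\<^sub>R tp x" using arg_cong[OF Sq, of tp] by simp
    have tx: "tp x * idm d = tp x" using x(2) by (metis tp_idm tp_times)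
    define S' where "S' = S + q * tp x"
    have "idm N * q = q"
      by (simp add: q_def distrib_left w) (simp add: S flip: mult.assoc)
    then have 1: "idm N * S' = S'" by (simp add: S'_def distrib_left S flip: mult.assoc)
    have 2: "S' * idm d = S'" by (simp add: S'_def distrib_right S mult.assoc tx)
    have "x * (tp q * q) * tp x = ip q q *\<^sub>R (x * tp x)"
    proof -
      have "x * (tp q * q) = ip q q *\<^sub>R (x * mu 0 0)" by (simp add: col_tp_times[OF colq colq])
      then show ?thesis using x(1) by (simp add: is_col_def)
    qed
    then have xqqx: "x * tp q * (q * tp x) = ip q q *\<^sub>R (x * tp x)" by (simp add: mult.assoc)
    have "tp S' * S' = tp S * S + (tp S * q) * tp x + x * (tp q * S) + x * tp q * (q * tp x)"
      by (simp add: S'_def distrib_left distrib_right mult.assoc)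
    also have "\<dots> = m *\<^sub>R idm d"
      unfolding xqqx Sq qS qq S(3) by (rule fmat_eqI) (simp add: algebra_simps)
    finally have 3: "tp S' * S' = m *\<^sub>R idm d" .
    have xx: "x * tp x * x = x"
      using col_tp_times[OF x(1) x(1)] x by (simp add: mult.assoc is_col_def)
    have "q * tp x * (x * tp q) = q * (tp x * x) * tp q" by (simp add: mult.assoc)
    also have "\<dots> = (q * mu 0 0) * tp q" by (simp add: col_tp_times[OF x(1) x(1)] x(3))
    also have "q * mu 0 0 = q" using colq by (simp add: is_col_def)
    finally have qxxq: "q * tp x * (x * tp q) = q * tp q" .
    have "S' * tp S' = S * tp S + ?u * tp q + q * tp ?u + q * tp q"
      by (simp add: S'_def distrib_left distrib_right qxxq) (simp add: mult.assoc)
    then have "ip C (S' * tp S') = ip C (S * tp S) + (ip ?u (C * q) + ip q (C * ?u) + ip q (C * q))"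
      by (simp add: ip_commute[of C] ip_distribs ip_outer del: tp_times)
    with max[OF 1 2 3] have "ip ?u (C * q) + ip q (C * ?u) + ip q (C * q) \<le> 0" by simp
    moreover have "ip ?u (C * q) + ip q (C * ?u) + ip q (C * q)
        = (c\<^sup>2 - 1) * ip ?u (C * ?u) + 2 * s * c * ip ?u (C * w) + s\<^sup>2 * ip w (C * w)"
      by (simp add: q_def ip_distribs distrib_left Ceq[of w ?u])
         (simp add: algebra_simps power2_eq_square)
    moreover have "c\<^sup>2 - 1 = - s\<^sup>2" using cs by simp
    ultimately show ?thesis by (simp add: algebra_simps)
  qed
  from rotation_quadratic[OF this]
  show "ip w (C * w) \<le> ip (S * x) (C * (S * x))" "ip (S * x) (C * w) = 0" by auto
qed

lemma orthogonal_complement: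
  assumes x: "is_col x" "idm d * x = x" "ip x x = 1"
    and w: "is_col w" "idm N * w = w" "tp S * w = 0"
  shows "ip w (C * w) \<le> ip (S * x) (C * (S * x)) / m * ip w w" "ip (S * x) (C * w) = 0"
proof -
  have "ip w (C * w) \<le> ip (S * x) (C * (S * x)) / m * ip w w \<and> ip (S * x) (C * w) = 0"
  proof (cases "w = 0")
    case False
    define r where "r = sqrt (m / ip w w)"
    have pos: "ip w w > 0" using ip_ge_0_pos[OF False] .
    have r: "r > 0" "r * r = m / ip w w" using pos m by (auto simp: r_def)
    have "is_col (r *\<^sub>R w)" "idm N * (r *\<^sub>R w) = r *\<^sub>R w" "tp S * (r *\<^sub>R w) = 0" "ip (r *\<^sub>R w) (r *\<^sub>R w) = m"
      using w pos r False by (simp_all add: col_scaleR flip: mult.assoc)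
    from first_order[OF x this] r pos m show ?thesis
      by (simp add: field_simps flip: mult.assoc)
  qed simp
  then show "ip w (C * w) \<le> ip (S * x) (C * (S * x)) / m * ip w w" "ip (S * x) (C * w) = 0" by auto
qed

definition "\<Lambda> = (1 / m) *\<^sub>R (tp S * C * S)"

text \<open>
  The columns of \<open>C S - S \<Lambda>\<close> are orthogonal to the range of \<open>S\<close>, hence by the first-order condition also to
  the columns of \<open>C S\<close>; so each of them is orthogonal to itself.
\<close>

lemma invariant: "C * S = S * \<Lambda>" if CN: "idm N * C = C"
proof -
  define M where "M = C * S - S * \<Lambda>"
  have NM: "idm N * M = M" by (simp add: M_def right_diff_distrib S CN flip: mult.assoc)
  have SM: "tp S * M = 0"
  proof -
    have "tp S * M = tp S * C * S - (tp S * S) * \<Lambda>" by (simp add: M_def right_diff_distrib mult.assoc)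
    also have "\<dots> = tp S * C * S - m *\<^sub>R (idm d * \<Lambda>)" by (simp add: S)
    also have "idm d * \<Lambda> = \<Lambda>"
    proof -
      have "idm d * tp S = tp S" using S(2) by (metis tp_idm tp_times)
      then show ?thesis by (simp add: \<Lambda>_def flip: mult.assoc)
    qed
    finally show ?thesis using m by (simp add: \<Lambda>_def)
  qed
  have "M = 0"
  proof (rule fmat_eq_columns[of _ d])
    show "M * idm d = M" by (simp add: M_def left_diff_distrib \<Lambda>_def mult.assoc S)
    fix j assume j: "j < d"
    define x where "x = mu j 0"
    have x: "is_col x" "idm d * x = x" "ip x x = 1"
      using j by (auto simp: x_def col_ent ip_mu intro!: fmat_eqI)
    have "is_col (M * x)" "idm N * (M * x) = M * x" "tp S * (M * x) = 0"
      using NM SM by (simp_all add: x_def col_mu flip: mult.assoc)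
    from orthogonal_complement(2)[OF x this]
    have "ip (C * (S * x)) (M * x) = 0" by (simp add: ip_times_left symC)
    moreover have "C * (S * x) = M * x + S * \<Lambda> * x"
      by (simp add: M_def left_diff_distrib mult.assoc)
    moreover have "ip (S * \<Lambda> * x) (M * x) = 0"
      using SM by (simp add: ip_times_left mult.assoc) (simp flip: mult.assoc)
    ultimately have "ip (M * x) (M * x) = 0" by (simp add: ip_distribs)
    then show "M * mu j 0 = 0" by (simp add: x_def)
  qed
  then show ?thesis by (simp add: M_def)
qed

text \<open>
  The Courant-Fischer argument. By counting dimensions, the range of \<open>Z\<close> contains a nonzero vector whose
  projection to the range of \<open>S\<close> is a multiple of \<open>S x\<close>. On that vector the form of \<open>C\<close> is at least \<open>l\<close>
  times its squared length, and at most the Rayleigh quotient at \<open>S x\<close> times its squared length.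
\<close>

lemma min_max_lower_bound:
  assumes Z: "idm N * Z = Z" "Z * idm d = Z" "tp Z * Z = m *\<^sub>R idm d"
    and low: "\<And>y. is_col y \<Longrightarrow> l * ip (Z * y) (Z * y) \<le> ip (Z * y) (C * (Z * y))"
    and x: "is_col x" "idm d * x = x"
  shows "l * m * ip x x \<le> ip (S * x) (C * (S * x))"
proof (cases "x = 0")
  case False
  define r where "r = 1 / fr x"
  have frx: "fr x > 0" using fr_nonneg[of x] fr_eq_0[of x] False by linarith
  define u where "u = r *\<^sub>R x"
  have ipx: "ip x x = fr x * fr x" by (simp add: fr_square[symmetric] power2_eq_square)
  have u: "is_col u" "idm d * u = u" "ip u u = 1"
    using x frx by (auto simp: u_def r_def col_scaleR ipx)
  define B where "B = tp S * Z"
  have tS: "idm d * tp S = tp S" using S(2) by (metis tp_idm tp_times)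
  have B: "idm d * B = B" "B * idm d = B"
    by (simp_all add: B_def mult.assoc Z) (simp add: tS flip: mult.assoc)
  \<comment> \<open>The vector of the dimension count: solve for a preimage of \<open>u\<close>, or take a kernel vector.\<close>
  obtain y \<alpha> where y: "is_col y" "idm d * y = y" "y \<noteq> 0" "B * y = \<alpha> *\<^sub>R u"
  proof (cases rule: invertible_or_kernel[OF B])
    case (1 B')
    have "B' * u \<noteq> 0"
    proof
      assume "B' * u = 0"
      then have "B * B' * u = 0" by (simp add: mult.assoc)
      then have "u = 0" using 1 u by simp
      then show False using u(3) by simp
    qed
    moreover have "B * (B' * u) = 1 *\<^sub>R u" using 1 u by (simp flip: mult.assoc)
    moreover have "idm d * (B' * u) = B' * u" using 1 by (simp flip: mult.assoc)
    ultimately show ?thesis using that col_times[OF u(1)] by blast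
  next
    case (2 y)
    then show ?thesis using that[of y 0] by simp
  qed
  define v where "v = Z * y"
  define \<beta> where "\<beta> = \<alpha> / m"
  define w where "w = v - \<beta> *\<^sub>R (S * u)"
  define \<rho> where "\<rho> = ip (S * u) (C * (S * u)) / m"
  have SSu: "tp S * (S * u) = m *\<^sub>R u" using u by (simp add: S flip: mult.assoc)
  have w: "is_col w" "idm N * w = w" "tp S * w = 0"
  proof -
    show "is_col w" by (simp add: w_def v_def col_diff col_scaleR col_times y u)
    show "idm N * w = w" by (simp add: w_def v_def right_diff_distrib) (simp add: Z S flip: mult.assoc)
    have "tp S * v = \<alpha> *\<^sub>R u" using y(4) by (simp add: v_def B_def mult.assoc)
    then show "tp S * w = 0" using m by (simp add: w_def right_diff_distrib SSu \<beta>_def)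
  qed
  note oc = orthogonal_complement[OF u w]
  have Swu: "ip (S * u) w = 0" by (simp add: ip_times_left w)
  have v: "v = w + \<beta> *\<^sub>R (S * u)" by (simp add: w_def)
  have wCu: "ip w (C * (S * u)) = 0"
    using oc(2) by (metis ip_commute ip_times_left symC)
  have "l * ip v v \<le> ip v (C * v)" using low[OF y(1)] by (simp add: v_def)
  also have "ip v (C * v) = ip w (C * w) + \<beta>\<^sup>2 * ip (S * u) (C * (S * u))"
    by (simp add: v ip_distribs distrib_left oc(2) wCu power2_eq_square)
  also have "\<dots> \<le> \<rho> * ip w w + \<beta>\<^sup>2 * (\<rho> * m)"
    using oc(1) m by (simp add: \<rho>_def)
  also have "\<dots> = \<rho> * ip v v"
  proof -
    have "ip (S * u) (S * u) = m" using ip_S[OF u(2), of u] u(3) by simp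
    moreover have "ip w (S * u) = 0" using Swu by (simp add: ip_commute)
    ultimately have "ip v v = ip w w + \<beta>\<^sup>2 * m"
      using Swu by (simp add: v ip_distribs power2_eq_square)
    then show ?thesis by (simp add: algebra_simps)
  qed
  finally have "l * ip v v \<le> \<rho> * ip v v" .
  moreover have "ip v v = m * ip y y"
  proof -
    have "ip v v = ip y (tp Z * Z * y)" by (simp add: v_def ip_times_left mult.assoc)
    then show ?thesis by (simp add: Z y)
  qed
  then have "ip v v > 0" using ip_ge_0_pos[OF y(3)] m by simp
  ultimately have "l \<le> \<rho>" by simp
  then have "l * m \<le> ip (S * u) (C * (S * u))" using m by (simp add: \<rho>_def field_simps)
  then have "l * m * ip x x \<le> ip (S * u) (C * (S * u)) * ip x x" by (rule mult_right_mono) simp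
  also have "\<dots> = ip (S * x) (C * (S * x))"
    using frx by (simp add: u_def r_def ipx)
  finally show ?thesis .
qed simp

end

text \<open>
  The map whose fixed point is the basis \<open>V\<close> of the top eigenspace of \<open>Z Z\<^sup>T + \<sigma> W\<close> with \<open>Z\<^sup>T V = n\<close>.
\<close>

definition gmap :: "real \<Rightarrow> real \<Rightarrow> fmat \<Rightarrow> fmat \<Rightarrow> fmat \<Rightarrow> fmat" where
  "gmap n \<sigma> Z W V = Z + (\<sigma> / n) *\<^sub>R (W * V - (1 / n) *\<^sub>R (V * (tp Z * W * V)))"

text \<open>
  By the min-max bound \<open>H = Z\<^sup>T S / n\<close> is bounded below, hence invertible, and \<open>V = S H\<inverse>\<close>. Multiplying
  \<open>C V = V L\<close> by \<open>Z\<^sup>T\<close> expresses \<open>L\<close> through \<open>V\<close>; inserting this back gives the fixed-point equation.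
\<close>

lemma eigenspace_graph:
  fixes n \<sigma> :: real
  assumes n: "0 < n" and \<sigma>: "0 < \<sigma>"
    and W: "tp W = W" "idm N * W = W"
    and Z: "idm N * Z = Z" "Z * idm d = Z" "tp Z * Z = n *\<^sub>R idm d"
    and S: "idm N * S = S" "S * idm d = S" "tp S * S = n *\<^sub>R idm d"
    and max: "\<And>S'. idm N * S' = S' \<Longrightarrow> S' * idm d = S' \<Longrightarrow> tp S' * S' = n *\<^sub>R idm d \<Longrightarrow>
      ip (Z * tp Z + \<sigma> *\<^sub>R W) (S' * tp S') \<le> ip (Z * tp Z + \<sigma> *\<^sub>R W) (S * tp S)"
    and small: "\<sigma> * norm W \<le> n / 8"
  obtains V H where "S = V * H" "V * idm d = V" "idm N * V = V" "idm d * H = H" "H * idm d = H" "tp Z * V = n *\<^sub>R idm d"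
    "V = gmap n \<sigma> Z W V" "norm V \<le> 2 * sqrt n" "norm H \<le> 1"
proof -
  define C where "C = Z * tp Z + \<sigma> *\<^sub>R W"
  interpret top_eigenspace N d n C S
    by unfold_locales (use assms in \<open>auto simp: C_def\<close>)
  have tZ: "idm d * tp Z = tp Z" using Z(2) by (metis tp_idm tp_times)
  have CN: "idm N * C = C" by (simp add: C_def distrib_left W Z flip: mult.assoc)
  have Weq: "\<bar>\<sigma> * ip u (W * u)\<bar> \<le> \<sigma> * norm W * ip u u" for u
  proof -
    have "\<bar>\<sigma> * ip u (W * u)\<bar> = \<sigma> * \<bar>ip u (W * u)\<bar>" using \<sigma> by (simp add: abs_mult)
    also have "\<dots> \<le> \<sigma> * (norm W * fr u * fr u)" using \<sigma> abs_ip_le_norm by (intro mult_left_mono) auto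
    also have "\<dots> = \<sigma> * norm W * ip u u" by (simp add: power2_eq_square flip: fr_square)
    finally show ?thesis .
  qed
  have quad: "ip u (C * u) = ip (tp Z * u) (tp Z * u) + \<sigma> * ip u (W * u)" for u
    by (simp add: C_def distrib_right ip_distribs mult.assoc ip_times_left)
  have low: "(n - \<sigma> * norm W) * ip (Z * y) (Z * y) \<le> ip (Z * y) (C * (Z * y))" for y
  proof -
    have "ip (tp Z * (Z * y)) (tp Z * (Z * y)) = n * n * ip (idm d * y) (idm d * y)"
      by (simp add: Z flip: mult.assoc)
    also have "ip (idm d * y) (idm d * y) = ip y (idm d * y)" by (simp add: ip_times_left flip: mult.assoc)
    also have "n * n * ip y (idm d * y) = n * ip (Z * y) (Z * y)"
    proof -
      have "ip (Z * y) (Z * y) = ip y (tp Z * Z * y)" by (simp add: ip_times_left mult.assoc)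
      then show ?thesis by (simp add: Z)
    qed
    finally show ?thesis using Weq[of "Z * y"] by (simp add: quad algebra_simps) 
  qed
  define H where "H = (1 / n) *\<^sub>R (tp Z * S)"
  have He: "idm d * H = H" "H * idm d = H"
    by (simp_all add: H_def mult.assoc S) (simp add: tZ flip: mult.assoc)
  have nS: "norm S \<le> sqrt n" and nZ: "norm Z \<le> sqrt n"
    using norm_le_sqrt_gram[OF S(3)] norm_le_sqrt_gram[OF Z(3)] n by auto
  have nH: "norm H \<le> 1"
  proof -
    have "norm (tp Z * S) \<le> sqrt n * sqrt n" using nS nZ by (intro norm_mult_le) auto
    then show ?thesis using n by (simp add: H_def field_simps)
  qed
  have Hlow: "(1/4) * ip x x \<le> ip (H * x) (H * x)" if x: "is_col x" "idm d * x = x" for x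
  proof -
    have "(n - \<sigma> * norm W) * n * ip x x \<le> ip (S * x) (C * (S * x))"
      by (rule min_max_lower_bound[OF Z low x])
    also have "\<dots> = n * n * ip (H * x) (H * x) + \<sigma> * ip (S * x) (W * (S * x))"
      using n by (simp add: quad H_def mult.assoc)
    also have "\<sigma> * ip (S * x) (W * (S * x)) \<le> \<sigma> * norm W * (n * ip x x)"
      using Weq[of "S * x"] ip_S[OF x(2), of x] by simp
    finally have "(n - 2 * (\<sigma> * norm W)) * n * ip x x \<le> n * n * ip (H * x) (H * x)"
      by (simp add: algebra_simps)
    moreover have "(n / 4) * n * ip x x \<le> (n - 2 * (\<sigma> * norm W)) * n * ip x x"
      using small n by (intro mult_right_mono) auto
    ultimately have "n * n * ((1/4) * ip x x) \<le> n * n * ip (H * x) (H * x)" by simp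
    then show ?thesis using n by (subst (asm) mult_le_cancel_left_pos) auto
  qed
  obtain H' where H': "idm d * H' = H'" "H' * idm d = H'" "H * H' = idm d" "H' * H = idm d"
  proof (cases rule: invertible_or_kernel[OF He])
    case (2 x)
    then show ?thesis using Hlow[of x] ip_ge_0_pos[of x] by simp
  qed
  have nH': "norm H' \<le> 2"
  proof (rule norm_leI_col)
    fix x assume x: "is_col x"
    have "(fr (H' * x))\<^sup>2 \<le> 4 * ip (H * (H' * x)) (H * (H' * x))"
      using Hlow[OF col_times[OF x], of H'] H' by (simp add: fr_square flip: mult.assoc)
    also have "H * (H' * x) = idm d * x" using H' by (simp flip: mult.assoc)
    also have "4 * ip (idm d * x) (idm d * x) \<le> 4 * (fr x)\<^sup>2"
    proof -
      have "fr (idm d * x) \<le> norm (idm d) * fr x" by (rule fr_times_le_norm)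
      also have "\<dots> \<le> fr x" using norm_idm_le_1 by (simp add: mult_left_le_one_le)
      finally show ?thesis by (simp add: power_mono flip: fr_square)
    qed
    finally have "(fr (H' * x))\<^sup>2 \<le> (2 * fr x)\<^sup>2" by (simp add: power_mult_distrib)
    then show "fr (H' * x) \<le> 2 * fr x" by (rule power2_le_imp_le) simp
  qed simp
  define V where "V = S * H'"
  have SV: "S = V * H" using H' S by (simp add: V_def mult.assoc)
  have Ve: "V * idm d = V" "idm N * V = V" by (simp_all add: V_def mult.assoc H') (simp add: S flip: mult.assoc)
  have ZV: "tp Z * V = n *\<^sub>R idm d"
  proof -
    have "tp Z * V = tp Z * S * H'" by (simp add: V_def mult.assoc)
    also have "tp Z * S = n *\<^sub>R H" using n by (simp add: H_def)
    finally show ?thesis by (simp add: H')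
  qed
  have nV: "norm V \<le> 2 * sqrt n" using norm_mult_le[OF nS nH'] by (simp add: V_def mult.commute)
  define L where "L = H * \<Lambda> * H'"
  have CV: "C * V = V * L"
  proof -
    have "C * V = C * S * H'" by (simp add: V_def mult.assoc)
    also have "\<dots> = S * \<Lambda> * H'" by (simp add: invariant[OF CN])
    also have "\<dots> = V * H * \<Lambda> * H'" by (simp add: SV[symmetric])
    finally show ?thesis by (simp add: L_def mult.assoc)
  qed
  have CV': "C * V = n *\<^sub>R Z + \<sigma> *\<^sub>R (W * V)"
    by (simp add: C_def distrib_right mult.assoc ZV Z)
  have Le: "idm d * L = L" by (simp add: L_def He flip: mult.assoc)
  have "n *\<^sub>R L = tp Z * (V * L)" using ZV Le by (simp flip: mult.assoc)
  also have "\<dots> = n *\<^sub>R (tp Z * Z) + \<sigma> *\<^sub>R (tp Z * W * V)"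
    by (simp flip: CV) (simp add: CV' distrib_left mult.assoc)
  also have "\<dots> = n *\<^sub>R (n *\<^sub>R idm d + (\<sigma> / n) *\<^sub>R (tp Z * W * V))"
    using n by (simp add: Z scaleR_add_right)
  finally have L: "L = n *\<^sub>R idm d + (\<sigma> / n) *\<^sub>R (tp Z * W * V)" using n by simp
  have "n *\<^sub>R Z + \<sigma> *\<^sub>R (W * V) = n *\<^sub>R V + (\<sigma> / n) *\<^sub>R (V * (tp Z * W * V))"
    using CV CV' by (simp add: L distrib_left Ve)
  then have "n *\<^sub>R V = n *\<^sub>R Z + \<sigma> *\<^sub>R (W * V) - (\<sigma> / n) *\<^sub>R (V * (tp Z * W * V))"
    by (simp add: algebra_simps)
  then have "(1 / n) *\<^sub>R (n *\<^sub>R V) = (1 / n) *\<^sub>R (n *\<^sub>R Z + \<sigma> *\<^sub>R (W * V) - (\<sigma> / n) *\<^sub>R (V * (tp Z * W * V)))"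
    by simp
  then have "V = gmap n \<sigma> Z W V"
    using n by (simp add: gmap_def scaleR_diff_right scaleR_add_right add_diff_eq)
  with SV Ve He ZV nV nH show ?thesis using that by blast
qed

section \<open>Leave-one-out analysis of the eigenvectors\<close>

text \<open>
  The noise with its \<open>i\<close>-th block row and block column set to zero.
\<close>

definition loo :: "nat \<Rightarrow> nat \<Rightarrow> fmat \<Rightarrow> fmat" where
  "loo d i W = (let p = sel d i * tp (sel d i) in W - p * W - W * p + p * W * p)"

lemma polar_factor_scaleR:
  assumes "polar_factor d Y P" "0 \<le> c" shows "polar_factor d (c *\<^sub>R Y) P"
  using assms by (simp add: polar_factor_def)

lemma norm_scaleR_inverse_le:
  fixes A :: fmat assumes "norm A \<le> c * b" "0 < c" shows "norm ((1 / c) *\<^sub>R A) \<le> b"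
  using assms by (simp add: field_simps)

lemma norm_scaleR_le:
  fixes A :: fmat assumes "norm A \<le> b" "0 \<le> c" shows "norm (c *\<^sub>R A) \<le> c * b"
  using assms by (simp add: mult_left_mono)

lemma blk_times: "blk d i (A * B) = blk d i A * B" by (simp add: blk_def mult.assoc)
lemma blk_simps: "blk d i (A + B) = blk d i A + blk d i B" "blk d i (A - B) = blk d i A - blk d i B"
  "blk d i (r *\<^sub>R A) = r *\<^sub>R blk d i A"
  by (simp_all add: blk_def distrib_left right_diff_distrib)
lemma idm_blk: "idm d * blk d i A = blk d i A"
  by (simp add: blk_def sel_dims flip: mult.assoc)
lemma blk_sel: "blk d i (sel d i * A) = idm d * A" by (simp add: blk_def sel_sel flip: mult.assoc)

text \<open>
  The parameter \<open>h\<close> bounds the ratio of the noise to the leading eigenvalue \<open>n\<close> of \<open>Z Z\<^sup>T\<close>.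
\<close>

locale synchronization =
  fixes n d :: nat and \<sigma> h :: real and Z W :: fmat
  assumes n: "0 < n" and d: "0 < d" and \<sigma>: "0 < \<sigma>" and h: "0 \<le> h" "h \<le> 1/100"
    and W: "tp W = W" "idm (n * d) * W = W"
    and diag: "\<And>i. i < n \<Longrightarrow> blk d i W * sel d i = 0"
    and Z: "idm (n * d) * Z = Z" "Z * idm d = Z"
    and Zi: "\<And>i. i < n \<Longrightarrow> orthf d (blk d i Z)"
    and W_small: "\<sigma> * norm W \<le> n * h"
begin

abbreviation "s \<equiv> sqrt (real n)"

lemma s_pos: "0 < s" using n by simp

lemma ZZ: "tp Z * Z = real n *\<^sub>R idm d"
  by (rule orthogonal_blocks_gram[OF d Z(1) Zi])

lemma norm_Z: "norm Z \<le> s"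
  by (rule norm_le_sqrt_gram[OF ZZ]) simp

lemma gmap_bound:
  assumes W': "norm W' \<le> norm W" and V: "norm V \<le> 2 * s"
  shows "norm (gmap n \<sigma> Z W' V - Z) \<le> 6 * h * s" "norm (gmap n \<sigma> Z W' V) \<le> 2 * s"
proof -
  have "norm (V * (tp Z * W' * V)) \<le> (2 * s) * (s * norm W * (2 * s))"
    using V W' norm_Z by (intro norm_mult_le) auto
  also have "\<dots> = n * (4 * s * norm W)" by simp
  finally have "norm ((1 / n) *\<^sub>R (V * (tp Z * W' * V))) \<le> 4 * s * norm W"
    using n by (intro norm_scaleR_inverse_le) auto
  moreover have "norm (W' * V) \<le> norm W * (2 * s)" using V W' by (intro norm_mult_le)
  ultimately have "norm (W' * V - (1 / n) *\<^sub>R (V * (tp Z * W' * V))) \<le> norm W * (2 * s) + 4 * s * norm W"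
    by (rule norm_diff_le[rotated])
  then have "(\<sigma> / n) * norm (W' * V - (1 / n) *\<^sub>R (V * (tp Z * W' * V))) \<le> (\<sigma> / n) * (norm W * (2 * s) + 4 * s * norm W)"
    using \<sigma> by (intro mult_left_mono) auto
  also have "\<dots> = (\<sigma> * norm W) * (6 * s / n)" by (simp add: field_simps)
  also have "\<dots> \<le> (n * h) * (6 * s / n)" using W_small by (intro mult_right_mono) auto
  also have "\<dots> = 6 * h * s" using n by simp
  finally show *: "norm (gmap n \<sigma> Z W' V - Z) \<le> 6 * h * s"
    using \<sigma> n by (simp add: gmap_def)
  have "norm (gmap n \<sigma> Z W' V) \<le> norm Z + norm (gmap n \<sigma> Z W' V - Z)"
    using norm_triangle_ineq[of Z "gmap n \<sigma> Z W' V - Z"] by simp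
  also have "\<dots> \<le> s + 6 * h * s" using norm_Z * by (rule add_mono)
  also have "\<dots> \<le> 2 * s" using mult_right_mono[of "6 * h" 1 s] h by simp
  finally show "norm (gmap n \<sigma> Z W' V) \<le> 2 * s" .
qed

lemma gmap_contraction:
  assumes W': "norm W' \<le> norm W" and U: "norm U \<le> 2 * s" and V: "norm V \<le> 2 * s"
  shows "norm (gmap n \<sigma> Z W' U - gmap n \<sigma> Z W' V) \<le> (1/2) * norm (U - V)"
proof -
  define D where "D = U - V"
  have eq: "gmap n \<sigma> Z W' U - gmap n \<sigma> Z W' V
      = (\<sigma> / n) *\<^sub>R (W' * D - (1 / n) *\<^sub>R (D * (tp Z * W' * U) + V * (tp Z * W' * D)))"
    by (simp add: gmap_def D_def algebra_simps)
  have "norm (D * (tp Z * W' * U) + V * (tp Z * W' * D))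
      \<le> norm D * (s * norm W * (2 * s)) + 2 * s * (s * norm W * norm D)"
    using U V W' norm_Z by (intro norm_add_le norm_mult_le) auto
  also have "\<dots> = n * (4 * norm W * norm D)" by simp
  finally have "norm ((1 / n) *\<^sub>R (D * (tp Z * W' * U) + V * (tp Z * W' * D))) \<le> 4 * norm W * norm D"
    using n by (intro norm_scaleR_inverse_le) auto
  moreover have "norm (W' * D) \<le> norm W * norm D" using W' by (intro norm_mult_le) auto
  ultimately have "norm (W' * D - (1 / n) *\<^sub>R (D * (tp Z * W' * U) + V * (tp Z * W' * D)))
      \<le> norm W * norm D + 4 * norm W * norm D" by (rule norm_diff_le[rotated])
  then have "norm (gmap n \<sigma> Z W' U - gmap n \<sigma> Z W' V) \<le> (\<sigma> / n) * (5 * norm W * norm D)"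
    unfolding eq using \<sigma> by (intro norm_scaleR_le) (auto simp: mult_ac)
  also have "\<dots> = (\<sigma> * norm W) * (5 * norm D / n)" by simp
  also have "\<dots> \<le> (n * h) * (5 * norm D / n)" using W_small by (intro mult_right_mono) auto
  also have "\<dots> = (5 * h) * norm D" using n by simp
  also have "\<dots> \<le> (1/2) * norm D" using h by (intro mult_right_mono) auto
  finally show ?thesis by (simp add: D_def)
qed

text \<open>
  The first iteration moves \<open>Z\<close> by at most \<open>6 h s\<close>, and the later steps shrink geometrically.
\<close>

lemma gmap_iterates:
  assumes W': "norm W' \<le> norm W"
  shows "norm ((gmap n \<sigma> Z W' ^^ k) Z) \<le> 2 * s"
    "norm ((gmap n \<sigma> Z W' ^^ Suc k) Z - (gmap n \<sigma> Z W' ^^ k) Z) \<le> (1/2) ^ k * (6 * h * s)"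
    "norm ((gmap n \<sigma> Z W' ^^ k) Z - Z) \<le> 6 * h * s"
proof -
  show b: "norm ((gmap n \<sigma> Z W' ^^ k) Z) \<le> 2 * s" for k
  proof (induction k)
    case 0
    have "norm Z \<le> 2 * s" using norm_Z s_pos by linarith
    then show ?case by simp
  next
    case (Suc k) then show ?case using gmap_bound(2)[OF W'] by simp
  qed
  show "norm ((gmap n \<sigma> Z W' ^^ Suc k) Z - (gmap n \<sigma> Z W' ^^ k) Z) \<le> (1/2) ^ k * (6 * h * s)"
  proof (induction k)
    case 0
    have "norm Z \<le> 2 * s" using norm_Z s_pos by linarith
    then show ?case using gmap_bound(1)[OF W', of Z] by simp
  next
    case (Suc k)
    have "norm ((gmap n \<sigma> Z W' ^^ Suc (Suc k)) Z - (gmap n \<sigma> Z W' ^^ Suc k) Z)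
        \<le> (1/2) * norm ((gmap n \<sigma> Z W' ^^ Suc k) Z - (gmap n \<sigma> Z W' ^^ k) Z)"
      using gmap_contraction[OF W' b[of "Suc k"] b[of k]] by simp
    also have "\<dots> \<le> (1/2) * ((1/2) ^ k * (6 * h * s))" using Suc by (intro mult_left_mono) auto
    finally show ?case by (simp only: power_Suc mult.assoc)
  qed
  show "norm ((gmap n \<sigma> Z W' ^^ k) Z - Z) \<le> 6 * h * s"
    using gmap_bound(1)[OF W' b] h s_pos by (cases k) auto
qed

lemma W_right: "W * idm (n * d) = W"
  using W by (metis tp_idm tp_times)

lemma proj_idm: assumes "i < n"
  shows "idm (n * d) * (sel d i * tp (sel d i)) = sel d i * tp (sel d i)"
    "sel d i * tp (sel d i) * idm (n * d) = sel d i * tp (sel d i)"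
  using sel_dims assms by (simp_all add: mult.assoc) (simp flip: mult.assoc)

lemma loo_eq: assumes "i < n"
  shows "loo d i W = (idm (n * d) - sel d i * tp (sel d i)) * W * (idm (n * d) - sel d i * tp (sel d i))"
  by (simp add: loo_def Let_def left_diff_distrib right_diff_distrib W mult.assoc W_right)

lemma norm_loo: assumes i: "i < n" shows "norm (loo d i W) \<le> norm W"
proof -
  define q where "q = idm (n * d) - sel d i * tp (sel d i)"
  have pp: "sel d i * tp (sel d i) * (sel d i * tp (sel d i)) = sel d i * tp (sel d i)"
  proof -
    have "sel d i * tp (sel d i) * (sel d i * tp (sel d i)) = sel d i * (tp (sel d i) * sel d i) * tp (sel d i)"
      by (simp add: mult.assoc)
    then show ?thesis by (simp add: sel_sel sel_dims)
  qed
  have "tp q * q = q"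
    by (simp add: q_def left_diff_distrib right_diff_distrib pp proj_idm[OF i])
  then have "norm q = (norm q)\<^sup>2" using norm_tp_self[of q] by simp
  then have "norm q * (norm q - 1) = 0" by (simp add: algebra_simps power2_eq_square)
  then have "norm q \<le> 1" by auto
  then show ?thesis unfolding loo_eq[OF i] q_def[symmetric]
    by (intro norm_mult_le_left norm_mult_le_right) auto
qed

lemma blk_loo: assumes i: "i < n" shows "blk d i (loo d i W) = 0"
proof -
  have "blk d i (sel d i * tp (sel d i)) = tp (sel d i)"
    by (simp add: blk_sel sel_dims)
  moreover have "blk d i (idm (n * d)) = tp (sel d i)" using i by (simp add: blk_def sel_dims)
  ultimately show ?thesis unfolding loo_eq[OF i] by (simp add: blk_times blk_simps)
qed

lemma W_minus_loo: assumes i: "i < n"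
  shows "W - loo d i W = sel d i * blk d i W + W * (sel d i * tp (sel d i))"
proof -
  have "sel d i * tp (sel d i) * W * (sel d i * tp (sel d i)) = sel d i * (blk d i W * sel d i) * tp (sel d i)"
    by (simp add: blk_def mult.assoc)
  also have "\<dots> = 0" by (simp add: diag[OF i])
  finally have "sel d i * tp (sel d i) * W * (sel d i * tp (sel d i)) = 0" .
  then show ?thesis unfolding loo_def Let_def by (simp add: blk_def mult.assoc)
qed

text \<open>
  An iterate of fixed order is used rather than the fixed point: it is a polynomial in the remaining noise
  entries, hence measurable and independent of the deleted ones. After \<open>n\<close> steps the residual is at most
  \<open>2^(-n) 6 h sqrt n\<close>, hence of the required order \<open>h\<close> (\<open>residual_U\<close>).
\<close>

definition "U i = (gmap n \<sigma> Z (loo d i W) ^^ n) Z"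

lemma norm_U: "i < n \<Longrightarrow> norm (U i) \<le> 2 * s" "i < n \<Longrightarrow> norm (U i - Z) \<le> 6 * h * s"
  using gmap_iterates[OF norm_loo] by (auto simp: U_def)

text \<open>
  The remaining noise has no \<open>i\<close>-th block row, so in this block \<open>gmap\<close> adds only its quadratic term to \<open>Z\<close>.
\<close>

lemma blk_U: assumes i: "i < n" shows "norm (blk d i (U i)) \<le> 2"
proof -
  have "norm (blk d i ((gmap n \<sigma> Z (loo d i W) ^^ k) Z)) \<le> 2" for k
  proof (induction k)
    case 0 then show ?case using orthfD(7)[OF Zi[OF i]] by simp
  next
    case (Suc k)
    define V where "V = (gmap n \<sigma> Z (loo d i W) ^^ k) Z"
    have V: "norm V \<le> 2 * s" unfolding V_def by (rule gmap_iterates(1)[OF norm_loo[OF i]])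
    have eq: "blk d i (gmap n \<sigma> Z (loo d i W) V)
        = blk d i Z - (\<sigma> / n / n) *\<^sub>R (blk d i V * (tp Z * loo d i W * V))"
      by (simp add: gmap_def blk_simps blk_times blk_loo[OF i])
    have "norm (blk d i V * (tp Z * loo d i W * V)) \<le> 2 * (s * norm W * (2 * s))"
      using Suc V norm_Z norm_loo[OF i] unfolding V_def[symmetric] by (intro norm_mult_le) auto
    also have "\<dots> = n * (4 * norm W)" by simp
    finally have "norm ((\<sigma> / n / n) *\<^sub>R (blk d i V * (tp Z * loo d i W * V))) \<le> (\<sigma> / n / n) * (n * (4 * norm W))"
      using \<sigma> by (intro norm_scaleR_le) auto
    also have "\<dots> = (4 / n) * (\<sigma> * norm W)" using n by simp
    also have "\<dots> \<le> (4 / n) * (n * h)" using W_small by (intro mult_left_mono) auto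
    also have "\<dots> \<le> 1" using n h by simp
    finally have "norm (blk d i (gmap n \<sigma> Z (loo d i W) V)) \<le> 1 + 1"
      unfolding eq using orthfD(7)[OF Zi[OF i]] by (intro norm_diff_le)
    then show ?case by (simp add: V_def)
  qed
  then show ?thesis by (simp add: U_def)
qed

lemma residual_U: assumes i: "i < n"
  shows "norm (gmap n \<sigma> Z (loo d i W) (U i) - U i) \<le> 6 * h"
proof -
  have "norm (gmap n \<sigma> Z (loo d i W) (U i) - U i) \<le> (1/2) ^ n * (6 * h * s)"
    using gmap_iterates(2)[OF norm_loo[OF i], of n] by (simp add: U_def)
  also have "\<dots> = (6 * h) * ((1/2) ^ n * s)" by simp
  also have "(6 * h) * ((1/2) ^ n * s) \<le> (6 * h) * 1"
  proof (rule mult_left_mono)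
    have "s \<le> n" using n by (simp add: sqrt_le_D real_sqrt_le_iff power2_eq_square real_le_lsqrt)
    also have "\<dots> \<le> 2 ^ n" using of_nat_less_two_power[of n] by simp
    finally show "(1/2) ^ n * s \<le> 1" by (simp add: field_simps)
  qed (use h in simp)
  finally show ?thesis by simp
qed

end

text \<open>
  The two probabilistic inputs. The second one is of second order, thanks to independence: \<open>U i - Z\<close> is itself
  of relative size \<open>h\<close>.
\<close>

locale synchronization_event = synchronization n d \<sigma> h Z W
  for n d :: nat and \<sigma> h :: real and Z W :: fmat +
  assumes WZ: "\<And>i. i < n \<Longrightarrow> \<sigma> * norm (blk d i W * Z) \<le> n * h"
    and WU: "\<And>i. i < n \<Longrightarrow> \<sigma> * norm (blk d i W * (U i - Z)) \<le> n * h\<^sup>2"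
begin

lemma h2: "h\<^sup>2 \<le> h / 100"
  using h mult_left_mono[of h "1/100" h] by (simp add: power2_eq_square)

lemma h3: "6 * h * (36 * h\<^sup>2) \<le> h\<^sup>2 * 3"
proof -
  have "216 * (h * h\<^sup>2) \<le> 216 * (1/100 * h\<^sup>2)"
    using h by (intro mult_left_mono mult_right_mono) auto
  also have "\<dots> \<le> h\<^sup>2 * 3" using zero_le_power2[of h] by simp
  finally show ?thesis by (simp add: mult_ac)
qed

text \<open>
  Compare the fixed point of \<open>gmap\<close> for the full noise with the approximate fixed point \<open>U i\<close> for the
  deleted noise. By contraction it suffices to bound the change of \<open>gmap\<close> at \<open>U i\<close>, that is, \<open>D * U i\<close> for
  the deleted part \<open>D\<close> of the noise: its block row contributes \<open>blk d i W * U i\<close>, its block column acts on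
  the bounded block \<open>blk d i (U i)\<close>.
\<close>

lemma leave_one_out:
  assumes i: "i < n" and V: "V = gmap n \<sigma> Z W V" "norm V \<le> 2 * s"
  shows "norm (V - U i) \<le> 36 * h"
proof -
  define D where "D = W - loo d i W"
  have "\<sigma> * norm (blk d i W * U i) \<le> \<sigma> * (norm (blk d i W * Z) + norm (blk d i W * (U i - Z)))"
    using norm_triangle_ineq[of "blk d i W * Z" "blk d i W * (U i - Z)"] \<sigma>
    by (intro mult_left_mono) (auto simp: algebra_simps)
  also have "\<dots> \<le> n * h + n * h\<^sup>2" using WZ[OF i] WU[OF i] by (simp add: distrib_left)
  also have "\<dots> \<le> n * (2 * h)" using h2 h n by (simp flip: distrib_left)
  finally have 1: "\<sigma> * norm (blk d i W * U i) \<le> n * (2 * h)" .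
  have "D * U i = sel d i * (blk d i W * U i) + W * (sel d i * blk d i (U i))"
    by (simp add: D_def W_minus_loo[OF i] distrib_right mult.assoc) (simp add: blk_def)
  also have "norm \<dots> \<le> norm (blk d i W * U i) + norm W * 2"
    by (intro norm_add_le norm_mult_le[OF order_refl] norm_mult_le_right[OF norm_sel(1)] blk_U[OF i] order_refl)
  finally have "\<sigma> * norm (D * U i) \<le> \<sigma> * (norm (blk d i W * U i) + norm W * 2)"
    using \<sigma> by (intro mult_left_mono) auto
  then have DU: "\<sigma> * norm (D * U i) \<le> n * (4 * h)"
    using 1 W_small by (simp add: algebra_simps)
  have eq: "gmap n \<sigma> Z W (U i) - gmap n \<sigma> Z (loo d i W) (U i)
     = (\<sigma> / n) *\<^sub>R (D * U i - (1 / n) *\<^sub>R (U i * (tp Z * (D * U i))))"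
    by (simp add: gmap_def D_def algebra_simps)
  have "norm (U i * (tp Z * (D * U i))) \<le> 2 * s * (s * norm (D * U i))"
    using norm_U[OF i] norm_Z by (intro norm_mult_le) auto
  also have "\<dots> = n * (2 * norm (D * U i))" by simp
  finally have "norm ((1 / n) *\<^sub>R (U i * (tp Z * (D * U i)))) \<le> 2 * norm (D * U i)"
    using n by (intro norm_scaleR_inverse_le) auto
  then have "norm (D * U i - (1 / n) *\<^sub>R (U i * (tp Z * (D * U i)))) \<le> norm (D * U i) + 2 * norm (D * U i)"
    by (intro norm_diff_le) auto
  then have "norm (gmap n \<sigma> Z W (U i) - gmap n \<sigma> Z (loo d i W) (U i)) \<le> (\<sigma> / n) * (3 * norm (D * U i))"
    unfolding eq using \<sigma> by (intro norm_scaleR_le) auto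
  also have "\<dots> = (3 / n) * (\<sigma> * norm (D * U i))" by simp
  also have "\<dots> \<le> (3 / n) * (n * (4 * h))" using DU by (intro mult_left_mono) auto
  also have "\<dots> = 12 * h" using n by simp
  finally have 2: "norm (gmap n \<sigma> Z W (U i) - gmap n \<sigma> Z (loo d i W) (U i)) \<le> 12 * h" .
  have "V - U i = (gmap n \<sigma> Z W V - gmap n \<sigma> Z W (U i))
      + (gmap n \<sigma> Z W (U i) - gmap n \<sigma> Z (loo d i W) (U i)) + (gmap n \<sigma> Z (loo d i W) (U i) - U i)"
    using V(1) by simp
  also have "norm \<dots> \<le> (1/2) * norm (V - U i) + 12 * h + 6 * h"
    using 2 residual_U[OF i] gmap_contraction[OF order_refl V(2) norm_U(1)[OF i]]
    by (intro norm_add_le)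
  finally show ?thesis by simp
qed

lemma noise_times_error:
  assumes i: "i < n" and V: "V = gmap n \<sigma> Z W V" "norm V \<le> 2 * s"
  shows "\<sigma> * norm (blk d i W * (V - Z)) \<le> n * (37 * h\<^sup>2)"
proof -
  have "blk d i W * (V - Z) = blk d i W * (U i - Z) + blk d i W * (V - U i)"
    by (simp add: algebra_simps)
  also have "norm \<dots> \<le> norm (blk d i W * (U i - Z)) + norm W * (36 * h)"
    using leave_one_out[OF assms] norm_blk by (intro norm_add_le norm_mult_le) auto
  finally have "\<sigma> * norm (blk d i W * (V - Z)) \<le> \<sigma> * (norm (blk d i W * (U i - Z)) + norm W * (36 * h))"
    using \<sigma> by (intro mult_left_mono) auto
  also have "\<dots> = \<sigma> * norm (blk d i W * (U i - Z)) + (\<sigma> * norm W) * (36 * h)"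
    by (simp add: algebra_simps)
  also have "\<dots> \<le> n * h\<^sup>2 + (n * h) * (36 * h)"
    using WU[OF i] W_small h by (intro add_mono mult_right_mono) auto
  also have "\<dots> = n * (37 * h\<^sup>2)" by (simp add: power2_eq_square)
  finally show ?thesis .
qed

lemma blk_gmap: "blk d i (gmap n \<sigma> Z W V)
    = blk d i Z + (\<sigma> / n) *\<^sub>R (blk d i W * V) - (\<sigma> / n / n) *\<^sub>R (blk d i V * (tp Z * W * V))"
  by (simp add: gmap_def blk_simps blk_times scaleR_diff_right)

lemma block_error:
  assumes i: "i < n" and V: "V = gmap n \<sigma> Z W V" "norm V \<le> 2 * s"
  shows "norm (blk d i (V - Z)) \<le> 6 * h"
proof -
  have nWV: "norm ((\<sigma> / n) *\<^sub>R (blk d i W * V)) \<le> h + 37 * h\<^sup>2"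
  proof -
    have "blk d i W * V = blk d i W * Z + blk d i W * (V - Z)" by (simp add: algebra_simps)
    then have "\<sigma> * norm (blk d i W * V) \<le> \<sigma> * norm (blk d i W * Z) + \<sigma> * norm (blk d i W * (V - Z))"
      using \<sigma> mult_left_mono[OF norm_triangle_ineq[of "blk d i W * Z" "blk d i W * (V - Z)"], of \<sigma>]
      by (simp add: distrib_left)
    also have "\<dots> \<le> n * h + n * (37 * h\<^sup>2)"
      using WZ[OF i] noise_times_error[OF assms] by (rule add_mono)
    finally show ?thesis using n \<sigma> by (simp add: field_simps)
  qed
  have nq: "norm ((\<sigma> / n / n) *\<^sub>R (blk d i V * (tp Z * W * V))) \<le> 2 * h * norm (blk d i V)"
  proof -
    have "norm (blk d i V * (tp Z * W * V)) \<le> norm (blk d i V) * (s * norm W * (2 * s))"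
      using V(2) norm_Z by (intro norm_mult_le) auto
    also have "\<dots> = n * (2 * norm W * norm (blk d i V))" by simp
    finally have "norm ((\<sigma> / n / n) *\<^sub>R (blk d i V * (tp Z * W * V)))
        \<le> (\<sigma> / n / n) * (n * (2 * norm W * norm (blk d i V)))"
      using \<sigma> by (intro norm_scaleR_le) auto
    also have "\<dots> = (\<sigma> * norm W) * (2 * norm (blk d i V) / n)" using n by simp
    also have "\<dots> \<le> (n * h) * (2 * norm (blk d i V) / n)" using W_small by (intro mult_right_mono) auto
    finally show ?thesis using n by (simp add: mult_ac)
  qed
  have eq: "blk d i (V - Z) = (\<sigma> / n) *\<^sub>R (blk d i W * V) - (\<sigma> / n / n) *\<^sub>R (blk d i V * (tp Z * W * V))"
    using arg_cong[OF V(1), of "blk d i"] by (simp only: blk_gmap blk_simps) (metis add_diff_cancel_left' add_diff_eq)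
  have le: "norm (blk d i (V - Z)) \<le> h + 37 * h\<^sup>2 + 2 * h * norm (blk d i V)"
    unfolding eq using nWV nq by (rule norm_diff_le)
  have "norm (blk d i V) \<le> norm (blk d i Z) + norm (blk d i (V - Z))"
    using norm_triangle_ineq[of "blk d i Z" "blk d i (V - Z)"] by (simp add: blk_simps)
  then have "norm (blk d i V) \<le> 1 + h + 37 * h\<^sup>2 + 2 * h * norm (blk d i V)"
    using le orthfD(7)[OF Zi[OF i]] by linarith
  moreover have "2 * h * norm (blk d i V) \<le> (1/50) * norm (blk d i V)"
    using h by (intro mult_right_mono) auto
  ultimately have "norm (blk d i V) \<le> 2" using h2 h by linarith
  then have "2 * h * norm (blk d i V) \<le> 2 * h * 2" using h by (intro mult_left_mono) auto
  then show ?thesis using le h2 h(1) by linarith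
qed

text \<open>
  With \<open>Q\<^sub>0\<close> the polar factor of \<open>H\<close>, write \<open>H = (I + T) Q\<^sub>0\<close>; the constraint on \<open>S\<close> forces \<open>T\<close> to be
  \<open>O(h\<^sup>2)\<close>, because \<open>V\<^sup>T V = n + R\<^sup>T R\<close> for \<open>R = V - Z\<close>. Hence \<open>S\<^sub>j = (I + X) Z\<^sub>j Q\<^sub>0\<close> with
  \<open>X = A\<^sub>j - M + G\<close>, where \<open>A\<^sub>j = (\<sigma>/n) W\<^sub>j Z Z\<^sub>j\<^sup>T\<close>, the matrix \<open>M\<close> comes from the quadratic term of \<open>gmap\<close> and
  is of first order but symmetric, and \<open>G\<close> is \<open>O(h\<^sup>2)\<close>. The polar expansion removes \<open>M\<close>.
\<close>

lemma eigenvector_polar_expansion: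
  assumes S: "S = V * H" and V: "V * idm d = V" "V = gmap n \<sigma> Z W V" "norm V \<le> 2 * s"
    and ZV: "tp Z * V = real n *\<^sub>R idm d"
    and H: "idm d * H = H" "H * idm d = H" "norm H \<le> 1"
    and SS: "tp S * S = real n *\<^sub>R idm d"
    and polar: "\<And>i. i < n \<Longrightarrow> polar_factor d (blk d i S) (P i)"
    and Zh: "\<And>i. i < n \<Longrightarrow> blk d i Zh = P i" "idm (n * d) * Zh = Zh"
    and Q: "polar_factor d (tp Z * Zh) Q" and Q0: "polar_factor d H Q0"
    and i: "i < n"
  shows "norm (tp (blk d i S) * blk d i S - idm d) \<le> 15 * h"
    "norm (P i - (idm d + (\<sigma> / (2 * real n)) *\<^sub>R (blk d i W * Z * tp (blk d i Z) - tp (blk d i W * Z * tp (blk d i Z))))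
        * blk d i Z * Q) \<le> 5000 * h\<^sup>2"
proof -
  define e where "e = idm d"
  define R where "R = V - Z"
  note V23 = V(2,3)
  have ee: "e * e = e" "tp e = e" by (simp_all add: e_def)
  have nR: "norm R \<le> 6 * h * s"
    using gmap_bound(1)[OF order_refl V(3)] V(2) by (simp add: R_def)
  have Re: "R * e = R" by (simp add: R_def e_def left_diff_distrib V(1) Z)
  have ZR: "tp Z * R = 0" by (simp add: R_def right_diff_distrib ZV ZZ)
  have RZ: "tp R * Z = 0" using arg_cong[OF ZR, of tp] by simp
  have VV: "tp V * V = real n *\<^sub>R e + tp R * R"
  proof -
    have "tp V * V = tp (Z + R) * (Z + R)" by (simp add: R_def)
    also have "\<dots> = real n *\<^sub>R e + tp R * R" by (simp add: distrib_left distrib_right ZR RZ ZZ e_def)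
    finally show ?thesis .
  qed
  have HH: "norm (tp H * H - e) \<le> 36 * h\<^sup>2"
  proof -
    have "real n *\<^sub>R e = tp H * (tp V * V) * H" using SS by (simp add: S e_def mult.assoc)
    also have "\<dots> = real n *\<^sub>R (tp H * H) + tp H * (tp R * R) * H"
      by (simp add: VV distrib_left distrib_right mult.assoc e_def H)
    finally have "real n *\<^sub>R (tp H * H - e) = - (tp H * (tp R * R) * H)"
      by (simp add: scaleR_diff_right)
    then have "n * norm (tp H * H - e) = norm (tp H * (tp R * R) * H)"
      by (metis abs_of_nat norm_minus_cancel norm_scaleR)
    also have "\<dots> \<le> 6 * h * s * (6 * h * s)"
      using nR H(3) by (intro norm_mult_le_left[OF norm_mult_le_right[OF _ norm_mult_le]]) auto
    also have "\<dots> = n * (36 * h\<^sup>2)" by (simp add: power2_eq_square)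
    finally show ?thesis using n by simp
  qed
  have Q0o: "orthf d Q0" using Q0 by (simp add: polar_factor_def)
  note Q0' = orthfD[OF Q0o, folded e_def]
  define B where "B = tp Q0 * H"
  have Be: "e * B = B" "B * e = B"
    by (simp_all add: B_def Q0' flip: mult.assoc) (simp add: mult.assoc H e_def)
  have "B * B = tp B * B" using Q0 by (simp add: B_def polar_factor_def)
  also have "\<dots> = tp H * (Q0 * tp Q0) * H" by (simp add: B_def mult.assoc)
  also have "\<dots> = tp H * H" by (simp add: Q0' mult.assoc) (simp add: e_def H)
  finally have "norm (B - e) \<le> 36 * h\<^sup>2"
    using psd_near_id[of d B] Be Q0 HH by (simp add: B_def polar_factor_def e_def)
  define T where "T = Q0 * (B - e) * tp Q0"
  have nT: "norm T \<le> 36 * h\<^sup>2"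
    unfolding T_def using \<open>norm (B - e) \<le> _\<close> Q0'(7) by (intro norm_mult_le_left[OF norm_mult_le_right]) auto
  have Te: "T * e = T" "e * T = T" by (simp_all add: T_def mult.assoc Q0') (simp add: Q0' flip: mult.assoc)
  have HT: "H = (e + T) * Q0"
  proof -
    have "T * Q0 = Q0 * (B - e) * (tp Q0 * Q0)" by (simp add: T_def mult.assoc)
    also have "\<dots> = Q0 * B - Q0"
      unfolding Q0'(3) by (simp add: mult.assoc left_diff_distrib right_diff_distrib Be Q0' ee)
    also have "Q0 * B = H" by (simp add: B_def Q0' flip: mult.assoc) (simp add: e_def H)
    finally show ?thesis by (simp add: distrib_right Q0')
  qed
  define A where "A j = (\<sigma> / n) *\<^sub>R (blk d j W * Z * tp (blk d j Z))" for j
  define A' where "A' j = (1/2) *\<^sub>R (A j - tp (A j))" for j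
  have nA': "norm (A' j) \<le> h" if "j < n" for j
  proof -
    have "norm (blk d j W * Z * tp (blk d j Z)) \<le> norm (blk d j W * Z)"
      by (rule norm_mult_le_left[OF order_refl norm_tp_orthf[OF Zi[OF that]]])
    then have "\<sigma> * norm (blk d j W * Z * tp (blk d j Z)) \<le> n * h"
      using WZ[OF that] \<sigma> by (meson mult_left_mono order_trans less_imp_le)
    then have "norm (A j) \<le> h" using \<sigma> n by (simp add: A_def field_simps)
    then have "norm (A j - tp (A j)) \<le> h + h" by (intro norm_diff_le) auto
    then show ?thesis by (simp add: A'_def)
  qed
  have main: "norm (tp (blk d j S) * blk d j S - e) \<le> 15 * h \<and>
      norm (P j - (e + A' j) * blk d j Z * Q0) \<le> 1000 * h\<^sup>2" if j: "j < n" for j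
  proof -
    define z where "z = blk d j Z"
    note z = orthfD[OF Zi[OF j], folded z_def e_def]
    define r where "r = blk d j R"
    have nr: "norm r \<le> 6 * h" unfolding r_def R_def by (rule block_error[OF j V23])
    have re: "r * e = r" by (simp add: r_def Re flip: blk_times)
    have er: "e * r = r" by (simp add: r_def e_def idm_blk)
    define X where "X = r * tp z + z * T * tp z + r * T * tp z"
    have nX: "norm X \<le> 7 * h"
    proof -
      have "norm X \<le> 6 * h + 36 * h\<^sup>2 + 6 * h * (36 * h\<^sup>2)"
        unfolding X_def using nr nT z(7)
        by (intro norm_add_le[OF norm_add_le[OF norm_mult_le_left norm_mult_le_left[OF norm_mult_le_right]]
              norm_mult_le_left[OF norm_mult_le]]) auto
      also have "6 * h * (36 * h\<^sup>2) \<le> h\<^sup>2 * 3" by (rule h3)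
      finally show ?thesis using h2 h by simp
    qed
    have Xe: "e * X = X" "X * e = X"
      by (simp_all add: X_def distrib_left distrib_right mult.assoc z) (simp add: er z flip: mult.assoc)
    have tXe: "tp X * e = tp X" by (rule tp_times[of e X, unfolded Xe(1) ee(2), symmetric])
    have eX: "(e + X) * (z * Q0) = blk d j S"
    proof -
      have "X * z = r * (tp z * z) + z * T * (tp z * z) + r * T * (tp z * z)"
        by (simp add: X_def distrib_right mult.assoc)
      also have "\<dots> = r + z * T + r * T" by (simp add: z re mult.assoc Te)
      finally have "(e + X) * z = (z + r) * (e + T)" by (simp add: distrib_left distrib_right z re)
      moreover have "z + r = blk d j V" by (simp add: z_def r_def R_def blk_simps)
      ultimately have "(e + X) * (z * Q0) = blk d j V * ((e + T) * Q0)" by (metis mult.assoc)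
      then show ?thesis by (simp add: HT[symmetric] S blk_times)
    qed
    have zQ: "orthf d (z * Q0)" unfolding z_def by (intro orthf_mult Zi j Q0o)
    note zQ' = orthfD[OF zQ, folded e_def]
    have gram: "norm (tp (blk d j S) * blk d j S - e) \<le> 15 * h"
    proof -
      have "tp (blk d j S) * blk d j S = tp (z * Q0) * ((e + tp X) * (e + X)) * (z * Q0)"
        by (simp add: eX[symmetric] mult.assoc ee)
      also have "(e + tp X) * (e + X) = e + (X + tp X + tp X * X)"
        by (simp add: distrib_left distrib_right Xe ee tXe add.assoc)
      also have "tp (z * Q0) * (e + (X + tp X + tp X * X)) * (z * Q0)
          = e + tp (z * Q0) * (X + tp X + tp X * X) * (z * Q0)"
        using zQ'(3) zQ'(6) by (simp add: distrib_left distrib_right del: tp_times)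
      finally have "tp (blk d j S) * blk d j S - e = tp (z * Q0) * (X + tp X + tp X * X) * (z * Q0)" by simp
      also have "norm \<dots> \<le> 7 * h + 7 * h + 7 * h * (7 * h)"
        using zQ'(7) norm_tp_orthf[OF zQ] nX
        by (intro norm_mult_le_left[OF norm_mult_le_right[OF _ norm_add_le[OF norm_add_le norm_mult_le]]]) auto
      also have "\<dots> \<le> 15 * h" using h2 zero_le_power2[of h] unfolding power2_eq_square by linarith
      finally show ?thesis .
    qed
    define K where "K = tp Z * W"
    have nK: "norm K \<le> s * norm W" unfolding K_def using norm_Z by (intro norm_mult_le) auto
    define M where "M = (\<sigma> / n / n) *\<^sub>R (z * (K * Z) * tp z)"
    have Msym: "tp M = M" by (simp add: M_def K_def mult.assoc W)
    define G where "G = (\<sigma> / n) *\<^sub>R (blk d j W * R * tp z) - (\<sigma> / n / n) *\<^sub>R ((r * (K * V) + z * (K * R)) * tp z)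
        + z * T * tp z + r * T * tp z"
    have XG: "X = A j - M + G"
    proof -
      have "r = (\<sigma> / n) *\<^sub>R (blk d j W * V) - (\<sigma> / n / n) *\<^sub>R (blk d j V * (K * V))"
        using arg_cong[OF V(2), of "blk d j"] unfolding K_def
        by (simp only: blk_gmap blk_simps r_def R_def) (metis add_diff_cancel_left' add_diff_eq)
      also have "V = Z + R" by (simp add: R_def)
      also have "blk d j (Z + R) = z + r" by (simp add: blk_simps z_def r_def)
      finally have "r = (\<sigma> / n) *\<^sub>R (blk d j W * (Z + R)) - (\<sigma> / n / n) *\<^sub>R ((z + r) * (K * (Z + R)))" .
      also have "\<dots> = (\<sigma> / n) *\<^sub>R (blk d j W * Z) - (\<sigma> / n / n) *\<^sub>R (z * (K * Z))
          + ((\<sigma> / n) *\<^sub>R (blk d j W * R) - (\<sigma> / n / n) *\<^sub>R (r * (K * V) + z * (K * R)))"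
        by (simp add: R_def algebra_simps)
      finally have "r * tp z = ((\<sigma> / n) *\<^sub>R (blk d j W * Z) - (\<sigma> / n / n) *\<^sub>R (z * (K * Z))
          + ((\<sigma> / n) *\<^sub>R (blk d j W * R) - (\<sigma> / n / n) *\<^sub>R (r * (K * V) + z * (K * R)))) * tp z"
        by simp
      then show ?thesis
        by (simp add: X_def A_def M_def G_def z_def[symmetric] left_diff_distrib distrib_right)
    qed
    have nG: "norm G \<le> 100 * h\<^sup>2"
    proof -
      have "\<sigma> * norm (blk d j W * R * tp z) \<le> \<sigma> * norm (blk d j W * R)"
        using \<sigma> z(7) by (intro mult_left_mono norm_mult_le_left[OF order_refl]) auto
      also have "\<dots> \<le> n * (37 * h\<^sup>2)" unfolding R_def by (rule noise_times_error[OF j V23])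
      finally have g1: "norm ((\<sigma> / n) *\<^sub>R (blk d j W * R * tp z)) \<le> 37 * h\<^sup>2"
        using n \<sigma> by (simp add: field_simps)
      have "norm ((r * (K * V) + z * (K * R)) * tp z)
          \<le> 6 * h * (s * norm W * (2 * s)) + s * norm W * (6 * h * s)"
      proof (rule norm_mult_le_left[OF norm_add_le])
        show "norm (r * (K * V)) \<le> 6 * h * (s * norm W * (2 * s))"
          by (rule norm_mult_le[OF nr norm_mult_le[OF nK V(3)]])
        show "norm (z * (K * R)) \<le> s * norm W * (6 * h * s)"
          by (rule norm_mult_le_right[OF z(7) norm_mult_le[OF nK nR]])
      qed (simp add: z(7))
      also have "\<dots> = n * (18 * h * norm W)" by simp
      finally have "norm ((\<sigma> / n / n) *\<^sub>R ((r * (K * V) + z * (K * R)) * tp z))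
          \<le> (\<sigma> / n / n) * (n * (18 * h * norm W))"
        using \<sigma> by (intro norm_scaleR_le) auto
      also have "\<dots> = (\<sigma> * norm W) * (18 * h / n)" using n by simp
      also have "\<dots> \<le> (n * h) * (18 * h / n)" using W_small h by (intro mult_right_mono) auto
      also have "\<dots> = 18 * h\<^sup>2" using n by (simp add: power2_eq_square)
      finally have g2: "norm ((\<sigma> / n / n) *\<^sub>R ((r * (K * V) + z * (K * R)) * tp z)) \<le> 18 * h\<^sup>2" .
      have "norm G \<le> 37 * h\<^sup>2 + 18 * h\<^sup>2 + 36 * h\<^sup>2 + 6 * h * (36 * h\<^sup>2)"
        unfolding G_def using nr nT z(7)
        by (intro norm_add_le[OF norm_add_le[OF norm_diff_le[OF g1 g2] norm_mult_le_left[OF norm_mult_le_right]]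
              norm_mult_le_left[OF norm_mult_le]]) auto
      also have "6 * h * (36 * h\<^sup>2) \<le> h\<^sup>2 * 3" by (rule h3)
      finally show ?thesis using zero_le_power2[of h] by linarith
    qed
    have "7 * h \<le> 1" using h by simp
    from polar_factor_expansion[OF polar[OF j] _ zQ Xe[unfolded e_def] nX this, folded e_def]
    have "norm (P j - (e + (1/2) *\<^sub>R (X - tp X)) * (z * Q0)) \<le> 17 * (7 * h)\<^sup>2" by (simp add: eX)
    moreover have "(1/2) *\<^sub>R (X - tp X) = A' j + (1/2) *\<^sub>R (G - tp G)"
      by (simp add: XG A'_def Msym algebra_simps)
    moreover have "norm ((1/2) *\<^sub>R (G - tp G) * (z * Q0)) \<le> 100 * h\<^sup>2"
    proof (rule norm_mult_le_left[OF _ zQ'(7)])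
      have "norm (G - tp G) \<le> 100 * h\<^sup>2 + 100 * h\<^sup>2" using nG by (intro norm_diff_le) auto
      then show "norm ((1/2) *\<^sub>R (G - tp G)) \<le> 100 * h\<^sup>2" by simp
    qed
    ultimately have "norm ((P j - (e + (A' j + (1/2) *\<^sub>R (G - tp G))) * (z * Q0)) + (1/2) *\<^sub>R (G - tp G) * (z * Q0))
        \<le> 17 * (7 * h)\<^sup>2 + 100 * h\<^sup>2" by (intro norm_add_le) auto
    also have "(P j - (e + (A' j + (1/2) *\<^sub>R (G - tp G))) * (z * Q0)) + (1/2) *\<^sub>R (G - tp G) * (z * Q0)
        = P j - (e + A' j) * z * Q0"
      by (simp add: distrib_right mult.assoc)
    also have "17 * (7 * h)\<^sup>2 + 100 * h\<^sup>2 \<le> 1000 * h\<^sup>2" by (simp add: power_mult_distrib)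
    finally have "norm (P j - (e + A' j) * z * Q0) \<le> 1000 * h\<^sup>2" .
    with gram show ?thesis by (simp add: z_def)
  qed
  from main[OF i] show "norm (tp (blk d i S) * blk d i S - idm d) \<le> 15 * h" by (simp add: e_def)
  define E0 where "E0 j = P j - (e + A' j) * blk d j Z * Q0" for j
  \<comment> \<open>Both halves of the skew parts sum to \<open>(\<sigma>/n) Z\<^sup>T W Z\<close>, which is symmetric.\<close>
  have skew: "(\<Sum>j<n. tp (blk d j Z) * A' j * blk d j Z) = 0"
  proof -
    have "tp (blk d j Z) * A j * blk d j Z = (\<sigma> / n) *\<^sub>R (tp (blk d j Z) * blk d j (W * Z))" if j: "j < n" for j
    proof -
      have "tp (blk d j Z) * A j * blk d j Z = (\<sigma> / n) *\<^sub>R (tp (blk d j Z) * (blk d j W * Z * (tp (blk d j Z) * blk d j Z)))"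
        by (simp add: A_def mult.assoc)
      then show ?thesis using orthfD(3)[OF Zi[OF j]] by (simp add: blk_times mult.assoc Z)
    qed
    then have s1: "(\<Sum>j<n. tp (blk d j Z) * A j * blk d j Z) = (\<sigma> / n) *\<^sub>R (tp Z * (W * Z))"
      using tp_times_blocks[of d n "W * Z" Z] d W by (simp add: scaleR_sum_right flip: mult.assoc)
    have tps: "tp (\<Sum>j<n. f j) = (\<Sum>j<n. tp (f j))" for f :: "nat \<Rightarrow> fmat"
      by (rule fmat_eqI) (simp add: ent_sum)
    have "(\<Sum>j<n. tp (blk d j Z) * tp (A j) * blk d j Z) = tp (\<Sum>j<n. tp (blk d j Z) * A j * blk d j Z)"
      by (simp add: tps mult.assoc)
    also have "\<dots> = (\<sigma> / n) *\<^sub>R (tp Z * (W * Z))" unfolding s1 by (simp add: W mult.assoc)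
    finally have s2: "(\<Sum>j<n. tp (blk d j Z) * tp (A j) * blk d j Z) = (\<sigma> / n) *\<^sub>R (tp Z * (W * Z))" .
    have "(\<Sum>j<n. tp (blk d j Z) * A' j * blk d j Z)
        = (1/2) *\<^sub>R ((\<Sum>j<n. tp (blk d j Z) * A j * blk d j Z) - (\<Sum>j<n. tp (blk d j Z) * tp (A j) * blk d j Z))"
      by (simp add: A'_def left_diff_distrib right_diff_distrib flip: scaleR_sum_right sum_subtractf)
    then show ?thesis by (simp only: s1 s2) simp
  qed
  define Y where "Y = (\<Sum>j<n. tp (blk d j Z) * E0 j)"
  have ZZh: "tp Z * Zh = real n *\<^sub>R Q0 + Y"
  proof -
    have "tp Z * Zh = (\<Sum>j<n. tp (blk d j Z) * P j)"
      using tp_times_blocks[OF d Zh(2), of Z] Zh(1) by simp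
    also have "\<dots> = (\<Sum>j<n. Q0 + tp (blk d j Z) * A' j * blk d j Z * Q0 + tp (blk d j Z) * E0 j)"
    proof (intro sum.cong refl)
      fix j assume "j \<in> {..<n}"
      then have j: "j < n" by simp
      note z = orthfD[OF Zi[OF j], folded e_def]
      have "P j = blk d j Z * Q0 + A' j * blk d j Z * Q0 + E0 j"
        by (simp add: E0_def distrib_right z)
      then have "tp (blk d j Z) * P j = tp (blk d j Z) * blk d j Z * Q0 + tp (blk d j Z) * A' j * blk d j Z * Q0 + tp (blk d j Z) * E0 j"
        by (simp add: distrib_left mult.assoc)
      then show "tp (blk d j Z) * P j = Q0 + tp (blk d j Z) * A' j * blk d j Z * Q0 + tp (blk d j Z) * E0 j"
        by (simp add: z Q0')
    qed
    also have "\<dots> = real n *\<^sub>R Q0 + (\<Sum>j<n. tp (blk d j Z) * A' j * blk d j Z) * Q0 + Y"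
      by (simp add: sum.distrib sum_distrib_right Y_def sum_constant_scaleR)
    finally show ?thesis by (simp add: skew)
  qed
  have nY: "norm Y \<le> n * (1000 * h\<^sup>2)"
  proof -
    have "norm Y \<le> (\<Sum>j<n. 1000 * h\<^sup>2)" unfolding Y_def
      using main norm_tp_orthf[OF Zi]
      by (intro sum_norm_le norm_mult_le_right) (auto simp: E0_def)
    then show ?thesis by simp
  qed
  define X where "X = (1 / n) *\<^sub>R (Y * tp Q0)"
  have nX: "norm X \<le> 1000 * h\<^sup>2"
  proof -
    have "norm (Y * tp Q0) \<le> n * (1000 * h\<^sup>2)" using nY Q0'(7) by (intro norm_mult_le_left) auto
    then show ?thesis using n by (simp add: X_def field_simps)
  qed
  have eY: "e * Y = Y" unfolding Y_def sum_distrib_left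
    using orthfD(5)[OF Zi] by (intro sum.cong refl) (simp add: e_def flip: mult.assoc)
  have Xe: "e * X = X" "X * e = X" by (simp_all add: X_def mult.assoc Q0') (simp add: eY flip: mult.assoc)
  have Ye: "Y * e = Y"
  proof -
    have "E0 j * e = E0 j" if "j < n" for j
    proof -
      have "orthf d (P j)" using polar[OF that] by (simp add: polar_factor_def)
      then have "P j * e = P j" by (simp add: e_def orthfD)
      then show ?thesis by (simp add: E0_def left_diff_distrib mult.assoc Q0')
    qed
    then show ?thesis unfolding Y_def sum_distrib_right by (intro sum.cong refl) (simp add: mult.assoc)
  qed
  have eq: "(1 / n) *\<^sub>R (tp Z * Zh) = (e + X) * Q0"
    using n Ye by (simp add: ZZh X_def scaleR_add_right distrib_right mult.assoc Q0')
  have r1: "1000 * h\<^sup>2 \<le> 1/10" using h2 h by simp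
  then have r1': "1000 * h\<^sup>2 \<le> 1" by simp
  have "norm (Q - (e + (1/2) *\<^sub>R (X - tp X)) * Q0) \<le> 17 * (1000 * h\<^sup>2)\<^sup>2"
    using polar_factor_expansion[OF polar_factor_scaleR[OF Q, of "1 / n"] eq[unfolded e_def] Q0o Xe[unfolded e_def] nX r1']
    by (simp add: e_def)
  moreover have "17 * (1000 * h\<^sup>2)\<^sup>2 \<le> 1.7 * (1000 * h\<^sup>2)"
    using mult_left_mono[OF r1, of "1000 * h\<^sup>2"] by (simp add: power2_eq_square)
  moreover have "norm ((1/2) *\<^sub>R (X - tp X) * Q0) \<le> 1000 * h\<^sup>2"
  proof (rule norm_mult_le_left[OF _ Q0'(7)])
    have "norm (X - tp X) \<le> 1000 * h\<^sup>2 + 1000 * h\<^sup>2" using nX by (intro norm_diff_le) auto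
    then show "norm ((1/2) *\<^sub>R (X - tp X)) \<le> 1000 * h\<^sup>2" by simp
  qed
  ultimately have "norm ((Q - (e + (1/2) *\<^sub>R (X - tp X)) * Q0) + (1/2) *\<^sub>R (X - tp X) * Q0)
      \<le> 1.7 * (1000 * h\<^sup>2) + 1000 * h\<^sup>2"
    by (intro norm_add_le) auto
  also have "(Q - (e + (1/2) *\<^sub>R (X - tp X)) * Q0) + (1/2) *\<^sub>R (X - tp X) * Q0 = Q - Q0"
    by (simp add: distrib_right Q0')
  finally have nQ: "norm (Q - Q0) \<le> 2700 * h\<^sup>2" by simp
  have "P i - (e + A' i) * blk d i Z * Q = E0 i - (e + A' i) * (blk d i Z * (Q - Q0))"
    by (simp add: E0_def algebra_simps)
  also have "norm \<dots> \<le> 1000 * h\<^sup>2 + (1 + h) * (2700 * h\<^sup>2)"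
    using main[OF i] nA'[OF i] norm_idm_le_1[of d] nQ orthfD(7)[OF Zi[OF i]]
    by (intro norm_diff_le[OF _ norm_mult_le[OF norm_add_le norm_mult_le_right]]) (auto simp: E0_def e_def)
  also have "(1 + h) * (2700 * h\<^sup>2) \<le> 4000 * h\<^sup>2"
  proof -
    have "(1 + h) * (2700 * h\<^sup>2) \<le> (5/4) * (2700 * h\<^sup>2)" using h by (intro mult_right_mono) auto
    also have "\<dots> \<le> 4000 * h\<^sup>2" by simp
    finally show ?thesis .
  qed
  finally have "norm (P i - (e + A' i) * blk d i Z * Q) \<le> 5000 * h\<^sup>2"
    using zero_le_power2[of h] by linarith
  moreover have "A' i = (\<sigma> / (2 * real n)) *\<^sub>R (blk d i W * Z * tp (blk d i Z) - tp (blk d i W * Z * tp (blk d i Z)))"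
    by (simp add: A'_def A_def scaleR_diff_right)
  ultimately show "norm (P i - (idm d + (\<sigma> / (2 * real n)) *\<^sub>R (blk d i W * Z * tp (blk d i Z) - tp (blk d i W * Z * tp (blk d i Z))))
        * blk d i Z * Q) \<le> 5000 * h\<^sup>2" by (simp add: e_def)
qed

end

section \<open>Linear forms in independent Gaussians\<close>

context prob_space
begin

text \<open>
  Restrict the family to singletons and evaluate.
\<close>

lemma indep_vars_reindex_inj:
  assumes ind: "indep_vars (\<lambda>_. N) X I" and f: "inj_on f J" "f ` J \<subseteq> I"
  shows "indep_vars (\<lambda>_. N) (\<lambda>j. X (f j)) J"
proof -
  have "indep_vars (\<lambda>j. PiM {f j} (\<lambda>_. N)) (\<lambda>j \<omega>. restrict (\<lambda>i. X i \<omega>) {f j}) J"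
    using f by (intro indep_vars_restrict[OF ind]) (auto simp: disjoint_family_on_def inj_on_def)
  then have "indep_vars (\<lambda>_. N) (\<lambda>j \<omega>. (\<lambda>x. x (f j)) (restrict (\<lambda>i. X i \<omega>) {f j})) J"
    by (rule indep_vars_compose2) (rule measurable_component_singleton, simp)
  then show ?thesis by simp
qed

lemma std_normal_mgf:
  assumes X: "distributed M lborel X std_normal_density"
  shows "(\<integral>\<^sup>+\<omega>. ennreal (exp (a * X \<omega>)) \<partial>M) = ennreal (exp (a\<^sup>2 / 2))"
proof -
  have "(\<integral>\<^sup>+\<omega>. ennreal (exp (a * X \<omega>)) \<partial>M)
      = (\<integral>\<^sup>+x. ennreal (std_normal_density x) * ennreal (exp (a * x)) \<partial>lborel)"
    by (rule distributed_nn_integral[OF X, symmetric]) simp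
  also have "\<dots> = (\<integral>\<^sup>+x. ennreal (exp (a\<^sup>2 / 2)) * ennreal (normal_density a 1 x) \<partial>lborel)"
  proof (intro nn_integral_cong)
    fix x :: real
    have "std_normal_density x * exp (a * x) = exp (a\<^sup>2 / 2) * normal_density a 1 x"
      by (simp add: std_normal_density_def normal_density_def field_simps flip: exp_add)
         (simp add: power2_eq_square field_simps)
    then show "ennreal (std_normal_density x) * ennreal (exp (a * x)) = ennreal (exp (a\<^sup>2 / 2)) * ennreal (normal_density a 1 x)"
      by (simp flip: ennreal_mult)
  qed
  also have "\<dots> = ennreal (exp (a\<^sup>2 / 2)) * (\<integral>\<^sup>+x. ennreal (normal_density a 1 x) \<partial>lborel)"
    by (rule nn_integral_cmult) simp
  also have "(\<integral>\<^sup>+x. ennreal (normal_density a 1 x) \<partial>lborel) = 1"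
    using prob_space.emeasure_space_1[OF prob_space_normal_density[of 1 a]]
    by (simp add: emeasure_density)
  finally show ?thesis by simp
qed

text \<open>
  The Chernoff bound at the optimal parameter \<open>t / s\<^sup>2\<close>.
\<close>

lemma gaussian_sum_upper_tail:
  assumes K: "finite K" and ind: "indep_vars (\<lambda>_. borel) X K"
    and X: "\<And>k. k \<in> K \<Longrightarrow> distributed M lborel (X k) std_normal_density"
    and c: "(\<Sum>k\<in>K. (c k)\<^sup>2) \<le> s\<^sup>2" and s: "0 < s" and t: "0 < t"
  shows "prob {\<omega>\<in>space M. t \<le> (\<Sum>k\<in>K. c k * X k \<omega>)} \<le> exp (- t\<^sup>2 / (2 * s\<^sup>2))"
proof -
  have [measurable]: "X k \<in> borel_measurable M" if "k \<in> K" for k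
    using distributed_measurable[OF X[OF that]] by simp
  define l where "l = t / s\<^sup>2"
  have l: "0 < l" using s t by (simp add: l_def)
  have "ennreal (prob {\<omega>\<in>space M. t \<le> (\<Sum>k\<in>K. c k * X k \<omega>)})
      = emeasure M {\<omega>\<in>space M. t \<le> (\<Sum>k\<in>K. c k * X k \<omega>)}"
    by (simp add: emeasure_eq_measure)
  also have "\<dots> \<le> ennreal (exp (- l * t)) * (\<integral>\<^sup>+\<omega>\<in>space M. ennreal (exp (l * (\<Sum>k\<in>K. c k * X k \<omega>))) \<partial>M)"
    by (intro Chernoff_ineq_nn_integral_ge l) auto
  also have "(\<integral>\<^sup>+\<omega>\<in>space M. ennreal (exp (l * (\<Sum>k\<in>K. c k * X k \<omega>))) \<partial>M)
      = (\<integral>\<^sup>+\<omega>. (\<Prod>k\<in>K. ennreal (exp ((l * c k) * X k \<omega>))) \<partial>M)"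
    by (intro nn_integral_cong)
       (simp_all add: sum_distrib_left exp_sum K prod_ennreal mult.assoc)
  also have "\<dots> = (\<Prod>k\<in>K. \<integral>\<^sup>+\<omega>. ennreal (exp ((l * c k) * X k \<omega>)) \<partial>M)"
    by (intro indep_vars_nn_integral K indep_vars_compose2[OF ind]) auto
  also have "\<dots> = (\<Prod>k\<in>K. ennreal (exp ((l * c k)\<^sup>2 / 2)))"
    by (intro prod.cong refl std_normal_mgf X)
  also have "\<dots> = ennreal (exp (l\<^sup>2 / 2 * (\<Sum>k\<in>K. (c k)\<^sup>2)))"
    by (simp add: prod_ennreal exp_sum[symmetric] K sum_distrib_left power_mult_distrib)
  also have "ennreal (exp (- l * t)) * \<dots> = ennreal (exp (l\<^sup>2 / 2 * (\<Sum>k\<in>K. (c k)\<^sup>2) - l * t))"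
    by (simp add: mult_exp_exp algebra_simps flip: ennreal_mult)
  finally have "prob {\<omega>\<in>space M. t \<le> (\<Sum>k\<in>K. c k * X k \<omega>)} \<le> exp (l\<^sup>2 / 2 * (\<Sum>k\<in>K. (c k)\<^sup>2) - l * t)"
    by (subst (asm) ennreal_le_iff) simp_all
  also have "\<dots> \<le> exp (l\<^sup>2 / 2 * s\<^sup>2 - l * t)" using c by (simp add: mult_left_mono)
  also have "l\<^sup>2 / 2 * s\<^sup>2 - l * t = - t\<^sup>2 / (2 * s\<^sup>2)"
    using s by (simp add: l_def field_simps power2_eq_square)
  finally show ?thesis .
qed

lemma gaussian_sum_tail:
  assumes K: "finite K" and ind: "indep_vars (\<lambda>_. borel) X K"
    and X: "\<And>k. k \<in> K \<Longrightarrow> distributed M lborel (X k) std_normal_density"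
    and c: "(\<Sum>k\<in>K. (c k)\<^sup>2) \<le> s\<^sup>2" and s: "0 < s" and t: "0 < t"
  shows "prob {\<omega>\<in>space M. t < \<bar>\<Sum>k\<in>K. c k * X k \<omega>\<bar>} \<le> 2 * exp (- t\<^sup>2 / (2 * s\<^sup>2))"
proof -
  have [measurable]: "X k \<in> borel_measurable M" if "k \<in> K" for k
    using distributed_measurable[OF X[OF that]] by simp
  have "prob {\<omega>\<in>space M. t < \<bar>\<Sum>k\<in>K. c k * X k \<omega>\<bar>}
      \<le> prob ({\<omega>\<in>space M. t \<le> (\<Sum>k\<in>K. c k * X k \<omega>)} \<union> {\<omega>\<in>space M. t \<le> (\<Sum>k\<in>K. - c k * X k \<omega>)})"
    by (intro finite_measure_mono) (auto simp: abs_if sum_negf split: if_splits)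
  also have "\<dots> \<le> prob {\<omega>\<in>space M. t \<le> (\<Sum>k\<in>K. c k * X k \<omega>)} + prob {\<omega>\<in>space M. t \<le> (\<Sum>k\<in>K. - c k * X k \<omega>)}"
    by (intro measure_Un_le) auto
  also have "\<dots> \<le> exp (- t\<^sup>2 / (2 * s\<^sup>2)) + exp (- t\<^sup>2 / (2 * s\<^sup>2))"
    using c by (intro add_mono gaussian_sum_upper_tail K ind X s t) auto
  finally show ?thesis by simp
qed

text \<open>
  Conditionally on the variables indexed by \<open>J\<close> the coefficients are constants, and the tail bound is the same
  for all of them; integrate it over the law of those variables. Truncating at the event that the
  coefficients are small makes a single deterministic \<open>s\<close> sufficient.
\<close>

lemma gaussian_sum_conditional_tail:
  fixes X :: "'i \<Rightarrow> 'a \<Rightarrow> real"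
  assumes K: "finite K" and ind: "indep_vars (\<lambda>_. borel) X I" and KJ: "K \<subseteq> I" "J \<subseteq> I" "J \<inter> K = {}"
    and X: "\<And>k. k \<in> K \<Longrightarrow> distributed M lborel (X k) std_normal_density"
    and c: "\<And>k. k \<in> K \<Longrightarrow> c k \<in> borel_measurable (PiM J (\<lambda>_. borel))"
    and s: "0 < s" and t: "0 < t"
  defines "B \<equiv> \<lambda>\<omega>. restrict (\<lambda>i. X i \<omega>) J"
  shows "{\<omega>\<in>space M. (\<Sum>k\<in>K. (c k (B \<omega>))\<^sup>2) \<le> s\<^sup>2 \<and> t < \<bar>\<Sum>k\<in>K. c k (B \<omega>) * X k \<omega>\<bar>} \<in> sets M" (is "?S \<in> _")
    "prob {\<omega>\<in>space M. (\<Sum>k\<in>K. (c k (B \<omega>))\<^sup>2) \<le> s\<^sup>2 \<and> t < \<bar>\<Sum>k\<in>K. c k (B \<omega>) * X k \<omega>\<bar>}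
      \<le> 2 * exp (- t\<^sup>2 / (2 * s\<^sup>2))"
proof -
  let ?J = "PiM J (\<lambda>_. borel :: real measure)" and ?K = "PiM K (\<lambda>_. borel :: real measure)"
  define A where "A = (\<lambda>\<omega>. restrict (\<lambda>i. X i \<omega>) K)"
  have iv: "indep_var ?J B ?K A"
    unfolding A_def B_def using KJ by (intro indep_var_restrict[OF ind])
  have mB[measurable]: "B \<in> measurable M ?J" and mA[measurable]: "A \<in> measurable M ?K"
    using iv by (auto dest: indep_var_rv1 indep_var_rv2)
  note [measurable] = c
  have mX[measurable]: "X k \<in> borel_measurable M" if "k \<in> K" for k
    using distributed_measurable[OF X[OF that]] by simp
  define S where "S = {p \<in> space (?J \<Otimes>\<^sub>M ?K). (\<Sum>k\<in>K. (c k (fst p))\<^sup>2) \<le> s\<^sup>2 \<and> t < \<bar>\<Sum>k\<in>K. c k (fst p) * snd p k\<bar>}"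
  have mS[measurable]: "S \<in> sets (?J \<Otimes>\<^sub>M ?K)" unfolding S_def by measurable
  show "?S \<in> sets M" by measurable
  have eqS: "?S = (\<lambda>\<omega>. (B \<omega>, A \<omega>)) -` S \<inter> space M"
    using measurable_space[OF mA] measurable_space[OF mB]
    by (auto simp: S_def space_pair_measure A_def)
  have "emeasure M ?S = emeasure (distr M (?J \<Otimes>\<^sub>M ?K) (\<lambda>\<omega>. (B \<omega>, A \<omega>))) S"
    unfolding eqS by (subst emeasure_distr) auto
  also have "distr M (?J \<Otimes>\<^sub>M ?K) (\<lambda>\<omega>. (B \<omega>, A \<omega>)) = distr M ?J B \<Otimes>\<^sub>M distr M ?K A"
    using iv by (simp add: indep_var_distribution_eq)
  also have "emeasure (distr M ?J B \<Otimes>\<^sub>M distr M ?K A) S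
      = (\<integral>\<^sup>+b. emeasure (distr M ?K A) (Pair b -` S) \<partial>distr M ?J B)"
  proof -
    interpret A: prob_space "distr M ?K A" by (rule prob_space_distr) simp
    have "sets (distr M ?J B \<Otimes>\<^sub>M distr M ?K A) = sets (?J \<Otimes>\<^sub>M ?K)"
      by (rule sets_pair_measure_cong; rule sets_distr)
    with mS have "S \<in> sets (distr M ?J B \<Otimes>\<^sub>M distr M ?K A)" by (simp only:)
    then show ?thesis by (rule A.emeasure_pair_measure_alt)
  qed
  also have "\<dots> \<le> (\<integral>\<^sup>+b. ennreal (2 * exp (- t\<^sup>2 / (2 * s\<^sup>2))) \<partial>distr M ?J B)"
  proof (rule nn_integral_mono)
    fix b assume "b \<in> space (distr M ?J B)"
    then have b: "b \<in> space ?J" by simp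
    have "emeasure (distr M ?K A) (Pair b -` S) = emeasure M (A -` (Pair b -` S) \<inter> space M)"
      by (rule emeasure_distr) (auto intro: sets_Pair1[OF mS])
    also have "A -` (Pair b -` S) \<inter> space M
        = {\<omega>\<in>space M. (\<Sum>k\<in>K. (c k b)\<^sup>2) \<le> s\<^sup>2 \<and> t < \<bar>\<Sum>k\<in>K. c k b * X k \<omega>\<bar>}"
      using measurable_space[OF mA] b by (auto simp: S_def space_pair_measure A_def)
    also have "emeasure M \<dots> \<le> ennreal (2 * exp (- t\<^sup>2 / (2 * s\<^sup>2)))"
    proof (cases "(\<Sum>k\<in>K. (c k b)\<^sup>2) \<le> s\<^sup>2")
      case True
      then show ?thesis
        using gaussian_sum_tail[OF K indep_vars_subset[OF ind KJ(1)] X True s t]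
        by (simp add: emeasure_eq_measure ennreal_leI)
    qed simp
    finally show "emeasure (distr M ?K A) (Pair b -` S) \<le> ennreal (2 * exp (- t\<^sup>2 / (2 * s\<^sup>2)))" .
  qed
  also have "\<dots> = ennreal (2 * exp (- t\<^sup>2 / (2 * s\<^sup>2)))"
  proof -
    interpret B: prob_space "distr M ?J B" by (rule prob_space_distr) simp
    show ?thesis using B.emeasure_space_1 by (simp add: nn_integral_const)
  qed
  finally show "prob ?S \<le> 2 * exp (- t\<^sup>2 / (2 * s\<^sup>2))"
    by (simp add: emeasure_eq_measure)
qed

text \<open>
  After normalisation \<open>w\<close> is a density for which \<open>X\<close> has the characteristic function of the standard normal
  law; apply the uniqueness theorem of Levy.
\<close>

lemma weighted_std_normal_law:
  fixes X w :: "'a \<Rightarrow> real"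
  assumes X[measurable]: "X \<in> borel_measurable M" and w[measurable]: "w \<in> borel_measurable M"
    and w0: "\<And>\<omega>. 0 \<le> w \<omega>" and wb: "\<And>\<omega>. w \<omega> \<le> b"
    and ch: "\<And>s. (CLINT \<omega>|M. complex_of_real (w \<omega>) * iexp (s * X \<omega>)) = complex_of_real (C * exp (- s\<^sup>2 / 2))"
    and A[measurable]: "A \<in> sets borel"
  shows "(\<integral>\<omega>. w \<omega> * indicator A (X \<omega>) \<partial>M) = C * measure std_normal_distribution A"
proof -
  have int: "integrable M w"
    by (rule integrable_const_bound[where B=b]) (auto simp: w0 wb)
  have "complex_of_real (\<integral>\<omega>. w \<omega> \<partial>M) = complex_of_real C"
    using ch[of 0] by simp
  then have C: "(\<integral>\<omega>. w \<omega> \<partial>M) = C" by (simp only: of_real_eq_iff)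
  then have C0: "0 \<le> C" using w0 by (metis Bochner_Integration.integral_nonneg)
  show ?thesis
  proof (cases "C = 0")
    case True
    then have "AE \<omega> in M. w \<omega> = 0" using integral_nonneg_eq_0_iff_AE[OF int] w0 C by simp
    then have "(\<integral>\<omega>. w \<omega> * indicator A (X \<omega>) \<partial>M) = (\<integral>\<omega>. 0 \<partial>M)"
      by (intro integral_cong_AE) auto
    then show ?thesis using True by simp
  next
    case False
    then have Cpos: "0 < C" using C0 by simp
    define \<mu> where "\<mu> = density M (\<lambda>\<omega>. ennreal (w \<omega> / C))"
    have [simp]: "space \<mu> = space M" "sets \<mu> = sets M" by (simp_all add: \<mu>_def)
    have prob: "prob_space \<mu>"
    proof (rule prob_spaceI)
      have "emeasure \<mu> (space \<mu>) = (\<integral>\<^sup>+\<omega>. ennreal (w \<omega> / C) \<partial>M)"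
        unfolding \<mu>_def by (subst emeasure_density) (auto intro!: nn_integral_cong)
      also have "\<dots> = ennreal (\<integral>\<omega>. w \<omega> / C \<partial>M)"
        using w0 Cpos int by (intro nn_integral_eq_integral) auto
      also have "\<dots> = 1" using C Cpos by simp
      finally show "emeasure \<mu> (space \<mu>) = 1" .
    qed
    have mX: "X \<in> borel_measurable \<mu>" by (simp add: \<mu>_def)
    have rd: "real_distribution (distr \<mu> borel X)"
      using prob mX by (intro prob_space.real_distribution_distr) auto
    have rs: "real_distribution std_normal_distribution"
      unfolding real_distribution_def real_distribution_axioms_def
      using prob_space_normal_density[of 1 0] by auto
    have "char (distr \<mu> borel X) s = char std_normal_distribution s" for s
    proof -
      have "char (distr \<mu> borel X) s = (CLINT \<omega>|\<mu>. iexp (s * X \<omega>))"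
        unfolding char_def using mX by (subst integral_distr) auto
      also have "\<dots> = (CLINT \<omega>|M. (w \<omega> / C) *\<^sub>R iexp (s * X \<omega>))"
        unfolding \<mu>_def using w0 Cpos by (subst integral_density) auto
      also have "\<dots> = (CLINT \<omega>|M. complex_of_real (1 / C) * (complex_of_real (w \<omega>) * iexp (s * X \<omega>)))"
        by (intro Bochner_Integration.integral_cong refl) (simp add: scaleR_conv_of_real)
      also have "\<dots> = complex_of_real (1 / C) * (CLINT \<omega>|M. complex_of_real (w \<omega>) * iexp (s * X \<omega>))"
        by (rule integral_mult_right_zero)
      also have "\<dots> = complex_of_real (exp (- s\<^sup>2 / 2))" unfolding ch using Cpos by simp
      finally show ?thesis by (simp add: char_std_normal_distribution)
    qed
    then have law: "distr \<mu> borel X = std_normal_distribution"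
      by (intro Levy_uniqueness rd rs) auto
    have "measure std_normal_distribution A = measure \<mu> (X -` A \<inter> space \<mu>)"
      unfolding law[symmetric] using mX by (subst measure_distr) auto
    also have "\<dots> = (\<integral>\<omega>. indicator (X -` A \<inter> space M) \<omega> \<partial>\<mu>)" by simp
    also have "\<dots> = (\<integral>\<omega>. (w \<omega> / C) *\<^sub>R indicator (X -` A \<inter> space M) \<omega> \<partial>M)"
      unfolding \<mu>_def using w0 Cpos by (subst integral_density) auto
    also have "\<dots> = (\<integral>\<omega>. (1 / C) * (w \<omega> * indicator A (X \<omega>)) \<partial>M)"
      by (intro Bochner_Integration.integral_cong refl) (auto simp: indicator_def)
    also have "\<dots> = (1 / C) * (\<integral>\<omega>. w \<omega> * indicator A (X \<omega>) \<partial>M)" by (rule integral_mult_right_zero)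
    finally show ?thesis using Cpos by simp
  qed
qed

text \<open>
  Uniqueness for characteristic functions in several variables, reduced to one variable. The exponentials
  are replaced by indicators one at a time. In the step, all other factors form a complex weight,
  whereas uniqueness applies to nonnegative weights; the weights \<open>f\<close>, \<open>f (1 + cos u)\<close> and \<open>f (1 + sin u)\<close>
  are nonnegative and recover \<open>f exp (i u)\<close> by linearity.
\<close>

lemma gaussian_char_imp_product:
  fixes L :: "'p \<Rightarrow> 'a \<Rightarrow> real"
  assumes P: "finite P" and L: "\<And>p. p \<in> P \<Longrightarrow> L p \<in> borel_measurable M"
    and ch: "\<And>t. (CLINT \<omega>|M. iexp (\<Sum>p\<in>P. t p * L p \<omega>)) = complex_of_real (exp (- (\<Sum>p\<in>P. (t p)\<^sup>2) / 2))"
    and Q: "Q \<subseteq> P" and A: "\<And>q. A q \<in> sets borel"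
  shows "(CLINT \<omega>|M. complex_of_real (\<Prod>q\<in>Q. indicator (A q) (L q \<omega>)) * iexp (\<Sum>p\<in>P - Q. t p * L p \<omega>))
    = complex_of_real ((\<Prod>q\<in>Q. measure std_normal_distribution (A q)) * exp (- (\<Sum>p\<in>P - Q. (t p)\<^sup>2) / 2))"
  using finite_subset[OF Q P] Q
proof (induction Q arbitrary: t rule: finite_induct)
  case empty
  show ?case using ch[of t] by simp
next
  case (insert q Q)
  note [measurable] = L A
  define R where "R = P - insert q Q"
  have PQ: "P - Q = insert q R" and qR: "q \<notin> R" and finR: "finite R" and qP: "q \<in> P"
    using insert.hyps insert.prems P by (auto simp: R_def)
  have sub: "Q \<subseteq> P" "R \<subseteq> P" using insert.prems by (auto simp: R_def)
  define f :: "'a \<Rightarrow> real" where "f \<omega> = (\<Prod>q\<in>Q. indicator (A q) (L q \<omega>))" for \<omega>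
  define u where "u \<omega> = (\<Sum>p\<in>R. t p * L p \<omega>)" for \<omega>
  define c where "c = (\<Prod>q\<in>Q. measure std_normal_distribution (A q))"
  define \<tau> where "\<tau> = exp (- (\<Sum>p\<in>R. (t p)\<^sup>2) / 2)"
  have mL[measurable]: "L q \<in> borel_measurable M" using L qP .
  have mf[measurable]: "f \<in> borel_measurable M" unfolding f_def[abs_def]
    using sub by (intro borel_measurable_prod measurable_compose[OF L borel_measurable_indicator[OF A]]) auto
  have mu[measurable]: "u \<in> borel_measurable M" unfolding u_def[abs_def]
    using sub by (intro borel_measurable_sum borel_measurable_times borel_measurable_const L) auto
  have f01: "0 \<le> f \<omega>" "f \<omega> \<le> 1" for \<omega>
    by (auto simp: f_def intro!: prod_nonneg prod_le_1)
  have IH: "(CLINT \<omega>|M. complex_of_real (f \<omega>) * iexp (s * L q \<omega> + e * u \<omega>))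
      = complex_of_real (c * exp (- s\<^sup>2 / 2) * exp (- (\<Sum>p\<in>R. (e * t p)\<^sup>2) / 2))" for s e
  proof -
    define t' where "t' p = (if p = q then s else e * t p)" for p
    have "(\<Sum>p\<in>P - Q. t' p * L p \<omega>) = s * L q \<omega> + e * u \<omega>" for \<omega>
    proof -
      have "(\<Sum>p\<in>R. t' p * L p \<omega>) = e * u \<omega>"
        unfolding u_def sum_distrib_left using qR by (intro sum.cong) (auto simp: t'_def)
      then show ?thesis using qR finR by (simp add: PQ t'_def)
    qed
    moreover have "(\<Sum>p\<in>P - Q. (t' p)\<^sup>2) = s\<^sup>2 + (\<Sum>p\<in>R. (e * t p)\<^sup>2)"
    proof -
      have "(\<Sum>p\<in>R. (t' p)\<^sup>2) = (\<Sum>p\<in>R. (e * t p)\<^sup>2)"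
        using qR by (intro sum.cong) (auto simp: t'_def)
      then show ?thesis using qR finR by (simp add: PQ t'_def)
    qed
    ultimately have "(CLINT \<omega>|M. complex_of_real (f \<omega>) * iexp (s * L q \<omega> + e * u \<omega>))
        = complex_of_real (c * exp (- (s\<^sup>2 + (\<Sum>p\<in>R. (e * t p)\<^sup>2)) / 2))"
      using insert.IH[OF sub(1), of t'] by (simp only: f_def c_def)
    also have "- (s\<^sup>2 + (\<Sum>p\<in>R. (e * t p)\<^sup>2)) / 2 = - s\<^sup>2 / 2 + - (\<Sum>p\<in>R. (e * t p)\<^sup>2) / 2"
      by (simp add: add_divide_distrib diff_divide_distrib)
    finally show ?thesis by (simp only: exp_add mult.assoc)
  qed
  have e0: "(CLINT \<omega>|M. complex_of_real (f \<omega>) * iexp (s * L q \<omega>)) = complex_of_real (c * exp (- s\<^sup>2 / 2))" for s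
    using IH[of s 0] by simp
  have e1: "(CLINT \<omega>|M. complex_of_real (f \<omega>) * iexp (s * L q \<omega> + u \<omega>)) = complex_of_real (c * exp (- s\<^sup>2 / 2) * \<tau>)" for s
    using IH[of s 1] by (simp add: \<tau>_def)
  have e2: "(CLINT \<omega>|M. complex_of_real (f \<omega>) * iexp (s * L q \<omega> - u \<omega>)) = complex_of_real (c * exp (- s\<^sup>2 / 2) * \<tau>)" for s
    using IH[of s "-1"] by (simp add: \<tau>_def)
  have int: "integrable M (\<lambda>\<omega>. complex_of_real (f \<omega>) * iexp (g \<omega>))" if [measurable]: "g \<in> borel_measurable M" for g
    by (rule integrable_const_bound[where B=1]) (auto simp: norm_mult f01)
  have iexp_sum: "iexp (x + y) = iexp x * iexp y" for x y
    by (simp add: distrib_left exp_add)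
  have iexp_diff: "iexp (x - y) = iexp x * iexp (- y)" for x y
    using iexp_sum[of x "- y"] by simp
  have cos_algebra: "F * (1 + (b + b') / 2) * a = F * a + (1/2) * (F * (a * b) + F * (a * b'))" for F a b b' :: complex
    by (simp add: field_simps)
  have sin_algebra: "F * (1 + (b - b') / (2 * \<i>)) * a = F * a + (1/(2*\<i>)) * (F * (a * b) - F * (a * b'))" for F a b b' :: complex
    by (simp add: field_simps)
  let ?N = "measure std_normal_distribution (A q)"
  have "(\<integral>\<omega>. f \<omega> * indicator (A q) (L q \<omega>) \<partial>M) = c * ?N"
    by (rule weighted_std_normal_law[OF mL mf f01 e0 A])
  moreover have "(\<integral>\<omega>. f \<omega> * (1 + cos (u \<omega>)) * indicator (A q) (L q \<omega>) \<partial>M) = c * (1 + \<tau>) * ?N"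
  proof (rule weighted_std_normal_law[OF mL _ _ _ _ A])
    show "0 \<le> f \<omega> * (1 + cos (u \<omega>))" for \<omega>
      
    proof -
      have "0 \<le> 1 + cos (u \<omega>)" using cos_ge_minus_one[of "u \<omega>"] by linarith
      then show ?thesis using f01[of \<omega>] by simp
    qed
    show "f \<omega> * (1 + cos (u \<omega>)) \<le> 1 * 2" for \<omega>
      
    proof -
      have "0 \<le> 1 + cos (u \<omega>)" "1 + cos (u \<omega>) \<le> 2"
        using cos_ge_minus_one[of "u \<omega>"] cos_le_one[of "u \<omega>"] by linarith+
      then show ?thesis using f01[of \<omega>] by (intro mult_mono) auto
    qed
    show "(CLINT \<omega>|M. complex_of_real (f \<omega> * (1 + cos (u \<omega>))) * iexp (s * L q \<omega>))
        = complex_of_real (c * (1 + \<tau>) * exp (- s\<^sup>2 / 2))" for s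
    proof -
      have "complex_of_real (f \<omega> * (1 + cos (u \<omega>))) * iexp (s * L q \<omega>)
          = complex_of_real (f \<omega>) * iexp (s * L q \<omega>)
          + (1/2) * (complex_of_real (f \<omega>) * iexp (s * L q \<omega> + u \<omega>) + complex_of_real (f \<omega>) * iexp (s * L q \<omega> - u \<omega>))" for \<omega>
      proof -
        have "complex_of_real (cos (u \<omega>)) = (iexp (u \<omega>) + iexp (- u \<omega>)) / 2"
          by (simp add: cos_exp_eq flip: cos_of_real)
        then have "complex_of_real (f \<omega> * (1 + cos (u \<omega>))) = complex_of_real (f \<omega>) * (1 + (iexp (u \<omega>) + iexp (- u \<omega>)) / 2)"
          by simp
        then show ?thesis by (simp only: iexp_sum iexp_diff cos_algebra)
      qed
      then have "(CLINT \<omega>|M. complex_of_real (f \<omega> * (1 + cos (u \<omega>))) * iexp (s * L q \<omega>))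
          = complex_of_real (c * exp (- s\<^sup>2 / 2)) + (1/2) * (complex_of_real (c * exp (- s\<^sup>2 / 2) * \<tau>) + complex_of_real (c * exp (- s\<^sup>2 / 2) * \<tau>))"
        by (simp only: Bochner_Integration.integral_add integral_mult_right_zero int integrable_mult_right
            Bochner_Integration.integrable_add e0 e1 e2 mL mu borel_measurable_add borel_measurable_diff borel_measurable_times borel_measurable_const)
      then show ?thesis by (simp add: algebra_simps)
    qed
  qed simp
  moreover have "(\<integral>\<omega>. f \<omega> * (1 + sin (u \<omega>)) * indicator (A q) (L q \<omega>) \<partial>M) = c * ?N"
  proof (rule weighted_std_normal_law[OF mL _ _ _ _ A])
    show "0 \<le> f \<omega> * (1 + sin (u \<omega>))" for \<omega>
      
    proof -
      have "0 \<le> 1 + sin (u \<omega>)" using sin_ge_minus_one[of "u \<omega>"] by linarith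
      then show ?thesis using f01[of \<omega>] by simp
    qed
    show "f \<omega> * (1 + sin (u \<omega>)) \<le> 1 * 2" for \<omega>
      
    proof -
      have "0 \<le> 1 + sin (u \<omega>)" "1 + sin (u \<omega>) \<le> 2"
        using sin_ge_minus_one[of "u \<omega>"] sin_le_one[of "u \<omega>"] by linarith+
      then show ?thesis using f01[of \<omega>] by (intro mult_mono) auto
    qed
    show "(CLINT \<omega>|M. complex_of_real (f \<omega> * (1 + sin (u \<omega>))) * iexp (s * L q \<omega>))
        = complex_of_real (c * exp (- s\<^sup>2 / 2))" for s
    proof -
      have "complex_of_real (f \<omega> * (1 + sin (u \<omega>))) * iexp (s * L q \<omega>)
          = complex_of_real (f \<omega>) * iexp (s * L q \<omega>)
          + (1/(2*\<i>)) * (complex_of_real (f \<omega>) * iexp (s * L q \<omega> + u \<omega>) - complex_of_real (f \<omega>) * iexp (s * L q \<omega> - u \<omega>))" for \<omega>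
      proof -
        have "complex_of_real (sin (u \<omega>)) = (iexp (u \<omega>) - iexp (- u \<omega>)) / (2 * \<i>)"
          by (simp add: sin_exp_eq flip: sin_of_real)
        then have "complex_of_real (f \<omega> * (1 + sin (u \<omega>))) = complex_of_real (f \<omega>) * (1 + (iexp (u \<omega>) - iexp (- u \<omega>)) / (2 * \<i>))"
          by simp
        then show ?thesis by (simp only: iexp_sum iexp_diff sin_algebra)
      qed
      then have "(CLINT \<omega>|M. complex_of_real (f \<omega> * (1 + sin (u \<omega>))) * iexp (s * L q \<omega>))
          = complex_of_real (c * exp (- s\<^sup>2 / 2)) + (1/(2*\<i>)) * (complex_of_real (c * exp (- s\<^sup>2 / 2) * \<tau>) - complex_of_real (c * exp (- s\<^sup>2 / 2) * \<tau>))"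
        by (simp only: Bochner_Integration.integral_add Bochner_Integration.integral_diff integral_mult_right_zero int integrable_mult_right
            Bochner_Integration.integrable_diff e0 e1 e2 mL mu borel_measurable_add borel_measurable_diff borel_measurable_times borel_measurable_const)
      then show ?thesis by simp
    qed
  qed simp
  moreover
  define g where "g \<omega> = f \<omega> * indicator (A q) (L q \<omega>)" for \<omega>
  have mg[measurable]: "g \<in> borel_measurable M" unfolding g_def by measurable
  have g01: "0 \<le> g \<omega>" "g \<omega> \<le> 1" for \<omega>
    using f01[of \<omega>] by (auto simp: g_def indicator_def)
  have ig: "integrable M g" "integrable M (\<lambda>\<omega>. g \<omega> * cos (u \<omega>))" "integrable M (\<lambda>\<omega>. g \<omega> * sin (u \<omega>))"
    by (rule integrable_const_bound[where B=1]; force simp: abs_mult g01 intro!: mult_le_one)+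
  ultimately have "(\<integral>\<omega>. g \<omega> \<partial>M) = c * ?N" "(\<integral>\<omega>. g \<omega> + g \<omega> * cos (u \<omega>) \<partial>M) = c * (1 + \<tau>) * ?N"
    "(\<integral>\<omega>. g \<omega> + g \<omega> * sin (u \<omega>) \<partial>M) = c * ?N"
    by (simp_all add: g_def algebra_simps)
  then have gc: "(\<integral>\<omega>. g \<omega> * cos (u \<omega>) \<partial>M) = c * \<tau> * ?N" and gs: "(\<integral>\<omega>. g \<omega> * sin (u \<omega>) \<partial>M) = 0"
    using ig by (simp_all add: algebra_simps)
  have "(CLINT \<omega>|M. complex_of_real (g \<omega>) * iexp (u \<omega>))
      = (CLINT \<omega>|M. complex_of_real (g \<omega> * cos (u \<omega>)) + \<i> * complex_of_real (g \<omega> * sin (u \<omega>)))"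
    by (intro Bochner_Integration.integral_cong refl) (simp add: exp_Euler algebra_simps cos_of_real sin_of_real)
  also have "\<dots> = complex_of_real (\<integral>\<omega>. g \<omega> * cos (u \<omega>) \<partial>M) + \<i> * complex_of_real (\<integral>\<omega>. g \<omega> * sin (u \<omega>) \<partial>M)"
    using ig by (simp del: of_real_mult)
  finally have "(CLINT \<omega>|M. complex_of_real (g \<omega>) * iexp (u \<omega>)) = complex_of_real (c * \<tau> * ?N)"
    unfolding gc gs by simp
  moreover have "(\<Prod>q'\<in>insert q Q. indicator (A q') (L q' \<omega>)) = g \<omega>" for \<omega>
    using insert.hyps by (simp add: g_def f_def)
  moreover have "(\<Prod>q'\<in>insert q Q. measure std_normal_distribution (A q')) = c * ?N"
    using insert.hyps by (simp add: c_def)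
  ultimately show ?case by (simp add: u_def \<tau>_def flip: R_def)
qed

lemma gaussian_char_imp_indep:
  fixes L :: "'p \<Rightarrow> 'a \<Rightarrow> real"
  assumes P: "finite P" "P \<noteq> {}" and L: "\<And>p. p \<in> P \<Longrightarrow> L p \<in> borel_measurable M"
    and ch: "\<And>t. (CLINT \<omega>|M. iexp (\<Sum>p\<in>P. t p * L p \<omega>)) = complex_of_real (exp (- (\<Sum>p\<in>P. (t p)\<^sup>2) / 2))"
  shows "indep_vars (\<lambda>_. borel) L P" "\<And>p. p \<in> P \<Longrightarrow> distributed M lborel (L p) std_normal_density"
proof -
  have joint: "prob (\<Inter>p\<in>P. L p -` A p \<inter> space M) = (\<Prod>p\<in>P. measure std_normal_distribution (A p))"
    if A: "\<And>p. A p \<in> sets borel" for A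
  proof -
    have "(CLINT \<omega>|M. complex_of_real (\<Prod>p\<in>P. indicator (A p) (L p \<omega>))) = complex_of_real (\<Prod>p\<in>P. measure std_normal_distribution (A p))"
      using gaussian_char_imp_product[where A=A and t="\<lambda>_. 0", OF P(1) L ch order_refl A] by simp
    then have "(\<integral>\<omega>. (\<Prod>p\<in>P. indicator (A p) (L p \<omega>)) \<partial>M) = (\<Prod>p\<in>P. measure std_normal_distribution (A p))"
      by (simp only: integral_complex_of_real of_real_eq_iff)
    moreover have ind: "(\<Prod>p\<in>P. indicator (A p) (L p \<omega>)) = (indicator (\<Inter>p\<in>P. L p -` A p \<inter> space M) \<omega> :: real)"
      if \<omega>: "\<omega> \<in> space M" for \<omega>
    proof (cases "\<forall>p\<in>P. L p \<omega> \<in> A p")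
      case True
      then show ?thesis using \<omega> P(2) by simp
    next
      case False
      then have "(\<Prod>p\<in>P. indicator (A p) (L p \<omega>)) = (0 :: real)"
        using P(1) by (intro prod_zero) (auto intro!: bexI)
      then show ?thesis using False by (auto simp: indicator_def)
    qed
    moreover have "(\<integral>\<omega>. (\<Prod>p\<in>P. indicator (A p) (L p \<omega>) :: real) \<partial>M) = (\<integral>\<omega>. indicator (\<Inter>p\<in>P. L p -` A p \<inter> space M) \<omega> \<partial>M)"
      by (intro Bochner_Integration.integral_cong refl ind)
    moreover have "(\<Inter>p\<in>P. L p -` A p \<inter> space M) \<in> sets M"
      using P L A by (intro sets.finite_INT) (auto intro!: measurable_sets)
    ultimately show ?thesis by simp
  qed
  have std: "measure std_normal_distribution UNIV = 1"
    using prob_space.prob_space[OF prob_space_normal_density[of 1 0]] by simp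
  have marg: "prob (L p -` B \<inter> space M) = measure std_normal_distribution B" if p: "p \<in> P" and B: "B \<in> sets borel" for p B
  proof -
    have "prob (\<Inter>q\<in>P. L q -` (if q = p then B else UNIV) \<inter> space M) = (\<Prod>q\<in>P. measure std_normal_distribution (if q = p then B else UNIV))"
      by (rule joint) (simp add: B)
    also have "(\<Inter>q\<in>P. L q -` (if q = p then B else UNIV) \<inter> space M) = L p -` B \<inter> space M"
      using p by (auto split: if_splits)
    also have "(\<Prod>q\<in>P. measure std_normal_distribution (if q = p then B else UNIV)) = (\<Prod>q\<in>P. if q = p then measure std_normal_distribution B else 1)"
      by (intro prod.cong) (auto simp: std)
    also have "\<dots> = measure std_normal_distribution B" using P p by (simp add: prod.delta)
    finally show ?thesis .
  qed
  show "indep_vars (\<lambda>_. borel) L P"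
  proof (subst indep_vars_finite[where E="\<lambda>_. sets borel"])
    show "\<forall>A\<in>P \<rightarrow> sets borel. prob (\<Inter>j\<in>P. L j -` A j \<inter> space M) = (\<Prod>j\<in>P. prob (L j -` A j \<inter> space M))"
    proof
      fix A :: "'p \<Rightarrow> real set" assume A: "A \<in> P \<rightarrow> sets borel"
      define A' where "A' p = (if p \<in> P then A p else {})" for p
      have "prob (\<Inter>j\<in>P. L j -` A j \<inter> space M) = prob (\<Inter>j\<in>P. L j -` A' j \<inter> space M)"
        by (simp add: A'_def)
      also have "\<dots> = (\<Prod>p\<in>P. measure std_normal_distribution (A' p))"
        using A by (intro joint) (auto simp: A'_def)
      also have "\<dots> = (\<Prod>j\<in>P. prob (L j -` A j \<inter> space M))"
      proof (intro prod.cong refl)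
        fix j assume j: "j \<in> P"
        then have "A j \<in> sets borel" using A by auto
        then show "measure std_normal_distribution (A' j) = prob (L j -` A j \<inter> space M)"
          using j by (simp add: A'_def marg)
      qed
      finally show "prob (\<Inter>j\<in>P. L j -` A j \<inter> space M) = (\<Prod>j\<in>P. prob (L j -` A j \<inter> space M))" .
    qed
    show "sets borel = sigma_sets (space borel) (sets (borel :: real measure))"
      by (metis sets.sigma_sets_eq)
    show "Int_stable (sets (borel :: real measure))" by (rule sets.Int_stable)
    show "sets borel \<subseteq> Pow (space (borel :: real measure))" by (rule sets.space_closed)
  qed (use P L in auto)
  fix p assume p: "p \<in> P"
  have "distr M lborel (L p) = std_normal_distribution"
  proof (rule measure_eqI)
    fix B assume "B \<in> sets (distr M lborel (L p))"
    then have B: "B \<in> sets borel" by simp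
    have "emeasure (distr M lborel (L p)) B = emeasure M (L p -` B \<inter> space M)"
      using B L[OF p] by (subst emeasure_distr) auto
    also have "\<dots> = emeasure std_normal_distribution B"
      using marg[OF p B] finite_measure.emeasure_eq_measure[OF prob_space.finite_measure[OF prob_space_normal_density[of 1 0]]]
      by (simp add: emeasure_eq_measure)
    finally show "emeasure (distr M lborel (L p)) B = emeasure std_normal_distribution B" .
  qed simp
  then show "distributed M lborel (L p) std_normal_density"
    using L[OF p] by (simp add: distributed_def)
qed

text \<open>
  Rotation invariance of the Gaussian law: the joint characteristic function depends on the coefficients
  only through their inner products.
\<close>

lemma orthonormal_combinations_std_normal:
  fixes Y :: "'k \<Rightarrow> 'a \<Rightarrow> real"
  assumes K: "finite K" and ind: "indep_vars (\<lambda>_. borel) Y K"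
    and Y: "\<And>k. k \<in> K \<Longrightarrow> distributed M lborel (Y k) std_normal_density"
    and P: "finite P" "P \<noteq> {}"
    and on: "\<And>p q. p \<in> P \<Longrightarrow> q \<in> P \<Longrightarrow> (\<Sum>k\<in>K. c p k * c q k) = (if p = q then 1 else 0)"
  shows "indep_vars (\<lambda>_. borel) (\<lambda>p \<omega>. \<Sum>k\<in>K. c p k * Y k \<omega>) P"
    "\<And>p. p \<in> P \<Longrightarrow> distributed M lborel (\<lambda>\<omega>. \<Sum>k\<in>K. c p k * Y k \<omega>) std_normal_density"
proof -
  have mY[measurable]: "Y k \<in> borel_measurable M" if "k \<in> K" for k
    using distributed_measurable[OF Y[OF that]] by simp
  have m: "(\<lambda>\<omega>. \<Sum>k\<in>K. c p k * Y k \<omega>) \<in> borel_measurable M" for p by measurable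
  have ch1: "(CLINT \<omega>|M. iexp (a * Y k \<omega>)) = complex_of_real (exp (- a\<^sup>2 / 2))" if k: "k \<in> K" for k a
  proof -
    have "distr M borel (Y k) = std_normal_distribution"
      using distributed_distr_eq_density[OF Y[OF k]] by (metis distr_cong sets_lborel)
    then have "char (distr M borel (Y k)) a = complex_of_real (exp (- a\<^sup>2 / 2))"
      by (simp add: char_std_normal_distribution)
    then show ?thesis unfolding char_def using k by (subst (asm) integral_distr) auto
  qed
  have "(CLINT \<omega>|M. iexp (\<Sum>p\<in>P. t p * (\<Sum>k\<in>K. c p k * Y k \<omega>))) = complex_of_real (exp (- (\<Sum>p\<in>P. (t p)\<^sup>2) / 2))" for t
  proof -
    define a where "a k = (\<Sum>p\<in>P. t p * c p k)" for k
    have sum1: "(\<Sum>p\<in>P. t p * (\<Sum>k\<in>K. c p k * Y k \<omega>)) = (\<Sum>k\<in>K. a k * Y k \<omega>)" for \<omega>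
      unfolding a_def sum_distrib_left sum_distrib_right by (subst sum.swap) (simp add: mult.assoc)
    have sq: "(\<Sum>k\<in>K. (a k)\<^sup>2) = (\<Sum>p\<in>P. (t p)\<^sup>2)"
    proof -
      have "(\<Sum>k\<in>K. (a k)\<^sup>2) = (\<Sum>k\<in>K. \<Sum>p\<in>P. \<Sum>q\<in>P. t p * t q * (c p k * c q k))"
        by (simp add: a_def power2_eq_square sum_product mult_ac)
      also have "\<dots> = (\<Sum>p\<in>P. \<Sum>k\<in>K. \<Sum>q\<in>P. t p * t q * (c p k * c q k))" by (rule sum.swap)
      also have "\<dots> = (\<Sum>p\<in>P. \<Sum>q\<in>P. \<Sum>k\<in>K. t p * t q * (c p k * c q k))"
        by (intro sum.cong sum.swap refl)
      also have "\<dots> = (\<Sum>p\<in>P. \<Sum>q\<in>P. t p * t q * (\<Sum>k\<in>K. c p k * c q k))" by (simp add: sum_distrib_left)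
      also have "\<dots> = (\<Sum>p\<in>P. \<Sum>q\<in>P. if q = p then t p * t p else 0)"
        using on by (intro sum.cong refl) auto
      also have "\<dots> = (\<Sum>p\<in>P. (t p)\<^sup>2)" using P by (simp add: sum.delta power2_eq_square)
      finally show ?thesis .
    qed
    have "(CLINT \<omega>|M. iexp (\<Sum>k\<in>K. a k * Y k \<omega>)) = (CLINT \<omega>|M. (\<Prod>k\<in>K. iexp (a k * Y k \<omega>)))"
      by (simp add: sum_distrib_left exp_sum K)
    also have "\<dots> = (\<Prod>k\<in>K. CLINT \<omega>|M. iexp (a k * Y k \<omega>))"
    proof (rule indep_vars_lebesgue_integral[OF K])
      show "indep_vars (\<lambda>_. borel) (\<lambda>k \<omega>. iexp (a k * Y k \<omega>)) K"
        by (rule indep_vars_compose2[OF ind, of "\<lambda>k x. iexp (a k * x)"]) simp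
      show "integrable M (\<lambda>\<omega>. iexp (a k * Y k \<omega>))" if "k \<in> K" for k
        using that by (intro integrable_const_bound[where B=1]) auto
    qed
    also have "\<dots> = (\<Prod>k\<in>K. complex_of_real (exp (- (a k)\<^sup>2 / 2)))"
      by (intro prod.cong refl ch1)
    also have "\<dots> = complex_of_real (exp (- (\<Sum>k\<in>K. (a k)\<^sup>2) / 2))"
      by (simp add: exp_sum K sum_negf[symmetric] sum_divide_distrib flip: of_real_prod)
    finally show ?thesis by (simp add: sum1 sq)
  qed
  from gaussian_char_imp_indep[OF P m this]
  show "indep_vars (\<lambda>_. borel) (\<lambda>p \<omega>. \<Sum>k\<in>K. c p k * Y k \<omega>) P"
    "\<And>p. p \<in> P \<Longrightarrow> distributed M lborel (\<lambda>\<omega>. \<Sum>k\<in>K. c p k * Y k \<omega>) std_normal_density" by auto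
qed

end

section \<open>Nets of the unit ball, and the free entries of the noise\<close>

definition colv :: "nat \<Rightarrow> (nat \<Rightarrow> real) \<Rightarrow> fmat" where
  "colv N f = Abs_fmat (\<lambda>i j. if i < N \<and> j = 0 then f i else 0)"

lemma ent_colv [simp]: "ent (colv N f) i j = (if i < N \<and> j = 0 then f i else 0)"
  unfolding colv_def by (subst ent_Abs[of "max 1 N"]) auto

lemma supp_le_col: "is_col x \<Longrightarrow> idm N * x = x \<Longrightarrow> supp_le N x"
  by (cases "N = 0") (auto simp: supp_le_def col_ent idm_times_iff)

lemma ip_col: "is_col x \<Longrightarrow> idm N * x = x \<Longrightarrow> ip x y = (\<Sum>i<N. ent x i 0 * ent y i 0)"
  by (rule col_ip) (auto intro: supp_le_col)

lemma colv_props: "is_col (colv N f)" "idm N * colv N f = colv N f"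
  by (auto simp: col_ent idm_times_iff)

text \<open>
  Integer points of the ball of radius \<open>4 sqrt N\<close>. Scaled down to the unit ball they form a net of mesh \<open>1/4\<close>,
  since rounding a coordinate towards 0 costs at most 1 before scaling. This needs no volume argument.
\<close>

definition lattice_points :: "nat \<Rightarrow> (nat \<Rightarrow> int) set" where
  "lattice_points N = {z \<in> {..<N} \<rightarrow>\<^sub>E {- int (4 * N)..int (4 * N)}. (\<Sum>i<N. (z i)\<^sup>2) \<le> 16 * int N}"

definition net :: "nat \<Rightarrow> fmat set" where
  "net N = (\<lambda>z. colv N (\<lambda>i. of_int (z i) / (4 * sqrt N))) ` lattice_points N"

lemma sum_half_powers: "(\<Sum>z\<in>{- int B..int B}. (1/2::real) ^ nat \<bar>z\<bar>) = 3 - 2 * (1/2) ^ B"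
proof (induction B)
  case (Suc B)
  have "{- int (Suc B)..int (Suc B)} = insert (- int (Suc B)) (insert (int (Suc B)) {- int B..int B})"
    by auto
  then show ?case using Suc by (simp add: nat_add_distrib)
qed simp

lemma finite_lattice_points: "finite (lattice_points N)"
  unfolding lattice_points_def by (rule finite_subset[of _ "{..<N} \<rightarrow>\<^sub>E {- int (4 * N)..int (4 * N)}"])
    (auto intro!: finite_PiE)

lemma finite_net: "finite (net N)" by (simp add: net_def finite_lattice_points)

text \<open>
  On the lattice points the weight \<open>exp (16 N - |z|\<^sup>2)\<close> is at least 1, and its sum over the whole box is a
  product of one-dimensional sums, each at most \<open>3\<close>.
\<close>

lemma card_net: "real (card (net N)) \<le> exp (18 * real N)"
proof -
  let ?I = "{- int (4 * N)..int (4 * N)}"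
  let ?P = "{..<N} \<rightarrow>\<^sub>E ?I"
  have fin: "finite ?P" by (intro finite_PiE) auto
  have one: "(\<Sum>z\<in>?I. exp (- real_of_int (z\<^sup>2))) \<le> 3"
  proof -
    have "exp (- real_of_int (z\<^sup>2)) \<le> (1/2) ^ nat \<bar>z\<bar>" for z :: int
    proof -
      have e: "(2::real) \<le> exp 1" using exp_ge_add_one_self[of 1] by simp
      have "\<bar>z\<bar> \<le> z\<^sup>2"
      proof (cases "z = 0")
        case False
        then show ?thesis using mult_left_mono[of 1 "\<bar>z\<bar>" "\<bar>z\<bar>"] by (simp add: power2_eq_square)
      qed simp
      then have "real_of_int \<bar>z\<bar> \<le> real_of_int (z\<^sup>2)" by (simp only: of_int_le_iff)
      then have "real (nat \<bar>z\<bar>) \<le> real_of_int (z\<^sup>2)" by simp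
      then have "exp (- real_of_int (z\<^sup>2)) \<le> exp (- real (nat \<bar>z\<bar>))" by simp
      also have "\<dots> = (exp (-1)) ^ nat \<bar>z\<bar>" by (simp flip: exp_of_nat_mult)
      also have "\<dots> \<le> (1/2) ^ nat \<bar>z\<bar>"
        using e by (intro power_mono) (auto simp: exp_minus field_simps)
      finally show ?thesis .
    qed
    then have "(\<Sum>z\<in>?I. exp (- real_of_int (z\<^sup>2))) \<le> (\<Sum>z\<in>?I. (1/2) ^ nat \<bar>z\<bar>)" by (rule sum_mono)
    also have "\<dots> \<le> 3" unfolding sum_half_powers by simp
    finally show ?thesis .
  qed
  have "real (card (net N)) \<le> real (card (lattice_points N))"
    unfolding net_def using card_image_le[OF finite_lattice_points] by simp
  also have "\<dots> = (\<Sum>z\<in>lattice_points N. 1)" by simp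
  also have "\<dots> \<le> (\<Sum>z\<in>lattice_points N. exp (16 * real N - (\<Sum>i<N. real_of_int ((z i)\<^sup>2))))"
  proof (intro sum_mono)
    fix z assume "z \<in> lattice_points N"
    then have "real_of_int (\<Sum>i<N. (z i)\<^sup>2) \<le> real_of_int (16 * int N)"
      by (subst of_int_le_iff) (simp add: lattice_points_def)
    then show "1 \<le> exp (16 * real N - (\<Sum>i<N. real_of_int ((z i)\<^sup>2)))" by simp
  qed
  also have "\<dots> \<le> (\<Sum>z\<in>?P. exp (16 * real N - (\<Sum>i<N. real_of_int ((z i)\<^sup>2))))"
    using fin by (intro sum_mono2) (auto simp: lattice_points_def)
  also have "\<dots> = exp (16 * real N) * (\<Sum>z\<in>?P. \<Prod>i<N. exp (- real_of_int ((z i)\<^sup>2)))"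
    by (simp add: exp_diff exp_minus sum_distrib_left exp_sum field_simps prod_inversef prod_dividef sum_negf[symmetric] flip: exp_sum)
  also have "(\<Sum>z\<in>?P. \<Prod>i<N. exp (- real_of_int ((z i)\<^sup>2))) = (\<Prod>i<N. \<Sum>z\<in>?I. exp (- real_of_int (z\<^sup>2)))"
    by (rule prod_sum_PiE[symmetric]) auto
  also have "\<dots> \<le> (\<Prod>i<N. 3)" using one by (intro prod_mono) (auto intro!: sum_nonneg)
  also have "exp (16 * real N) * \<dots> \<le> exp (16 * real N) * exp (2 * real N)"
  proof -
    have "(3::real) \<le> exp 2" using exp_ge_add_one_self[of 2] by simp
    then have "(3::real) ^ N \<le> exp 2 ^ N" by (intro power_mono) auto
    also have "\<dots> = exp (2 * real N)" by (simp add: mult.commute flip: exp_of_nat_mult)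
    finally show ?thesis by simp
  qed
  also have "\<dots> = exp (18 * real N)" by (simp add: mult_exp_exp)
  finally show ?thesis by simp
qed

lemma net_props:
  assumes "y \<in> net N" shows "is_col y" "idm N * y = y" "fr y \<le> 1"
proof -
  obtain z where z: "z \<in> lattice_points N" "y = colv N (\<lambda>i. of_int (z i) / (4 * sqrt N))"
    using assms by (auto simp: net_def)
  show c: "is_col y" "idm N * y = y" using colv_props by (auto simp: z(2))
  have "ip y y = (\<Sum>i<N. (of_int (z i) / (4 * sqrt N))\<^sup>2)"
    unfolding ip_col[OF c, of y] by (simp add: z(2) power2_eq_square)
  also have "\<dots> = real_of_int (\<Sum>i<N. (z i)\<^sup>2) / (16 * real N)"
    by (simp add: power_divide power_mult_distrib sum_divide_distrib)
  also have "\<dots> \<le> 1"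
  proof (cases "N = 0")
    case False
    have "real_of_int (\<Sum>i<N. (z i)\<^sup>2) \<le> real_of_int (16 * int N)"
      using z(1) by (subst of_int_le_iff) (simp add: lattice_points_def)
    then show ?thesis using False by (simp add: divide_le_eq)
  qed simp
  finally show "fr y \<le> 1" by (simp add: fr_def)
qed

lemma net_approx:
  assumes N: "0 < N" and x: "is_col x" "idm N * x = x" "fr x \<le> 1"
  shows "\<exists>y\<in>net N. fr (x - y) \<le> 1/4"
proof -
  define s where "s = 4 * sqrt N"
  have s: "0 < s" "s\<^sup>2 = 16 * N" using N by (auto simp: s_def power_mult_distrib)
  define tr where "tr t = (if t \<ge> 0 then \<lfloor>t\<rfloor> else \<lceil>t\<rceil>)" for t :: real
  have tr1: "\<bar>of_int (tr t)\<bar> \<le> \<bar>t\<bar>" for t :: real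
  proof (cases "0 \<le> t")
    case False
    then have "\<lceil>t\<rceil> \<le> 0" by simp
    then have "real_of_int \<lceil>t\<rceil> \<le> 0" by (simp only: of_int_le_0_iff)
    then show ?thesis using False le_of_int_ceiling[of t] by (simp add: tr_def)
  qed (simp add: tr_def)
  have tr2: "\<bar>t - of_int (tr t)\<bar> \<le> 1" for t :: real
    using floor_correct[of t] ceiling_correct[of t] unfolding tr_def abs_le_iff by (simp split: if_split) linarith
  define z where "z = restrict (\<lambda>i. tr (s * ent x i 0)) {..<N}"
  have ipx: "(\<Sum>i<N. (ent x i 0)\<^sup>2) \<le> 1"
    using x(3) ip_col[OF x(1,2), of x] by (simp add: fr_def power2_eq_square)
  have "real_of_int (\<Sum>i<N. (z i)\<^sup>2) = (\<Sum>i<N. (of_int (z i))\<^sup>2)" by simp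
  also have "\<dots> \<le> (\<Sum>i<N. (s * ent x i 0)\<^sup>2)"
    using tr1 by (intro sum_mono) (simp add: z_def abs_le_square_iff[symmetric])
  also have "\<dots> = s\<^sup>2 * (\<Sum>i<N. (ent x i 0)\<^sup>2)" by (simp add: power_mult_distrib sum_distrib_left)
  also have "\<dots> \<le> s\<^sup>2 * 1" using ipx by (intro mult_left_mono) auto
  finally have "real_of_int (\<Sum>i<N. (z i)\<^sup>2) \<le> real_of_int (16 * int N)" using s by simp
  then have zsum: "(\<Sum>i<N. (z i)\<^sup>2) \<le> 16 * int N" by (simp only: of_int_le_iff)
  have zI: "z i \<in> {- int (4 * N)..int (4 * N)}" if i: "i < N" for i
  proof -
    have "(z i)\<^sup>2 \<le> (\<Sum>i<N. (z i)\<^sup>2)" using i by (intro member_le_sum) auto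
    also have "\<dots> \<le> 16 * int N" by (rule zsum)
    also have "\<dots> \<le> (int (4 * N))\<^sup>2" using N by (simp add: power2_eq_square)
    finally have "\<bar>z i\<bar> \<le> \<bar>int (4 * N)\<bar>" by (simp only: abs_le_square_iff)
    then show ?thesis by auto
  qed
  have zL: "z \<in> lattice_points N"
    using zI zsum by (auto simp: lattice_points_def z_def PiE_iff extensional_def)
  define y where "y = colv N (\<lambda>i. of_int (z i) / s)"
  have yn: "y \<in> net N" using zL by (auto simp: net_def y_def s_def)
  have xy: "is_col (x - y)" "idm N * (x - y) = x - y"
    using x colv_props by (auto simp: y_def col_diff right_diff_distrib)
  have "ip (x - y) (x - y) = (\<Sum>i<N. (ent x i 0 - of_int (z i) / s)\<^sup>2)"
    unfolding ip_col[OF xy, of "x - y"] by (simp add: y_def power2_eq_square)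
  also have "\<dots> \<le> (\<Sum>i<N. (1 / s)\<^sup>2)"
  proof (intro sum_mono)
    fix i assume i: "i \<in> {..<N}"
    have "\<bar>ent x i 0 - of_int (z i) / s\<bar> = \<bar>s * ent x i 0 - of_int (z i)\<bar> / s"
      using s by (simp add: field_simps)
    also have "\<dots> \<le> 1 / s" using i s tr2 by (intro divide_right_mono) (auto simp: z_def)
    finally show "(ent x i 0 - of_int (z i) / s)\<^sup>2 \<le> (1 / s)\<^sup>2"
      using s by (simp add: abs_le_square_iff[symmetric])
  qed
  also have "\<dots> = (1/4)\<^sup>2" using N s by (simp add: power_divide)
  finally have "fr (x - y) \<le> 1/4" unfolding fr_def by (metis real_sqrt_le_iff real_sqrt_abs abs_of_nonneg zero_le_divide_1_iff zero_le_numeral)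
  then show ?thesis using yn by blast
qed

text \<open>
  Moving both arguments of the bilinear form to net points changes it by at most half of the norm.
\<close>

lemma norm_le_net:
  assumes N: "0 < N" "0 < K" and A: "idm N * A = A" "A * idm K = A"
    and b: "\<And>x y. x \<in> net N \<Longrightarrow> y \<in> net K \<Longrightarrow> \<bar>ip x (A * y)\<bar> \<le> t"
  shows "norm A \<le> 2 * t"
proof -
  have bil: "\<bar>ip x (A * y)\<bar> \<le> t + norm A / 2"
    if x: "is_col x" "idm N * x = x" "fr x \<le> 1" and y: "is_col y" "idm K * y = y" "fr y \<le> 1" for x y
  proof -
    obtain x' where x': "x' \<in> net N" "fr (x - x') \<le> 1/4" using net_approx[OF N(1) x] by blast
    obtain y' where y': "y' \<in> net K" "fr (y - y') \<le> 1/4" using net_approx[OF N(2) y] by blast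
    have "\<bar>ip (x - x') (A * y)\<bar> \<le> norm A * (1/4) * 1"
      using x' y by (intro order_trans[OF abs_ip_le_norm] mult_mono) auto
    moreover have "\<bar>ip x' (A * (y - y'))\<bar> \<le> norm A * 1 * (1/4)"
      using x' y' net_props[of x' N] by (intro order_trans[OF abs_ip_le_norm] mult_mono) auto
    moreover have "ip x (A * y) = ip x' (A * y') + ip (x - x') (A * y) + ip x' (A * (y - y'))"
      by (simp add: ip_distribs right_diff_distrib)
    ultimately show ?thesis using b[OF x'(1) y'(1)] by linarith
  qed
  have t0: "0 \<le> t + norm A / 2"
    using bil[of 0 0] by (simp add: is_col_def)
  have "norm A \<le> t + norm A / 2"
  proof (rule norm_leI_col[OF t0])
    fix y assume y: "is_col y"
    define y' where "y' = idm K * y"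
    have Ay: "A * y = A * y'" by (simp add: y'_def A flip: mult.assoc)
    have fry: "fr y' \<le> fr y"
    proof -
      have "fr y' \<le> norm (idm K) * fr y" unfolding y'_def by (rule fr_times_le_norm)
      also have "\<dots> \<le> 1 * fr y" using norm_idm_le_1 by (intro mult_right_mono) auto
      finally show ?thesis by simp
    qed
    show "fr (A * y) \<le> (t + norm A / 2) * fr y"
    proof (cases "fr (A * y) = 0 \<or> fr y' = 0")
      case True
      then show ?thesis
      proof
        assume "fr y' = 0" then show ?thesis using t0 by (simp add: Ay)
      qed (use t0 in simp)
    next
      case False
      then have p: "0 < fr (A * y)" "0 < fr y'" by (simp_all add: less_le)
      define u where "u = (A * y) /\<^sub>R fr (A * y)"
      define v where "v = y' /\<^sub>R fr y'"
      have fuv: "fr u \<le> 1" "fr v \<le> 1" using p by (simp_all add: u_def v_def field_simps)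
      have "\<bar>ip u (A * v)\<bar> \<le> t + norm A / 2"
      proof (rule bil[OF _ _ fuv(1) _ _ fuv(2)])
        show "is_col u" "is_col v" by (simp_all add: u_def v_def y'_def col_scaleR col_times y)
        show "idm N * u = u" by (simp add: u_def A flip: mult.assoc)
        show "idm K * v = v" by (simp add: v_def y'_def flip: mult.assoc)
      qed
      moreover have "ip u (A * v) = fr (A * y) / fr y'"
        using p by (simp add: u_def v_def Ay[symmetric] fr_square[symmetric] power2_eq_square field_simps)
      ultimately have "fr (A * y) \<le> (t + norm A / 2) * fr y'" using p by (simp add: field_simps)
      also have "\<dots> \<le> (t + norm A / 2) * fr y" using fry t0 by (intro mult_left_mono)
      finally show ?thesis .
    qed
  qed
  then show ?thesis by simp
qed

text \<open>
  Positions above the block diagonal, where the entries of the noise are free, and the strictly upper and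
  symmetric matrices with given entries there.
\<close>

definition upper :: "nat \<Rightarrow> nat \<Rightarrow> (nat \<times> nat) set" where
  "upper n d = {(r, c). r < n * d \<and> c < n * d \<and> r div d < c div d}"

lemma finite_upper: "finite (upper n d)"
  by (rule finite_subset[of _ "{..<n*d} \<times> {..<n*d}"]) (auto simp: upper_def)

definition utri :: "nat \<Rightarrow> nat \<Rightarrow> (nat \<times> nat \<Rightarrow> real) \<Rightarrow> fmat" where
  "utri n d y = Abs_fmat (\<lambda>r c. if (r, c) \<in> upper n d then y (r, c) else 0)"

lemma ent_utri [simp]: "ent (utri n d y) r c = (if (r, c) \<in> upper n d then y (r, c) else 0)"
  unfolding utri_def by (subst ent_Abs[of "n * d"]) (auto simp: upper_def)

lemma supp_le_utri: "supp_le (n * d) (utri n d y)" by (auto simp: supp_le_def upper_def)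

definition wmat :: "nat \<Rightarrow> nat \<Rightarrow> (nat \<times> nat \<Rightarrow> real) \<Rightarrow> fmat" where
  "wmat n d y = utri n d y + tp (utri n d y)"

text \<open>
  The coefficients of the bilinear form of the symmetric matrix in its free entries.
\<close>

definition coef :: "fmat \<Rightarrow> fmat \<Rightarrow> nat \<times> nat \<Rightarrow> real" where
  "coef x v = (\<lambda>(r, c). ent x r 0 * ent v c 0 + ent v r 0 * ent x c 0)"

lemma ip_utri:
  assumes x: "is_col x" and v: "is_col v"
  shows "ip x (utri n d y * v) = (\<Sum>(r, c)\<in>upper n d. ent x r 0 * ent v c 0 * y (r, c))"
proof -
  define N where "N = n * d"
  have "ip x (utri n d y * v) = ip (utri n d y * v) x" by (rule ip_commute)
  also have "\<dots> = (\<Sum>r<N. ent (utri n d y * v) r 0 * ent x r 0)"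
  proof (rule ip_col)
    show "is_col (utri n d y * v)" by (rule col_times[OF v])
    have "idm N * utri n d y = utri n d y" by (auto simp: idm_times_iff upper_def N_def)
    then show "idm N * (utri n d y * v) = utri n d y * v" by (simp flip: mult.assoc)
  qed
  also have "\<dots> = (\<Sum>r<N. \<Sum>c<N. ent x r 0 * ent v c 0 * ent (utri n d y) r c)"
    unfolding N_def
    by (simp add: ent_times[of "n * d", OF disjI1[OF supp_le_utri]] sum_distrib_right sum_distrib_left mult_ac del: ent_utri)
  also have "\<dots> = (\<Sum>(r, c)\<in>{..<N} \<times> {..<N}. ent x r 0 * ent v c 0 * ent (utri n d y) r c)"
    by (simp add: sum.cartesian_product)
  also have "\<dots> = (\<Sum>(r, c)\<in>upper n d. ent x r 0 * ent v c 0 * y (r, c))"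
    by (intro sum.mono_neutral_cong_right) (auto simp: upper_def N_def split: if_splits)
  finally show ?thesis .
qed

lemma ip_wmat:
  assumes x: "is_col x" and v: "is_col v"
  shows "ip x (wmat n d y * v) = (\<Sum>k\<in>upper n d. coef x v k * y k)"
proof -
  have "ip x (wmat n d y * v) = ip x (utri n d y * v) + ip v (utri n d y * x)"
    by (simp add: wmat_def distrib_right ip_distribs) (metis ip_commute ip_times_left)
  also have "\<dots> = (\<Sum>k\<in>upper n d. coef x v k * y k)"
    unfolding ip_utri[OF x v] ip_utri[OF v x] sum.distrib[symmetric]
    by (intro sum.cong) (auto simp: coef_def distrib_right)
  finally show ?thesis .
qed

definition touching :: "nat \<Rightarrow> nat \<Rightarrow> nat \<Rightarrow> (nat \<times> nat) set" where
  "touching n d i = {(r, c) \<in> upper n d. r div d = i \<or> c div d = i}"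

lemma touching_subset: "touching n d i \<subseteq> upper n d" by (auto simp: touching_def)

lemma coef_not_touching:
  assumes "\<And>r. r div d \<noteq> i \<Longrightarrow> ent x r 0 = 0" "k \<in> upper n d - touching n d i"
  shows "coef x v k = 0"
proof -
  obtain r c where k: "k = (r, c)" "r div d \<noteq> i" "c div d \<noteq> i"
    using assms(2) by (auto simp: touching_def)
  then show ?thesis using assms(1)[OF k(2)] assms(1)[OF k(3)] by (simp add: coef_def)
qed

text \<open>
  A free entry touches block \<open>i\<close> with at most one of its two indices, as the diagonal blocks vanish. So the
  two summands of a coefficient never both contribute, and the sum over positions above the diagonal becomes
  a full product sum.
\<close>

lemma sum_coef_products:
  assumes i: "i < n" and d: "0 < d" and x: "\<And>r. r div d \<noteq> i \<Longrightarrow> ent x r 0 = 0" "\<And>r. r div d \<noteq> i \<Longrightarrow> ent x' r 0 = 0"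
  shows "(\<Sum>k\<in>upper n d. coef x v k * coef x' v' k)
     = (\<Sum>r<n*d. ent x r 0 * ent x' r 0) * (\<Sum>c | c < n * d \<and> c div d \<noteq> i. ent v c 0 * ent v' c 0)"
proof -
  define f where "f = (\<lambda>(r, c). ent x r 0 * ent x' r 0 * (ent v c 0 * ent v' c 0))"
  let ?L = "{(r, c). r < n * d \<and> c < n * d \<and> c div d < r div d}"
  let ?N = "{..<n*d}"
  have finL: "finite ?L" by (rule finite_subset[of _ "?N \<times> ?N"]) auto
  have "coef x v k * coef x' v' k = f k + f (prod.swap k)" if k: "k \<in> upper n d" for k
  proof -
    obtain r c where k': "k = (r, c)" "r div d < c div d" using k by (auto simp: upper_def)
    then have cross: "ent x r 0 * ent x' c 0 = 0" "ent x c 0 * ent x' r 0 = 0"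
      using k'(2) x by (metis less_irrefl mult_eq_0_iff)+
    have "coef x v k * coef x' v' k = f k + f (prod.swap k)
        + (ent x r 0 * ent x' c 0) * (ent v c 0 * ent v' r 0) + (ent x c 0 * ent x' r 0) * (ent v r 0 * ent v' c 0)"
      by (simp add: coef_def f_def k'(1) algebra_simps)
    then show ?thesis by (simp only: cross mult_zero_left add_0_right)
  qed
  then have "(\<Sum>k\<in>upper n d. coef x v k * coef x' v' k) = (\<Sum>k\<in>upper n d. f k) + (\<Sum>k\<in>upper n d. f (prod.swap k))"
    by (simp add: sum.distrib)
  also have "(\<Sum>k\<in>upper n d. f (prod.swap k)) = (\<Sum>k\<in>?L. f k)"
    by (rule sum.reindex_bij_witness[of _ prod.swap prod.swap]) (auto simp: upper_def)
  also have "(\<Sum>k\<in>upper n d. f k) + (\<Sum>k\<in>?L. f k) = (\<Sum>k\<in>upper n d \<union> ?L. f k)"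
    by (rule sum.union_disjoint[symmetric]) (auto simp: finite_upper finL, auto simp: upper_def)
  also have "\<dots> = (\<Sum>k\<in>?N \<times> {c. c < n * d \<and> c div d \<noteq> i}. f k)"
  proof (rule sum.mono_neutral_cong)
    show "f k = 0" if "k \<in> ?N \<times> {c. c < n * d \<and> c div d \<noteq> i} - (upper n d \<union> ?L)" for k
    proof -
      obtain r c where k: "k = (r, c)" by (cases k)
      have "\<not> r div d < c div d" "\<not> c div d < r div d" "c div d \<noteq> i"
        using that by (auto simp: upper_def k)
      then have "r div d \<noteq> i" by linarith
      then show ?thesis using x(1)[of r] by (simp add: f_def k)
    qed
    show "f k = 0" if "k \<in> (upper n d \<union> ?L) - ?N \<times> {c. c < n * d \<and> c div d \<noteq> i}" for k
    proof -
      obtain r c where k: "k = (r, c)" by (cases k)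
      have "r div d \<noteq> c div d" "c div d = i" using that by (auto simp: upper_def k)
      then have "r div d \<noteq> i" by simp
      then show ?thesis using x(1)[of r] by (simp add: f_def k)
    qed
  qed (auto simp: finite_upper finL)
  also have "\<dots> = (\<Sum>r<n*d. ent x r 0 * ent x' r 0) * (\<Sum>c | c < n * d \<and> c div d \<noteq> i. ent v c 0 * ent v' c 0)"
    by (simp add: sum_product f_def sum.cartesian_product split_def)
  finally show ?thesis .
qed

lemma ent_proj_times: assumes d: "0 < d"
  shows "ent (sel d i * tp (sel d i) * A) r c = (if r div d = i then ent A r c else 0)"
proof -
  obtain N where N: "supp_le N A" by (rule supp_le_obtain[of A A A])
  have "ent (sel d i * tp (sel d i) * A) r c = (\<Sum>k<N. ent (sel d i * tp (sel d i)) r k * ent A k c)"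
    using N by (simp add: ent_times[of N])
  also have "\<dots> = (\<Sum>k<N. if k = r then (if r div d = i then ent A r c else 0) else 0)"
    by (intro sum.cong) (auto simp: ent_proj[OF d])
  also have "\<dots> = (if r div d = i then ent A r c else 0)" using N by (auto simp: supp_le_def)
  finally show ?thesis .
qed

lemma ent_times_proj: assumes d: "0 < d"
  shows "ent (A * (sel d i * tp (sel d i))) r c = (if c div d = i then ent A r c else 0)"
proof -
  have "ent (A * (sel d i * tp (sel d i))) r c = ent (tp (A * (sel d i * tp (sel d i)))) c r"
    by (simp only: ent_tp)
  also have "tp (A * (sel d i * tp (sel d i))) = sel d i * tp (sel d i) * tp A" by (simp add: mult.assoc)
  finally show ?thesis by (simp only: ent_proj_times[OF d] ent_tp)
qed

text \<open>
  Deleting a block row and column in terms of the free entries.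
\<close>

definition mask :: "nat \<Rightarrow> nat \<Rightarrow> (nat \<times> nat \<Rightarrow> real) \<Rightarrow> nat \<times> nat \<Rightarrow> real" where
  "mask d i y = (\<lambda>(r, c). if r div d = i \<or> c div d = i then 0 else y (r, c))"

lemma ent_wmat: "ent (wmat n d y) r c = (if (r, c) \<in> upper n d then y (r, c) else if (c, r) \<in> upper n d then y (c, r) else 0)"
  by (auto simp: wmat_def upper_def)

lemma loo_wmat: assumes d: "0 < d" shows "loo d i (wmat n d y) = wmat n d (mask d i y)"
proof (rule fmat_eqI)
  fix r c
  show "ent (loo d i (wmat n d y)) r c = ent (wmat n d (mask d i y)) r c"
    unfolding loo_def Let_def
    by (simp add: ent_proj_times[OF d] ent_times_proj[OF d] ent_wmat mask_def)
qed

lemma wmat_props: "tp (wmat n d y) = wmat n d y" "idm (n * d) * wmat n d y = wmat n d y"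
  by (simp_all add: wmat_def add.commute) (auto simp: idm_times_iff upper_def)

lemma wmat_diag: assumes "i < n" shows "blk d i (wmat n d y) * sel d i = 0"
  by (rule fmat_eqI) (auto simp: upper_def ent_wmat)

text \<open>
  The uniform bound on the support turns entries of products into sums over a fixed index set.
\<close>

definition fmeas :: "'x measure \<Rightarrow> ('x \<Rightarrow> fmat) \<Rightarrow> bool" where
  "fmeas X f \<longleftrightarrow> (\<forall>r c. (\<lambda>x. ent (f x) r c) \<in> borel_measurable X) \<and> (\<exists>N. \<forall>x. supp_le N (f x))"

lemma fmeas_const: "fmeas X (\<lambda>_. A)"
  using supp_le_bd by (auto simp: fmeas_def)

lemma fmeas_ops:
  assumes "fmeas X f" "fmeas X g"
  shows "fmeas X (\<lambda>x. f x + g x)" "fmeas X (\<lambda>x. f x - g x)" "fmeas X (\<lambda>x. f x * g x)"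
    "fmeas X (\<lambda>x. a *\<^sub>R f x)" "fmeas X (\<lambda>x. tp (f x))"
proof -
  obtain N1 N2 where N12: "\<And>x. supp_le N1 (f x)" "\<And>x. supp_le N2 (g x)" using assms by (auto simp: fmeas_def)
  define N where "N = max N1 N2"
  have N: "supp_le N (f x)" "supp_le N (g x)" for x
    using supp_le_mono[OF N12(1)] supp_le_mono[OF N12(2)] by (auto simp: N_def)
  have m: "(\<lambda>x. ent (f x) r c) \<in> borel_measurable X" "(\<lambda>x. ent (g x) r c) \<in> borel_measurable X" for r c
    using assms by (auto simp: fmeas_def)
  show "fmeas X (\<lambda>x. f x + g x)" "fmeas X (\<lambda>x. f x - g x)" "fmeas X (\<lambda>x. a *\<^sub>R f x)" "fmeas X (\<lambda>x. tp (f x))"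
    using m N by (auto simp: fmeas_def supp_le_def intro!: exI[of _ N])
  show "fmeas X (\<lambda>x. f x * g x)"
    unfolding fmeas_def
  proof (intro conjI allI exI[of _ N])
    show "supp_le N (f x * g x)" for x by (rule supp_le_times[OF N])
    show "(\<lambda>x. ent (f x * g x) r c) \<in> borel_measurable X" for r c
      unfolding ent_times[OF disjI1[OF N(1)]] using m by measurable
  qed
qed

lemmas fmeas_scaleR = fmeas_ops(4)[OF _ fmeas_const]

lemma fmeas_gmap_iterate:
  assumes "fmeas X w" shows "fmeas X (\<lambda>x. (gmap n \<sigma> Z (w x) ^^ k) Z)"
proof (induction k)
  case 0 then show ?case by (simp add: fmeas_const)
next
  case (Suc k)
  have "fmeas X (\<lambda>x. gmap n \<sigma> Z (w x) (V x))" if "fmeas X V" for V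
    unfolding gmap_def by (intro fmeas_ops(1,2,3) fmeas_scaleR fmeas_const assms that)
  from this[OF Suc] have "fmeas X (\<lambda>x. gmap n \<sigma> Z (w x) ((gmap n \<sigma> Z (w x) ^^ k) Z))" .
  then show ?case by simp
qed

section \<open>High-probability events for the noise\<close>

lemma gmap_iterate_dims:
  assumes "Z * idm d = Z" "idm N * Z = Z" "idm N * W = W"
  shows "(gmap n \<sigma> Z W ^^ k) Z * idm d = (gmap n \<sigma> Z W ^^ k) Z"
    "idm N * (gmap n \<sigma> Z W ^^ k) Z = (gmap n \<sigma> Z W ^^ k) Z"
proof -
  have 1: "gmap n \<sigma> Z W V * idm d = gmap n \<sigma> Z W V" if "V * idm d = V" for V
    using assms that by (simp add: gmap_def distrib_right left_diff_distrib mult.assoc)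
  have 2: "idm N * gmap n \<sigma> Z W V = gmap n \<sigma> Z W V" if "idm N * V = V" for V
    using assms that by (simp add: gmap_def distrib_left right_diff_distrib flip: mult.assoc)
  show "(gmap n \<sigma> Z W ^^ k) Z * idm d = (gmap n \<sigma> Z W ^^ k) Z" by (induction k) (simp_all add: 1 assms)
  show "idm N * (gmap n \<sigma> Z W ^^ k) Z = (gmap n \<sigma> Z W ^^ k) Z" by (induction k) (simp_all add: 2 assms)
qed

lemma sum_off_block:
  assumes d: "0 < d" and v: "is_col v" "idm (n * d) * v = v"
  shows "(\<Sum>c | c < n * d \<and> c div d \<noteq> i. ent v c 0 * ent v' c 0) = ip v v' - ip (blk d i v) (blk d i v')"
proof -
  define p where "p = sel d i * tp (sel d i)"
  have "ip v v' - ip (blk d i v) (blk d i v') = ip v (v' - p * v')"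
    by (simp add: ip_distribs blk_def p_def ip_times_left mult.assoc)
  also have "\<dots> = (\<Sum>c<n*d. ent v c 0 * ent (v' - p * v') c 0)" by (rule ip_col[OF v])
  also have "\<dots> = (\<Sum>c | c < n * d \<and> c div d \<noteq> i. ent v c 0 * ent v' c 0)"
    by (rule sum.mono_neutral_cong_right) (auto simp: p_def ent_proj_times[OF d])
  finally show ?thesis by simp
qed

lemma ent_sel_times_off: assumes d: "0 < d" and r: "r div d \<noteq> i" shows "ent (sel d i * x) r c = 0"
proof -
  have "sel d i * x = sel d i * tp (sel d i) * (sel d i * x)"
  proof -
    have "sel d i * tp (sel d i) * (sel d i * x) = sel d i * (tp (sel d i) * sel d i) * x" by (simp add: mult.assoc)
    then show ?thesis by (simp add: sel_sel sel_dims)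
  qed
  then have "ent (sel d i * x) r c = ent (sel d i * tp (sel d i) * (sel d i * x)) r c" by simp
  also have "\<dots> = 0" using r by (simp only: ent_proj_times[OF d] if_False)
  finally show ?thesis .
qed

text \<open>
  For a vector supported in block \<open>i\<close>, the forms of the block row have covariances given by inner products.
  This yields both variance bounds and the orthonormality needed for \<open>G\<close>.
\<close>

lemma sum_coef_ip:
  assumes i: "i < n" and d: "0 < d" and x: "is_col x" "idm d * x = x" "is_col x'"
    and v: "is_col v" "idm (n * d) * v = v"
  shows "(\<Sum>k\<in>upper n d. coef (sel d i * x) v k * coef (sel d i * x') v' k)
    = ip x x' * (ip v v' - ip (blk d i v) (blk d i v'))"
proof -
  have "(\<Sum>r<n*d. ent (sel d i * x) r 0 * ent (sel d i * x') r 0) = ip (sel d i * x) (sel d i * x')"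
    by (rule ip_col[symmetric]) (use i in \<open>simp_all add: col_times x sel_dims flip: mult.assoc\<close>)
  also have "\<dots> = ip x (idm d * x')" by (simp add: ip_times_left sel_sel flip: mult.assoc)
  also have "\<dots> = ip x x'" using x(2) by (metis ip_times_left tp_idm)
  finally have "(\<Sum>r<n*d. ent (sel d i * x) r 0 * ent (sel d i * x') r 0) = ip x x'" .
  then show ?thesis
    using sum_coef_products[OF i d, of "sel d i * x" "sel d i * x'" v v'] ent_sel_times_off[OF d]
    by (simp add: sum_off_block[OF d v])
qed

locale block_noise = prob_space M for M :: "'w measure" +
  fixes n d :: nat and W :: "'w \<Rightarrow> real mat"
  assumes noise: "noise_matrix M n d W" and n: "0 < n" and d: "0 < d"
begin

definition Y :: "nat \<times> nat \<Rightarrow> 'w \<Rightarrow> real" where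
  "Y k \<omega> = block d (W \<omega>) (fst k div d) (snd k div d) $$ (fst k mod d, snd k mod d)"

lemma div_less: "r < n * d \<Longrightarrow> r div d < n"
  using d by (simp add: div_less_iff_less_mult)

lemma Y_indep: "indep_vars (\<lambda>_. borel) Y (upper n d)"
proof -
  let ?I = "{(i, j, a, b). i < j \<and> j < n \<and> a < d \<and> b < d}"
  let ?X = "\<lambda>(i, j, a, b) \<omega>. block d (W \<omega>) i j $$ (a, b)"
  define f where "f k = (fst k div d, snd k div d, fst k mod d, snd k mod d)" for k :: "nat \<times> nat"
  have ind: "indep_vars (\<lambda>_. borel) ?X ?I" using noise by (simp add: noise_matrix_def)
  have "inj_on f (upper n d)"
  proof (rule inj_onI)
    fix k l assume "f k = f l"
    then have "fst k = fst l" "snd k = snd l"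
      unfolding f_def prod.inject by (metis div_mult_mod_eq)+
    then show "k = l" by (simp add: prod_eq_iff)
  qed
  moreover have "f ` upper n d \<subseteq> ?I" using d by (auto simp: f_def upper_def div_less)
  ultimately have "indep_vars (\<lambda>_. borel) (\<lambda>k. ?X (f k)) (upper n d)" by (rule indep_vars_reindex_inj[OF ind])
  moreover have "(\<lambda>k. ?X (f k)) = Y" by (simp add: fun_eq_iff f_def Y_def)
  ultimately show ?thesis by simp
qed

lemma Y_normal: assumes "k \<in> upper n d" shows "distributed M lborel (Y k) std_normal_density"
proof -
  have "fst k div d < snd k div d" "snd k div d < n" "fst k mod d < d" "snd k mod d < d"
    using assms d by (auto simp: upper_def div_less)
  then show ?thesis using noise unfolding noise_matrix_def Y_def[abs_def] by blast
qed

lemma Y_measurable: "k \<in> upper n d \<Longrightarrow> Y k \<in> borel_measurable M"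
  using distributed_measurable[OF Y_normal] by simp

lemma of_mat_W: assumes \<omega>: "\<omega> \<in> space M" shows "of_mat (W \<omega>) = wmat n d (\<lambda>k. Y k \<omega>)"
proof (rule fmat_eqI)
  fix r c
  have carr: "W \<omega> \<in> carrier_mat (n * d) (n * d)"
    and diag: "\<And>i. i < n \<Longrightarrow> block d (W \<omega>) i i = 0\<^sub>m d d"
    and sym: "\<And>i j. i < n \<Longrightarrow> j < n \<Longrightarrow> (block d (W \<omega>) i j)\<^sup>T = block d (W \<omega>) j i"
    using noise \<omega> by (auto simp: noise_matrix_def)
  show "ent (of_mat (W \<omega>)) r c = ent (wmat n d (\<lambda>k. Y k \<omega>)) r c"
  proof (cases "r < n * d \<and> c < n * d")
    case False
    then show ?thesis using carr by (auto simp: ent_wmat upper_def)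
  next
    case rc: True
    define i j a b where "i = r div d" and "j = c div d" and "a = r mod d" and "b = c mod d"
    have ij: "i < n" "j < n" "a < d" "b < d" using rc d by (auto simp: i_def j_def a_def b_def div_less)
    have Wrc: "W \<omega> $$ (r, c) = block d (W \<omega>) i j $$ (a, b)"
      using ij by (simp add: block_def i_def j_def a_def b_def)
    have Wcr: "block d (W \<omega>) i j $$ (a, b) = block d (W \<omega>) j i $$ (b, a)"
      using arg_cong[OF sym[OF ij(1,2)], of "\<lambda>A. A $$ (b, a)"] ij by (simp add: block_def)
    have Wii: "block d (W \<omega>) i j $$ (a, b) = 0" if "i = j"
      using arg_cong[OF diag[OF ij(1)], of "\<lambda>A. A $$ (a, b)"] that ij by simp
    show ?thesis
      using rc carr Wrc Wcr Wii
      by (auto simp: ent_wmat upper_def Y_def i_def j_def a_def b_def simp del: index_transpose_mat)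
  qed
qed

lemma union_bound:
  fixes b :: real
  assumes "finite F" "\<And>p. p \<in> F \<Longrightarrow> B p \<in> sets M" "\<And>p. p \<in> F \<Longrightarrow> prob (B p) \<le> b"
  shows "prob (\<Union>p\<in>F. B p) \<le> card F * b"
proof -
  have "prob (\<Union>p\<in>F. B p) \<le> (\<Sum>p\<in>F. prob (B p))"
    using assms by (intro finite_measure_subadditive_finite) auto
  also have "\<dots> \<le> (\<Sum>p\<in>F. b)" using assms by (intro sum_mono)
  finally show ?thesis by simp
qed

lemma net_union_bound:
  assumes "\<And>x y. x \<in> net N \<Longrightarrow> y \<in> net N \<Longrightarrow> B x y \<in> sets M"
    and "\<And>x y. x \<in> net N \<Longrightarrow> y \<in> net N \<Longrightarrow> prob (B x y) \<le> 2 * exp (- u)"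
  shows "(\<Union>p\<in>net N \<times> net N. B (fst p) (snd p)) \<in> sets M"
    "prob (\<Union>p\<in>net N \<times> net N. B (fst p) (snd p)) \<le> 2 * exp (36 * real N - u)"
proof -
  have F: "finite (net N \<times> net N)" by (simp add: finite_net)
  show "(\<Union>p\<in>net N \<times> net N. B (fst p) (snd p)) \<in> sets M"
    using assms(1) F by (intro sets.finite_UN) auto
  have "prob (\<Union>p\<in>net N \<times> net N. B (fst p) (snd p)) \<le> card (net N \<times> net N) * (2 * exp (- u))"
    using assms F by (intro union_bound) auto
  also have "\<dots> = (real (card (net N)) * real (card (net N))) * (2 * exp (- u))"
    by (simp add: card_cartesian_product)
  also have "\<dots> \<le> (exp (18 * real N) * exp (18 * real N)) * (2 * exp (- u))"
    using card_net by (intro mult_right_mono mult_mono) auto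
  also have "\<dots> = 2 * exp (36 * real N - u)" by (simp add: mult_exp_exp)
  finally show "prob (\<Union>p\<in>net N \<times> net N. B (fst p) (snd p)) \<le> 2 * exp (36 * real N - u)" .
qed

text \<open>
  The strictly upper part has independent entries, and the noise is the sum of it and its transpose.
\<close>

lemma operator_norm_event:
  assumes t: "0 < t"
  shows "\<exists>B\<in>sets M. prob B \<le> 2 * exp (36 * real (n * d) - t\<^sup>2 / 2) \<and>
    (\<forall>\<omega>\<in>space M - B. norm (of_mat (W \<omega>)) \<le> 4 * t)"
proof -
  define B where "B x y = {\<omega>\<in>space M. t < \<bar>\<Sum>k\<in>upper n d. (ent x (fst k) 0 * ent y (snd k) 0) * Y k \<omega>\<bar>}" for x y
  have mB: "B x y \<in> sets M" for x y
    unfolding B_def using Y_measurable by measurable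
  have pB: "prob (B x y) \<le> 2 * exp (- (t\<^sup>2 / 2))" if x: "x \<in> net (n * d)" and y: "y \<in> net (n * d)" for x y
  proof -
    have "(\<Sum>k\<in>upper n d. (ent x (fst k) 0 * ent y (snd k) 0)\<^sup>2)
        \<le> (\<Sum>k\<in>{..<n*d} \<times> {..<n*d}. (ent x (fst k) 0 * ent y (snd k) 0)\<^sup>2)"
      by (intro sum_mono2) (auto simp: upper_def)
    also have "\<dots> = ip x x * ip y y"
      unfolding ip_col[OF net_props(1,2)[OF x], of x] ip_col[OF net_props(1,2)[OF y], of y]
      by (simp add: sum_product sum.cartesian_product power2_eq_square split_def mult_ac)
    also have "\<dots> \<le> 1 * 1"
      using net_props(3)[OF x] net_props(3)[OF y] by (intro mult_mono) (auto simp: fr_def)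
    finally have "(\<Sum>k\<in>upper n d. (ent x (fst k) 0 * ent y (snd k) 0)\<^sup>2) \<le> 1\<^sup>2" by simp
    then have "prob (B x y) \<le> 2 * exp (- t\<^sup>2 / (2 * 1\<^sup>2))"
      unfolding B_def by (intro gaussian_sum_tail finite_upper Y_indep Y_normal t) auto
    then show ?thesis by simp
  qed
  let ?B = "\<Union>p\<in>net (n * d) \<times> net (n * d). B (fst p) (snd p)"
  have "norm (of_mat (W \<omega>)) \<le> 4 * t" if \<omega>: "\<omega> \<in> space M - ?B" for \<omega>
  proof -
    let ?T = "utri n d (\<lambda>k. Y k \<omega>)"
    have "norm ?T \<le> 2 * t"
    proof (rule norm_le_net[of "n * d" "n * d"])
      show "idm (n * d) * ?T = ?T" "?T * idm (n * d) = ?T"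
        by (auto simp: idm_times_iff times_idm_iff upper_def)
      fix x y assume xy: "x \<in> net (n * d)" "y \<in> net (n * d)"
      then have "\<omega> \<notin> B x y" using \<omega> by force
      then show "\<bar>ip x (?T * y)\<bar> \<le> t"
      proof -
        have "\<bar>\<Sum>k\<in>upper n d. ent x (fst k) 0 * ent y (snd k) 0 * Y k \<omega>\<bar> \<le> t"
          using \<open>\<omega> \<notin> B x y\<close> \<omega> by (auto simp: B_def)
        then show ?thesis using net_props(1)[OF xy(1)] net_props(1)[OF xy(2)] by (simp add: ip_utri split_def)
      qed
    qed (use n d in auto)
    then have "norm (?T + tp ?T) \<le> 2 * t + 2 * t" by (intro norm_add_le) auto
    then show ?thesis using \<omega> by (simp add: of_mat_W wmat_def)
  qed
  then show ?thesis using net_union_bound[of "n * d" B "t\<^sup>2 / 2", OF mB pB] by blast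
qed

text \<open>
  \<open>V\<close> depends on the entries off block \<open>i\<close> only, so for fixed net points the bilinear form of
  \<open>blk d i W * V\<close> is a Gaussian sum with independent random coefficients. Their squares sum to at most \<open>s\<^sup>2\<close>
  when the norm of \<open>V\<close> is at most \<open>s\<close>.
\<close>

lemma block_event:
  assumes i: "i < n" and s: "0 < s" and t: "0 < t"
    and V: "fmeas (PiM (upper n d - touching n d i) (\<lambda>_. borel)) V"
    and Vd: "\<And>b. V b * idm d = V b" "\<And>b. idm (n * d) * V b = V b"
  defines "R \<equiv> \<lambda>\<omega>. restrict (\<lambda>k. Y k \<omega>) (upper n d - touching n d i)"
  shows "\<exists>B\<in>sets M. prob B \<le> 2 * exp (36 * real d - t\<^sup>2 / (2 * s\<^sup>2)) \<and>
    (\<forall>\<omega>\<in>space M - B. norm (V (R \<omega>)) \<le> s \<longrightarrow> norm (blk d i (of_mat (W \<omega>)) * V (R \<omega>)) \<le> 2 * t)"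
proof -
  let ?K = "touching n d i" and ?J = "upper n d - touching n d i"
  define c where "c x y k b = coef (sel d i * x) (V b * y) k" for x y k b
  define B where "B x y = {\<omega>\<in>space M. (\<Sum>k\<in>?K. (c x y k (R \<omega>))\<^sup>2) \<le> s\<^sup>2 \<and> t < \<bar>\<Sum>k\<in>?K. c x y k (R \<omega>) * Y k \<omega>\<bar>}" for x y
  have finK: "finite ?K" using finite_subset[OF touching_subset finite_upper] .
  have mc: "c x y k \<in> borel_measurable (PiM ?J (\<lambda>_. borel))" for x y k
  proof -
    have "fmeas (PiM ?J (\<lambda>_. borel)) (\<lambda>b. V b * y)" by (rule fmeas_ops(3)[OF V fmeas_const])
    then have [measurable]: "(\<lambda>b. ent (V b * y) r c) \<in> borel_measurable (PiM ?J (\<lambda>_. borel))" for r c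
      by (simp add: fmeas_def)
    show ?thesis unfolding c_def[abs_def] coef_def by (cases k) simp
  qed
  have Bs: "B x y \<in> sets M" "prob (B x y) \<le> 2 * exp (- (t\<^sup>2 / (2 * s\<^sup>2)))" for x y
  proof -
    have "?J \<inter> ?K = {}" "\<And>k. k \<in> ?K \<Longrightarrow> distributed M lborel (Y k) std_normal_density"
      using Y_normal subsetD[OF touching_subset] by blast+
    from gaussian_sum_conditional_tail[OF finK Y_indep touching_subset Diff_subset this, where c="c x y" and s=s and t=t, OF _ mc s t]
    show "B x y \<in> sets M" "prob (B x y) \<le> 2 * exp (- (t\<^sup>2 / (2 * s\<^sup>2)))"
      by (simp_all add: B_def R_def)
  qed
  let ?B = "\<Union>p\<in>net d \<times> net d. B (fst p) (snd p)"
  have "norm (blk d i (of_mat (W \<omega>)) * V (R \<omega>)) \<le> 2 * t"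
    if \<omega>: "\<omega> \<in> space M - ?B" and Vs: "norm (V (R \<omega>)) \<le> s" for \<omega>
  proof (rule norm_le_net[of d d])
    let ?W = "wmat n d (\<lambda>k. Y k \<omega>)"
    have W: "of_mat (W \<omega>) = ?W" using \<omega> by (simp add: of_mat_W)
    show "idm d * (blk d i (of_mat (W \<omega>)) * V (R \<omega>)) = blk d i (of_mat (W \<omega>)) * V (R \<omega>)"
      by (simp add: idm_blk flip: mult.assoc)
    show "blk d i (of_mat (W \<omega>)) * V (R \<omega>) * idm d = blk d i (of_mat (W \<omega>)) * V (R \<omega>)"
      by (simp add: mult.assoc Vd)
    fix x y assume xy: "x \<in> net d" "y \<in> net d"
    note x = net_props[OF xy(1)] and y = net_props[OF xy(2)]
    define v where "v = V (R \<omega>) * y"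
    have v: "is_col v" "idm (n * d) * v = v"
      by (simp_all add: v_def col_times y Vd flip: mult.assoc)
    have cz: "coef (sel d i * x) v k = 0" if "k \<in> upper n d - ?K" for k
      by (rule coef_not_touching[OF ent_sel_times_off[OF d] that])
    have "(\<Sum>k\<in>?K. (c x y k (R \<omega>))\<^sup>2) = (\<Sum>k\<in>upper n d. coef (sel d i * x) v k * coef (sel d i * x) v k)"
      unfolding c_def v_def[symmetric] power2_eq_square
      using cz touching_subset finite_upper by (intro sum.mono_neutral_left) auto
    also have "\<dots> = ip x x * (ip v v - ip (blk d i v) (blk d i v))"
      by (rule sum_coef_ip[OF i d x(1,2,1) v])
    also have "\<dots> \<le> ip x x * ip v v" by (intro mult_left_mono) auto
    also have "\<dots> = (fr x)\<^sup>2 * (fr v)\<^sup>2" by (simp add: fr_square)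
    also have "\<dots> \<le> 1\<^sup>2 * s\<^sup>2"
    proof (intro mult_mono power_mono)
      have "fr v \<le> norm (V (R \<omega>)) * fr y" unfolding v_def by (rule fr_times_le_norm)
      also have "\<dots> \<le> s * 1" using Vs y s by (intro mult_mono) auto
      finally show "fr v \<le> s" by simp
    qed (use x in auto)
    finally have "(\<Sum>k\<in>?K. (c x y k (R \<omega>))\<^sup>2) \<le> s\<^sup>2" by simp
    moreover have "\<omega> \<notin> B x y" using \<omega> xy by force
    ultimately have "\<bar>\<Sum>k\<in>?K. c x y k (R \<omega>) * Y k \<omega>\<bar> \<le> t" using \<omega> by (simp add: B_def)
    also have "(\<Sum>k\<in>?K. c x y k (R \<omega>) * Y k \<omega>) = (\<Sum>k\<in>upper n d. coef (sel d i * x) v k * Y k \<omega>)"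
      unfolding c_def v_def[symmetric]
      using cz touching_subset finite_upper by (intro sum.mono_neutral_left) auto
    also have "\<dots> = ip (sel d i * x) (?W * v)" by (rule ip_wmat[symmetric]) (simp_all add: col_times x v)
    also have "\<dots> = ip x (blk d i (of_mat (W \<omega>)) * V (R \<omega>) * y)"
      by (simp add: W v_def blk_def ip_times_left mult.assoc)
    finally show "\<bar>ip x (blk d i (of_mat (W \<omega>)) * V (R \<omega>) * y)\<bar> \<le> t" .
  qed (use d in auto)
  then show ?thesis using net_union_bound[of d B "t\<^sup>2 / (2 * s\<^sup>2)", OF Bs] by blast
qed

lemma wmat_mask_restrict:
  "wmat n d (mask d i (restrict y (upper n d - touching n d i))) = wmat n d (mask d i y)"
  by (rule fmat_eqI) (auto simp: ent_wmat mask_def touching_def)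

text \<open>
  The constant \<open>\<tau>\<close> is large enough to outweigh the net cardinalities and leaves probability at most
  \<open>2 n powr (- \<gamma> - 4)\<close> for each of the \<open>2 n + 1\<close> exceptional events.
\<close>

lemma good_event:
  fixes \<gamma> \<sigma> s1 s2 :: real
  assumes n2: "2 \<le> n" and \<gamma>: "0 < \<gamma>" and s1: "0 < s1" and s2: "0 < s2"
    and Z: "Z * idm d = Z" "idm (n * d) * Z = Z"
  defines "\<tau> \<equiv> sqrt (2 * (40 + \<gamma>))" and "\<Delta> \<equiv> sqrt (real d) + sqrt (ln (real n))"
  defines "U \<equiv> \<lambda>i \<omega>. (gmap n \<sigma> Z (loo d i (of_mat (W \<omega>))) ^^ n) Z"
  shows "\<exists>A\<in>sets M. 1 - real n powr (- \<gamma>) \<le> prob A \<and> (\<forall>\<omega>\<in>A. \<omega> \<in> space M \<and>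
    norm (of_mat (W \<omega>)) \<le> 4 * \<tau> * sqrt (real (n * d)) \<and>
    (\<forall>i<n. (norm Z \<le> s1 \<longrightarrow> norm (blk d i (of_mat (W \<omega>)) * Z) \<le> 2 * (s1 * \<tau> * \<Delta>)) \<and>
      (norm (U i \<omega> - Z) \<le> s2 \<longrightarrow> norm (blk d i (of_mat (W \<omega>)) * (U i \<omega> - Z)) \<le> 2 * (s2 * \<tau> * \<Delta>))))"
proof -
  define a where "a = 40 + \<gamma>"
  have \<tau>: "0 < \<tau>" "\<tau>\<^sup>2 = 2 * a" using \<gamma> by (auto simp: \<tau>_def a_def)
  have ln: "0 \<le> ln (real n)" using n by simp
  have \<Delta>: "0 < \<Delta>" unfolding \<Delta>_def using d ln by (intro add_pos_nonneg) auto
  have \<Delta>2: "real d + ln (real n) \<le> \<Delta>\<^sup>2" using ln by (simp add: \<Delta>_def power2_sum)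
  define b where "b = exp (- ((\<gamma> + 4) * ln (real n)))"
  have tail: "2 * exp (36 * real d - (s * \<tau> * \<Delta>)\<^sup>2 / (2 * s\<^sup>2)) \<le> 2 * b" if "0 < s" for s
  proof -
    have "(s * \<tau> * \<Delta>)\<^sup>2 / (2 * s\<^sup>2) = a * \<Delta>\<^sup>2" using that \<tau> by (simp add: power_mult_distrib)
    moreover have "a * (real d + ln (real n)) \<le> a * \<Delta>\<^sup>2" using \<Delta>2 \<gamma> by (intro mult_left_mono) (auto simp: a_def)
    moreover have "36 * real d \<le> a * real d" "(\<gamma> + 4) * ln (real n) \<le> a * ln (real n)"
      using \<gamma> ln by (intro mult_right_mono; simp add: a_def)+
    ultimately have "36 * real d - (s * \<tau> * \<Delta>)\<^sup>2 / (2 * s\<^sup>2) \<le> - ((\<gamma> + 4) * ln (real n))"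
      by (simp only: distrib_left)
    then show ?thesis by (simp add: b_def)
  qed
  have tail1: "2 * exp (36 * real (n * d) - (\<tau> * sqrt (real (n * d)))\<^sup>2 / 2) \<le> 2 * b"
  proof -
    have "ln (real n) \<le> real n" using n by (metis ln_le_minus_one of_nat_0_less_iff diff_le_eq add_increasing2 order_trans zero_le_one le_add_same_cancel1)
    also have "\<dots> \<le> real (n * d)" using d by (simp only: of_nat_le_iff) simp
    finally have "(\<gamma> + 4) * ln (real n) \<le> (\<gamma> + 4) * real (n * d)" using \<gamma> by (intro mult_left_mono) auto
    moreover have "(\<tau> * sqrt (real (n * d)))\<^sup>2 / 2 = a * real (n * d)" using \<tau> by (simp add: power_mult_distrib)
    ultimately have "36 * real (n * d) - (\<tau> * sqrt (real (n * d)))\<^sup>2 / 2 \<le> - ((\<gamma> + 4) * ln (real n))"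
      by (simp add: a_def algebra_simps)
    then show ?thesis by (simp add: b_def)
  qed
  have "0 < \<tau> * sqrt (real (n * d))" using \<tau> n d by simp
  from operator_norm_event[OF this] obtain B0 where B0: "B0 \<in> sets M" "prob B0 \<le> 2 * b"
    "\<And>\<omega>. \<omega> \<in> space M - B0 \<Longrightarrow> norm (of_mat (W \<omega>)) \<le> 4 * (\<tau> * sqrt (real (n * d)))"
    using tail1 by (meson order_trans)
  have "\<exists>B. B \<in> sets M \<and> prob B \<le> 2 * b \<and> (\<forall>\<omega>\<in>space M - B. norm Z \<le> s1 \<longrightarrow> norm (blk d i (of_mat (W \<omega>)) * Z) \<le> 2 * (s1 * \<tau> * \<Delta>))"
    if i: "i < n" for i
  proof -
    have t: "0 < s1 * \<tau> * \<Delta>" using s1 \<tau> \<Delta> by simp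
    show ?thesis
      using block_event[OF i s1 t fmeas_const[of _ Z] Z] tail[OF s1] by (meson order_trans)
  qed
  then obtain B1 where B1: "\<And>i. i < n \<Longrightarrow> B1 i \<in> sets M" "\<And>i. i < n \<Longrightarrow> prob (B1 i) \<le> 2 * b"
    "\<And>i \<omega>. i < n \<Longrightarrow> \<omega> \<in> space M - B1 i \<Longrightarrow> norm Z \<le> s1 \<Longrightarrow> norm (blk d i (of_mat (W \<omega>)) * Z) \<le> 2 * (s1 * \<tau> * \<Delta>)"
    by metis
  have "\<exists>B. B \<in> sets M \<and> prob B \<le> 2 * b \<and> (\<forall>\<omega>\<in>space M - B. norm (U i \<omega> - Z) \<le> s2 \<longrightarrow>
      norm (blk d i (of_mat (W \<omega>)) * (U i \<omega> - Z)) \<le> 2 * (s2 * \<tau> * \<Delta>))"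
    if i: "i < n" for i
  proof -
    let ?J = "upper n d - touching n d i"
    define w where "w y = wmat n d (mask d i y)" for y
    define V where "V y = (gmap n \<sigma> Z (w y) ^^ n) Z - Z" for y
    have t: "0 < s2 * \<tau> * \<Delta>" using s2 \<tau> \<Delta> by simp
    have "fmeas (PiM ?J (\<lambda>_. borel)) w"
      unfolding fmeas_def
    proof (intro conjI allI exI[of _ "n * d"])
      show "supp_le (n * d) (w y)" for y by (auto simp: w_def supp_le_def ent_wmat upper_def)
      fix r c
      have m: "(\<lambda>y. mask d i y k) \<in> borel_measurable (PiM ?J (\<lambda>_. borel))" if "k \<in> upper n d" for k
      proof -
        obtain a b where k: "k = (a, b)" by (cases k)
        show ?thesis
        proof (cases "a div d = i \<or> b div d = i")
          case False
          then have "k \<in> ?J" using that by (auto simp: k touching_def)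
          then have "(\<lambda>y. y k) \<in> borel_measurable (PiM ?J (\<lambda>_. borel))"
            by (rule measurable_component_singleton)
          then show ?thesis using False by (simp add: mask_def k)
        qed (auto simp: mask_def k)
      qed
      show "(\<lambda>y. ent (w y) r c) \<in> borel_measurable (PiM ?J (\<lambda>_. borel))"
        unfolding w_def ent_wmat using m by (cases "(r, c) \<in> upper n d"; cases "(c, r) \<in> upper n d") auto
    qed
    then have V: "fmeas (PiM ?J (\<lambda>_. borel)) V"
      unfolding V_def[abs_def] by (intro fmeas_ops(2) fmeas_gmap_iterate fmeas_const)
    have Vd: "V y * idm d = V y" "idm (n * d) * V y = V y" for y
      using gmap_iterate_dims[OF Z wmat_props(2)] Z
      by (simp_all add: V_def w_def left_diff_distrib right_diff_distrib)
    have VU: "V (restrict (\<lambda>k. Y k \<omega>) ?J) = U i \<omega> - Z" if "\<omega> \<in> space M" for \<omega>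
      using that by (simp add: V_def U_def w_def wmat_mask_restrict of_mat_W loo_wmat[OF d])
    from block_event[OF i s2 t V Vd] obtain B where B: "B \<in> sets M"
      "prob B \<le> 2 * exp (36 * real d - (s2 * \<tau> * \<Delta>)\<^sup>2 / (2 * s2\<^sup>2))"
      "\<forall>\<omega>\<in>space M - B. norm (V (restrict (\<lambda>k. Y k \<omega>) ?J)) \<le> s2 \<longrightarrow>
        norm (blk d i (of_mat (W \<omega>)) * V (restrict (\<lambda>k. Y k \<omega>) ?J)) \<le> 2 * (s2 * \<tau> * \<Delta>)" by blast
    show ?thesis using B tail[OF s2] VU by (intro exI[of _ B]) (auto intro: order_trans)
  qed
  then obtain B2 where B2: "\<And>i. i < n \<Longrightarrow> B2 i \<in> sets M" "\<And>i. i < n \<Longrightarrow> prob (B2 i) \<le> 2 * b"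
    "\<And>i \<omega>. i < n \<Longrightarrow> \<omega> \<in> space M - B2 i \<Longrightarrow> norm (U i \<omega> - Z) \<le> s2 \<Longrightarrow>
      norm (blk d i (of_mat (W \<omega>)) * (U i \<omega> - Z)) \<le> 2 * (s2 * \<tau> * \<Delta>)"
    by metis
  define Bad where "Bad = B0 \<union> ((\<Union>i\<in>{..<n}. B1 i) \<union> (\<Union>i\<in>{..<n}. B2 i))"
  have m1: "(\<Union>i\<in>{..<n}. B1 i) \<in> sets M" "(\<Union>i\<in>{..<n}. B2 i) \<in> sets M"
    using B1(1) B2(1) by (auto intro!: sets.finite_UN)
  have mBad: "Bad \<in> sets M" unfolding Bad_def using B0(1) m1 by simp
  have "prob Bad \<le> prob B0 + (prob (\<Union>i\<in>{..<n}. B1 i) + prob (\<Union>i\<in>{..<n}. B2 i))"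
    unfolding Bad_def using B0(1) m1
    by (intro order_trans[OF measure_Un_le] add_left_mono measure_Un_le) auto
  also have "\<dots> \<le> 2 * b + (real n * (2 * b) + real n * (2 * b))"
    using B0(2) union_bound[of "{..<n}" B1 "2 * b"] union_bound[of "{..<n}" B2 "2 * b"] B1 B2
    by (intro add_mono) auto
  also have "\<dots> = (2 + 4 * real n) * b" by (simp add: algebra_simps)
  also have "b = real n powr (- \<gamma>) / real n ^ 4"
  proof -
    have "b = real n powr (- \<gamma> - 4)" using n by (simp add: b_def powr_def algebra_simps)
    also have "\<dots> = real n powr (- \<gamma>) / real n powr 4" by (rule powr_diff)
    finally show ?thesis using n by (simp add: powr_numeral)
  qed
  also have "(2 + 4 * real n) * (real n powr (- \<gamma>) / real n ^ 4) \<le> real n powr (- \<gamma>)"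
  proof -
    have "2 \<le> real n" using n2 by simp
    then have "2 ^ 3 \<le> real n ^ 3" by (intro power_mono) auto
    then have "8 * real n \<le> real n ^ 3 * real n" by (intro mult_right_mono) auto
    also have "real n ^ 3 * real n = real n ^ 4" by (simp add: power_numeral_reduce)
    finally have "2 + 4 * real n \<le> real n ^ 4" using \<open>2 \<le> real n\<close> by linarith
    then have "(2 + 4 * real n) * real n powr (- \<gamma>) \<le> real n ^ 4 * real n powr (- \<gamma>)"
      by (intro mult_right_mono) auto
    then show ?thesis using n by (simp add: field_simps)
  qed
  finally have pBad: "prob Bad \<le> real n powr (- \<gamma>)" .
  have "1 - real n powr (- \<gamma>) \<le> prob (space M - Bad)" using pBad by (simp add: prob_compl[OF mBad])
  moreover have "space M - Bad \<in> sets M" using mBad by auto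
  ultimately show ?thesis
    using B0(3) B1(3) B2(3) by (intro bexI[of _ "space M - Bad"]) (auto simp: Bad_def mult.assoc)
qed

text \<open>
  Off the sample space the matrix \<open>W \<omega>\<close> is arbitrary, so \<open>G\<close> is built from the coordinates \<open>Y\<close>.
\<close>

definition G :: "fmat \<Rightarrow> nat \<Rightarrow> 'w \<Rightarrow> real mat" where
  "G Z i \<omega> = to_mat d d ((1 / sqrt (real (n - 1))) *\<^sub>R
     (blk d i (wmat n d (\<lambda>k. Y k \<omega>)) * Z * tp (blk d i Z)))"

lemma gaussian_G:
  assumes n2: "2 \<le> n" and i: "i < n" and Z: "Z * idm d = Z" "idm (n * d) * Z = Z" "tp Z * Z = real n *\<^sub>R idm d"
    and Zi: "orthf d (blk d i Z)"
  shows "gaussian_matrix M d (G Z i)"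
proof -
  define B where "B = Z * tp (blk d i Z)"
  note z = orthfD[OF Zi]
  have B1: "idm (n * d) * B = B" by (simp add: B_def Z flip: mult.assoc)
  have BB: "tp B * B = real n *\<^sub>R idm d"
  proof -
    have "tp B * B = blk d i Z * (tp Z * Z) * tp (blk d i Z)" by (simp add: B_def mult.assoc)
    then show ?thesis by (simp add: Z z)
  qed
  have bB: "blk d i B = idm d" by (simp add: B_def blk_times z)
  define c where "c p k = (1 / sqrt (real (n - 1))) * coef (sel d i * mu (fst p) 0) (B * mu (snd p) 0) k" for p k
  have Geq: "G Z i \<omega> $$ p = (\<Sum>k\<in>upper n d. c p k * Y k \<omega>)" if p: "p \<in> {..<d} \<times> {..<d}" for p \<omega>
  proof -
    obtain a b where ab: "p = (a, b)" "a < d" "b < d" using p by auto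
    let ?W = "wmat n d (\<lambda>k. Y k \<omega>)"
    have "ent (blk d i ?W * Z * tp (blk d i Z)) a b = ent (blk d i ?W * B * mu b 0) a 0"
      by (simp add: B_def mult.assoc[symmetric])
    also have "\<dots> = ip (mu a 0) (blk d i ?W * B * mu b 0)" by (simp add: ip_mu)
    also have "\<dots> = ip (sel d i * mu a 0) (?W * (B * mu b 0))"
      by (simp add: blk_def ip_times_left mult.assoc)
    also have "\<dots> = (\<Sum>k\<in>upper n d. coef (sel d i * mu a 0) (B * mu b 0) k * Y k \<omega>)"
      by (rule ip_wmat) (simp_all add: col_mu)
    finally show ?thesis using ab by (simp add: G_def to_mat_def c_def sum_divide_distrib mult.assoc)
  qed
  have on: "(\<Sum>k\<in>upper n d. c p k * c q k) = (if p = q then 1 else 0)"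
    if p: "p \<in> {..<d} \<times> {..<d}" and q: "q \<in> {..<d} \<times> {..<d}" for p q
  proof -
    obtain a b a' b' where ab: "p = (a, b)" "q = (a', b')" "a < d" "b < d" "a' < d" "b' < d" using p q by auto
    let ?v = "B * mu b 0" and ?v' = "B * mu b' 0"
    have m: "ip (mu a 0) (mu a' 0) = (if a = a' then 1 else 0)" for a a' by (auto simp: ip_mu)
    have em: "idm d * mu a 0 = mu a 0" if "a < d" for a using that by (auto simp: idm_times_iff)
    have cm: "is_col (mu a 0)" for a by (auto simp: col_ent)
    have v: "is_col ?v" "idm (n * d) * ?v = ?v" by (simp_all add: col_mu B1 flip: mult.assoc)
    have "ip ?v ?v' = ip (mu b 0) (tp B * B * mu b' 0)" by (simp add: ip_times_left mult.assoc)
    then have vv: "ip ?v ?v' = real n * (if b = b' then 1 else 0)" using ab by (simp add: BB em m)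
    have bb: "ip (blk d i ?v) (blk d i ?v') = (if b = b' then 1 else 0)"
      using ab by (simp add: blk_times bB em m)
    have "(\<Sum>k\<in>upper n d. c p k * c q k)
        = (1 / sqrt (real (n - 1)) * (1 / sqrt (real (n - 1)))) * (\<Sum>k\<in>upper n d. coef (sel d i * mu a 0) ?v k * coef (sel d i * mu a' 0) ?v' k)"
      unfolding sum_distrib_left by (intro sum.cong) (simp_all add: c_def ab)
    also have "\<dots> = (1 / real (n - 1)) * (ip (mu a 0) (mu a' 0) * (ip ?v ?v' - ip (blk d i ?v) (blk d i ?v')))"
      using sum_coef_ip[OF i d cm em[OF ab(3)] cm v, of a' ?v'] by simp
    also have "\<dots> = (if p = q then 1 else 0)"
      unfolding m vv bb using n2 by (auto simp: ab of_nat_diff)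
    finally show ?thesis .
  qed
  have P: "finite ({..<d} \<times> {..<d})" "{..<d} \<times> {..<d} \<noteq> {}" using d by auto
  have os1: "indep_vars (\<lambda>_. borel) (\<lambda>p \<omega>. \<Sum>k\<in>upper n d. c p k * Y k \<omega>) ({..<d} \<times> {..<d})"
    by (rule orthonormal_combinations_std_normal(1)[OF finite_upper Y_indep Y_normal P on])
  have os2: "distributed M lborel (\<lambda>\<omega>. \<Sum>k\<in>upper n d. c p k * Y k \<omega>) std_normal_density"
    if "p \<in> {..<d} \<times> {..<d}" for p
    by (rule orthonormal_combinations_std_normal(2)[OF finite_upper Y_indep Y_normal P on]) (use that in auto)
  have "indep_vars (\<lambda>_. borel) (\<lambda>p \<omega>. G Z i \<omega> $$ p) ({..<d} \<times> {..<d})"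
    using os1 by (subst indep_vars_cong[OF refl _ refl, where Y="\<lambda>p \<omega>. \<Sum>k\<in>upper n d. c p k * Y k \<omega>"]) (auto simp: Geq)
  moreover have "distributed M lborel (\<lambda>\<omega>. G Z i \<omega> $$ p) std_normal_density" if "p \<in> {..<d} \<times> {..<d}" for p
    using os2[OF that] by (simp add: Geq[OF that])
  ultimately show ?thesis by (auto simp: gaussian_matrix_def split_def G_def)
qed

end

section \<open>The decomposition\<close>

lemma eig_solution_maximal:
  assumes sol: "eig_solution n d C S" and C: "C \<in> carrier_mat (n * d) (n * d)"
  shows "S \<in> carrier_mat (n * d) d" "tp (of_mat S) * of_mat S = real n *\<^sub>R idm d"
    "\<And>S'. idm (n * d) * S' = S' \<Longrightarrow> S' * idm d = S' \<Longrightarrow> tp S' * S' = real n *\<^sub>R idm d \<Longrightarrow>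
      ip (of_mat C) (S' * tp S') \<le> ip (of_mat C) (of_mat S * tp (of_mat S))"
proof -
  have arg: "is_arg_min (\<lambda>S. - frob_inner C (S * S\<^sup>T))
       (\<lambda>S. S \<in> carrier_mat (n * d) d \<and> S\<^sup>T * S = real n \<cdot>\<^sub>m 1\<^sub>m d) S"
    using sol by (simp add: eig_solution_def)
  have tS: "of_mat (T\<^sup>T * T) = tp (of_mat T) * of_mat T" "frob_inner C (T * T\<^sup>T) = ip (of_mat C) (of_mat T * tp (of_mat T))"
    if T: "T \<in> carrier_mat (n * d) d" for T
  proof -
    have T': "T\<^sup>T \<in> carrier_mat d (n * d)" using T by simp
    show "of_mat (T\<^sup>T * T) = tp (of_mat T) * of_mat T" using of_mat_mult[OF T' T] by simp
    have "T * T\<^sup>T \<in> carrier_mat (n * d) (n * d)" using T by simp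
    from frob_inner_eq_ip[OF C this]
    show "frob_inner C (T * T\<^sup>T) = ip (of_mat C) (of_mat T * tp (of_mat T))" by (simp add: of_mat_mult[OF T T'])
  qed
  show S: "S \<in> carrier_mat (n * d) d" using arg by (auto simp: is_arg_min_def)
  have "S\<^sup>T * S = real n \<cdot>\<^sub>m 1\<^sub>m d" using arg by (auto simp: is_arg_min_def)
  then show "tp (of_mat S) * of_mat S = real n *\<^sub>R idm d"
    using tS(1)[OF S] by simp
  fix S' assume S': "idm (n * d) * S' = S'" "S' * idm d = S'" "tp S' * S' = real n *\<^sub>R idm d"
  define T where "T = to_mat (n * d) d S'"
  have T: "T \<in> carrier_mat (n * d) d" "of_mat T = S'" using S' by (simp_all add: T_def of_mat_to_mat)
  have "T\<^sup>T * T = real n \<cdot>\<^sub>m 1\<^sub>m d"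
    by (rule of_mat_inj[of _ d d]) (use T tS(1)[OF T(1)] S' in auto)
  then have "\<not> - frob_inner C (T * T\<^sup>T) < - frob_inner C (S * S\<^sup>T)"
    using arg T(1) by (auto simp: is_arg_min_def)
  then show "ip (of_mat C) (S' * tp S') \<le> ip (of_mat C) (of_mat S * tp (of_mat S))"
    using tS(2)[OF T(1)] tS(2)[OF S] T(2) by simp
qed

lemma gram_props:
  assumes S: "S \<in> carrier_mat (n * d) d" and i: "i < n"
  shows "gram d S i \<in> carrier_mat d d" "(gram d S i)\<^sup>T = gram d S i"
    "of_mat (gram d S i) = tp (blk d i (of_mat S)) * blk d i (of_mat S)"
proof -
  have b: "row_block d S i \<in> carrier_mat d d" by (simp add: block_def)
  then show "gram d S i \<in> carrier_mat d d" by (simp add: gram_def)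
  show "(gram d S i)\<^sup>T = gram d S i" unfolding gram_def
    using b by (subst transpose_mult[of _ d d _ d]) auto
  have "of_mat (gram d S i) = of_mat ((row_block d S i)\<^sup>T) * of_mat (row_block d S i)"
    unfolding gram_def using b by (intro of_mat_mult) auto
  then show "of_mat (gram d S i) = tp (blk d i (of_mat S)) * blk d i (of_mat S)"
    by (simp add: of_mat_row_block[OF S i])
qed

text \<open>
  This turns the signal-to-noise hypothesis into one in which \<open>\<kappa>\<close> no longer occurs.
\<close>

lemma cond_number_ge_1:
  assumes S: "S \<in> carrier_mat (n * d) d" and n: "0 < n" and d: "0 < d" and fin: "cond_finite n d S"
  shows "1 \<le> cond_number n d S"
proof -
  note g = gram_props[OF S n]
  note sp = symmetric_spectrum[OF g(1,2) d]
  have "lambda_min (gram d S 0) \<le> lambda_max (gram d S 0)"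
    unfolding lambda_min_def lambda_max_def using sp by (meson Max_ge Min_in)
  moreover have "0 < lambda_min (gram d S 0)" using fin n by (simp add: cond_finite_def)
  ultimately have "1 \<le> lambda_max (gram d S 0) / lambda_min (gram d S 0)" by simp
  also have "\<dots> \<le> cond_number n d S" unfolding cond_number_def using n by (intro Max_ge) auto
  finally show ?thesis .
qed

lemma cond_number_le:
  assumes S: "S \<in> carrier_mat (n * d) d" and n: "0 < n" and d: "0 < d" and \<delta>: "\<delta> < 1"
    and near: "\<And>i. i < n \<Longrightarrow> norm (tp (blk d i (of_mat S)) * blk d i (of_mat S) - idm d) \<le> \<delta>"
  shows "cond_number n d S \<le> (1 + \<delta>) / (1 - \<delta>)"
proof -
  have "lambda_max (gram d S i) / lambda_min (gram d S i) \<le> (1 + \<delta>) / (1 - \<delta>)" if i: "i < n" for i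
  proof -
    note g = gram_props[OF S i]
    note sp = symmetric_spectrum[OF g(1,2) d]
    have ev: "\<bar>l - 1\<bar> \<le> \<delta>" if "l \<in> spectrum (gram d S i)" for l
      using eigenvalue_near_1[OF g(1) that] near[OF i] by (simp add: g(3))
    have "\<bar>lambda_max (gram d S i) - 1\<bar> \<le> \<delta>" "\<bar>lambda_min (gram d S i) - 1\<bar> \<le> \<delta>"
      unfolding lambda_max_def lambda_min_def using ev sp by (auto intro!: ev Max_in Min_in)
    then show ?thesis using \<delta> by (intro frac_le) auto
  qed
  then show ?thesis unfolding cond_number_def using n by (subst Max_le_iff) auto
qed

lemma orth_stack_blocks:
  assumes "Z \<in> orth_stack n d"
  shows "Z \<in> carrier_mat (n * d) d" "\<And>i. i < n \<Longrightarrow> orthf d (blk d i (of_mat Z))"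
proof -
  show Z: "Z \<in> carrier_mat (n * d) d" using assms by (simp add: orth_stack_def)
  fix i assume i: "i < n"
  have "row_block d Z i \<in> orth d" using assms i by (simp add: orth_stack_def)
  moreover have "row_block d Z i \<in> carrier_mat d d" by (simp add: block_def)
  ultimately show "orthf d (blk d i (of_mat Z))"
    using orth_iff_orthf of_mat_row_block[OF Z i] by metis
qed

lemma stack_blocks:
  assumes B: "\<And>i. i < n \<Longrightarrow> B i \<in> carrier_mat d d" and i: "i < n"
  shows "blk d i (of_mat (stack n d B)) = of_mat (B i)"
proof -
  have c: "stack n d B \<in> carrier_mat (n * d) d" by (simp add: stack_def)
  have "row_block d (stack n d B) i = B i"
    using B[OF i] block_bound[OF i, of _ d] by (intro eq_matI) (auto simp: block_def stack_def)
  then show ?thesis using of_mat_row_block[OF c i] by simp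
qed

text \<open>
  The last hypothesis on the noise is conditional, because the size of the leave-one-out error is only known
  when the noise is small.
\<close>

lemma deterministic_decomposition:
  fixes \<sigma> h :: real
  assumes n: "0 < n" and d: "0 < d" and \<sigma>: "0 < \<sigma>" and h: "0 \<le> h" "h \<le> 1/100"
    and Z: "Z \<in> orth_stack n d" and Wc: "W \<in> carrier_mat (n * d) (n * d)" and W: "of_mat W = wmat n d y"
    and W_small: "\<sigma> * norm (of_mat W) \<le> n * h"
    and WZ: "\<And>i. i < n \<Longrightarrow> \<sigma> * norm (blk d i (of_mat W) * of_mat Z) \<le> n * h"
    and WU: "\<And>i. i < n \<Longrightarrow> norm ((gmap n \<sigma> (of_mat Z) (loo d i (of_mat W)) ^^ n) (of_mat Z) - of_mat Z) \<le> 6 * h * sqrt n \<Longrightarrow>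
      \<sigma> * norm (blk d i (of_mat W) * ((gmap n \<sigma> (of_mat Z) (loo d i (of_mat W)) ^^ n) (of_mat Z) - of_mat Z)) \<le> n * h\<^sup>2"
    and P: "polar_retraction d P" and S: "eig_solution n d (observation \<sigma> Z W) S"
    and i: "i < n"
  defines "Q \<equiv> P (Z\<^sup>T * stack n d (\<lambda>i. P (row_block d S i)))"
  shows "norm (tp (blk d i (of_mat S)) * blk d i (of_mat S) - idm d) \<le> 15 * h"
    "Q \<in> carrier_mat d d" "P (row_block d S i) \<in> carrier_mat d d"
    "norm (of_mat (P (row_block d S i)) - (idm d + (\<sigma> / (2 * real n)) *\<^sub>R
      (blk d i (of_mat W) * of_mat Z * tp (blk d i (of_mat Z)) - tp (blk d i (of_mat W) * of_mat Z * tp (blk d i (of_mat Z)))))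
        * blk d i (of_mat Z) * of_mat Q) \<le> 5000 * h\<^sup>2"
proof -
  let ?Z = "of_mat Z" and ?W = "of_mat W" and ?S = "of_mat S"
  note Zs = orth_stack_blocks[OF Z]
  note Zd = of_mat_dims[OF Zs(1)]
  have Zt: "Z\<^sup>T \<in> carrier_mat d (n * d)" using Zs(1) by simp
  interpret synchronization n d \<sigma> h ?Z ?W
    by unfold_locales (use n d \<sigma> h W_small Zd Zs(2) in \<open>auto simp: W wmat_props wmat_diag\<close>)
  interpret synchronization_event n d \<sigma> h ?Z ?W
    by unfold_locales (use WZ WU norm_U in \<open>auto simp: U_def\<close>)
  have obs: "observation \<sigma> Z W \<in> carrier_mat (n * d) (n * d)"
    "of_mat (observation \<sigma> Z W) = ?Z * tp ?Z + \<sigma> *\<^sub>R ?W"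
  proof -
    have ZZt: "Z * Z\<^sup>T \<in> carrier_mat (n * d) (n * d)" using Zs(1) by simp
    then show "observation \<sigma> Z W \<in> carrier_mat (n * d) (n * d)" using Wc by (simp add: observation_def)
    show "of_mat (observation \<sigma> Z W) = ?Z * tp ?Z + \<sigma> *\<^sub>R ?W"
      unfolding observation_def using Wc ZZt
      by (subst of_mat_add[OF ZZt]) (auto simp: of_mat_mult[OF Zs(1) Zt])
  qed
  note es = eig_solution_maximal[OF S obs(1), unfolded obs(2)]
  note Sd = of_mat_dims[OF es(1)]
  have "real n * h \<le> real n * (1/100)" using h by (intro mult_left_mono) auto
  then have small: "\<sigma> * norm ?W \<le> real n / 8" using W_small by linarith
  have npos: "0 < real n" using n by simp
  have symW: "tp ?W = ?W" "idm (n * d) * ?W = ?W" by (simp_all add: W wmat_props)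
  have "\<exists>V H. ?S = V * H \<and> V * idm d = V \<and> idm (n * d) * V = V \<and> idm d * H = H \<and> H * idm d = H \<and>
      tp ?Z * V = real n *\<^sub>R idm d \<and> V = gmap n \<sigma> ?Z ?W V \<and> norm V \<le> 2 * s \<and> norm H \<le> 1"
    by (rule eigenspace_graph[OF npos \<sigma> symW Zd ZZ Sd es(2) _ small])
       (erule es(3), assumption+, intro exI conjI, assumption+)
  then obtain V H where VH: "?S = V * H" "V * idm d = V" "idm (n * d) * V = V" "idm d * H = H" "H * idm d = H"
    "tp ?Z * V = real n *\<^sub>R idm d" "V = gmap n \<sigma> ?Z ?W V" "norm V \<le> 2 * s" "norm H \<le> 1"
    by blast
  have rb: "row_block d S j \<in> carrier_mat d d" for j by (simp add: block_def)
  have Pc: "P (row_block d S j) \<in> carrier_mat d d" for j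
    by (rule polar_retraction_polar_factor(1)[OF P rb])
  then show "P (row_block d S i) \<in> carrier_mat d d" .
  have polar: "polar_factor d (blk d j ?S) (of_mat (P (row_block d S j)))" if "j < n" for j
    using polar_retraction_polar_factor(2)[OF P rb, of j] by (simp add: of_mat_row_block[OF es(1) that])
  let ?Zh = "stack n d (\<lambda>i. P (row_block d S i))"
  have Zh: "?Zh \<in> carrier_mat (n * d) d" by (simp add: stack_def)
  have ZZh: "Z\<^sup>T * ?Zh \<in> carrier_mat d d" using Zt Zh by simp
  show "Q \<in> carrier_mat d d" unfolding Q_def by (rule polar_retraction_polar_factor(1)[OF P ZZh])
  have Q: "polar_factor d (tp ?Z * of_mat ?Zh) (of_mat Q)"
    using polar_retraction_polar_factor(2)[OF P ZZh] by (simp add: Q_def of_mat_mult[OF Zt Zh])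
  have Q0: "polar_factor d H (of_mat (P (to_mat d d H)))"
    using polar_retraction_polar_factor(2)[OF P, of "to_mat d d H"] VH by (simp add: of_mat_to_mat)
  note main = eigenvector_polar_expansion[OF VH(1,2,7,8,6,4,5,9) es(2) polar stack_blocks[OF Pc] of_mat_dims(1)[OF Zh] Q Q0 i]
  show "norm (tp (blk d i ?S) * blk d i ?S - idm d) \<le> 15 * h" by (rule main(1))
  show "norm (of_mat (P (row_block d S i)) - (idm d + (\<sigma> / (2 * real n)) *\<^sub>R
      (blk d i ?W * ?Z * tp (blk d i ?Z) - tp (blk d i ?W * ?Z * tp (blk d i ?Z)))) * blk d i ?Z * of_mat Q) \<le> 5000 * h\<^sup>2"
    using main(2) by simp
qed

theorem theorem2p2:
  fixes \<gamma> :: real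
  assumes "0 < \<gamma>"
  shows "\<exists>C\<^sub>0>0. \<exists>C>0. \<exists>K>0. \<forall>n\<ge>1. \<forall>d\<ge>2.
    \<exists>c'>0. c' \<le> K * (1 + sqrt (ln (real n) / real d)) \<and>
    (\<forall>\<sigma>>0. \<forall>Z\<in>orth_stack n d. \<forall>(M :: 'w measure) W.
      prob_space M \<longrightarrow> noise_matrix M n d W \<longrightarrow>
      (\<exists>G :: nat \<Rightarrow> 'w \<Rightarrow> real mat.
        (2 \<le> n \<longrightarrow> (\<forall>i<n. gaussian_matrix M d (G i))) \<and>
        (\<exists>A\<in>sets M. measure M A \<ge> 1 - real n powr (- \<gamma>) \<and>
          (\<forall>\<omega>\<in>A. \<forall>P S. polar_retraction d P \<longrightarrow>
            eig_solution n d (observation \<sigma> Z (W \<omega>)) S \<longrightarrow>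
            (let \<kappa> = cond_number n d S;
                 \<Delta> = sqrt (real d) + sqrt (ln (real n));
                 Zhat = stack n d (\<lambda>i. P (row_block d S i));
                 Q = P (Z\<^sup>T * Zhat)
             in cond_finite n d S \<longrightarrow> snr n d \<sigma> \<ge> C\<^sub>0 * sqrt \<kappa> * \<Delta> \<longrightarrow>
                \<kappa> \<le> (1 + c' * inverse (snr n d \<sigma>)) / (1 - c' * inverse (snr n d \<sigma>)) \<and>
                (\<exists>E. \<forall>i<n. E i \<in> carrier_mat d d \<and>
                   P (row_block d S i) =
                     (1\<^sub>m d + (\<sigma> * sqrt (real (n - 1)) / (2 * real n)) \<cdot>\<^sub>m (G i \<omega> - (G i \<omega>)\<^sup>T))
                       * row_block d Z i * Q + E i \<and>
                   frob_norm (E i) \<le> C * sqrt \<kappa> * inverse ((snr n d \<sigma>)\<^sup>2) * \<Delta>\<^sup>2))))))"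
proof -
  define \<tau> where "\<tau> = sqrt (2 * (40 + \<gamma>))"
  have \<tau>: "0 < \<tau>" using assms by (simp add: \<tau>_def)
  \<comment> \<open>\<open>C\<^sub>0\<close> ensures \<open>h \<le> 1/100\<close> below; \<open>C = 5000 (12 \<tau>)\<^sup>2\<close> and \<open>K = 15 (12 \<tau>)\<close> come from the two bounds in terms of \<open>h\<close>.\<close>
  define C\<^sub>0 C K where "C\<^sub>0 = 1200 * \<tau>" and "C = 720000 * \<tau>\<^sup>2" and "K = 180 * \<tau>"
  have pos: "0 < C\<^sub>0" "0 < C" "0 < K" using \<tau> by (auto simp: C\<^sub>0_def C_def K_def)
  show ?thesis
  proof (rule exI[of _ C\<^sub>0], rule conjI, rule pos(1), rule exI[of _ C], rule conjI, rule pos(2),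
      rule exI[of _ K], rule conjI, rule pos(3), intro allI impI)
    fix n d :: nat
    assume n1: "1 \<le> n" and d2: "2 \<le> d"
    define \<Delta> where "\<Delta> = sqrt (real d) + sqrt (ln (real n))"
    have ln: "0 \<le> ln (real n)" using n1 by simp
    have \<Delta>d: "sqrt (real d) \<le> \<Delta>" using ln by (simp add: \<Delta>_def)
    have \<Delta>0: "0 < \<Delta>" using \<Delta>d d2 by (meson less_le_trans of_nat_0_less_iff order_less_le_trans pos2 real_sqrt_gt_zero)
    define c' where "c' = K * (1 + sqrt (ln (real n) / real d))"
    have "0 < 1 + sqrt (ln (real n) / real d)" using ln by (intro add_pos_nonneg) auto
    then have c'0: "0 < c'" using pos by (simp add: c'_def)
    show "\<exists>c'>0. c' \<le> K * (1 + sqrt (ln (real n) / real d)) \<and>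
      (\<forall>\<sigma>>0. \<forall>Z\<in>orth_stack n d. \<forall>(M :: 'w measure) W.
      prob_space M \<longrightarrow> noise_matrix M n d W \<longrightarrow>
      (\<exists>G :: nat \<Rightarrow> 'w \<Rightarrow> real mat.
        (2 \<le> n \<longrightarrow> (\<forall>i<n. gaussian_matrix M d (G i))) \<and>
        (\<exists>A\<in>sets M. measure M A \<ge> 1 - real n powr (- \<gamma>) \<and>
          (\<forall>\<omega>\<in>A. \<forall>P S. polar_retraction d P \<longrightarrow>
            eig_solution n d (observation \<sigma> Z (W \<omega>)) S \<longrightarrow>
            (let \<kappa> = cond_number n d S;
                 \<Delta> = sqrt (real d) + sqrt (ln (real n));
                 Zhat = stack n d (\<lambda>i. P (row_block d S i));
                 Q = P (Z\<^sup>T * Zhat)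
             in cond_finite n d S \<longrightarrow> snr n d \<sigma> \<ge> C\<^sub>0 * sqrt \<kappa> * \<Delta> \<longrightarrow>
                \<kappa> \<le> (1 + c' * inverse (snr n d \<sigma>)) / (1 - c' * inverse (snr n d \<sigma>)) \<and>
                (\<exists>E. \<forall>i<n. E i \<in> carrier_mat d d \<and>
                   P (row_block d S i) =
                     (1\<^sub>m d + (\<sigma> * sqrt (real (n - 1)) / (2 * real n)) \<cdot>\<^sub>m (G i \<omega> - (G i \<omega>)\<^sup>T))
                       * row_block d Z i * Q + E i \<and>
                   frob_norm (E i) \<le> C * sqrt \<kappa> * inverse ((snr n d \<sigma>)\<^sup>2) * \<Delta>\<^sup>2))))))"
    proof (intro exI[of _ c'] conjI allI impI ballI c'0)
      show "c' \<le> K * (1 + sqrt (ln (real n) / real d))" by (simp add: c'_def)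
      fix \<sigma> :: real and Z M and W :: "'w \<Rightarrow> real mat"
      assume \<sigma>: "0 < \<sigma>" and Z: "Z \<in> orth_stack n d" and M: "prob_space M" and W: "noise_matrix M n d W"
      show "\<exists>G :: nat \<Rightarrow> 'w \<Rightarrow> real mat.
        (2 \<le> n \<longrightarrow> (\<forall>i<n. gaussian_matrix M d (G i))) \<and>
        (\<exists>A\<in>sets M. measure M A \<ge> 1 - real n powr (- \<gamma>) \<and>
          (\<forall>\<omega>\<in>A. \<forall>P S. polar_retraction d P \<longrightarrow>
            eig_solution n d (observation \<sigma> Z (W \<omega>)) S \<longrightarrow>
            (let \<kappa> = cond_number n d S;
                 \<Delta> = sqrt (real d) + sqrt (ln (real n));
                 Zhat = stack n d (\<lambda>i. P (row_block d S i));
                 Q = P (Z\<^sup>T * Zhat)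
             in cond_finite n d S \<longrightarrow> snr n d \<sigma> \<ge> C\<^sub>0 * sqrt \<kappa> * \<Delta> \<longrightarrow>
                \<kappa> \<le> (1 + c' * inverse (snr n d \<sigma>)) / (1 - c' * inverse (snr n d \<sigma>)) \<and>
                (\<exists>E. \<forall>i<n. E i \<in> carrier_mat d d \<and>
                   P (row_block d S i) =
                     (1\<^sub>m d + (\<sigma> * sqrt (real (n - 1)) / (2 * real n)) \<cdot>\<^sub>m (G i \<omega> - (G i \<omega>)\<^sup>T))
                       * row_block d Z i * Q + E i \<and>
                   frob_norm (E i) \<le> C * sqrt \<kappa> * inverse ((snr n d \<sigma>)\<^sup>2) * \<Delta>\<^sup>2))))"
      proof (cases "2 \<le> n")
        case False
        \<comment> \<open>The empty event suffices, as \<open>1 - 1 powr (- \<gamma>) = 0\<close>.\<close>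
        then have "n = 1" using n1 by simp
        then show ?thesis by (intro exI[of _ "\<lambda>_ _. 0\<^sub>m d d"]) (auto intro!: bexI[of _ "{}"])
      next
        case n2: True
        interpret block_noise M n d W
          using M W n1 d2 by (simp add: block_noise_def block_noise_axioms_def)
        let ?Z = "of_mat Z"
        note Zs = orth_stack_blocks[OF Z]
        note Zd = of_mat_dims[OF Zs(1)]
        have ZZ: "tp ?Z * ?Z = real n *\<^sub>R idm d"
          by (rule orthogonal_blocks_gram) (use d2 Zd(1) Zs(2) in auto)
        have nZ: "norm ?Z \<le> sqrt n" by (rule norm_le_sqrt_gram[OF ZZ]) simp
        define sn where "sn = sqrt (real n)"
        have sn: "0 < sn" "sn * sn = real n" using n1 by (simp_all add: sn_def)
        \<comment> \<open>With the factor 12, \<open>good_event\<close> at \<open>s2 = 6 h sn\<close> bounds the norm of the block row times \<open>U i - Z\<close> by \<open>n h\<^sup>2 / \<sigma>\<close>.\<close>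
        define h where "h = 12 * \<tau> * (\<sigma> * \<Delta> / sn)"
        have h0: "0 < h" using \<tau> \<sigma> \<Delta>0 sn by (simp add: h_def)
        have nh: "real n * h = 12 * \<tau> * \<sigma> * \<Delta> * sn"
          using sn by (simp add: h_def sn(2)[symmetric])
        have s12: "0 < sn" "0 < 6 * h * sn" using sn h0 by auto
        obtain A where A: "A \<in> sets M" "1 - real n powr (- \<gamma>) \<le> prob A"
          and AA: "\<And>\<omega>. \<omega> \<in> A \<Longrightarrow> \<omega> \<in> space M"
            "\<And>\<omega>. \<omega> \<in> A \<Longrightarrow> norm (of_mat (W \<omega>)) \<le> 4 * \<tau> * sqrt (real (n * d))"
            "\<And>\<omega> i. \<omega> \<in> A \<Longrightarrow> i < n \<Longrightarrow> norm ?Z \<le> sn \<Longrightarrow> norm (blk d i (of_mat (W \<omega>)) * ?Z) \<le> 2 * (sn * \<tau> * \<Delta>)"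
            "\<And>\<omega> i. \<omega> \<in> A \<Longrightarrow> i < n \<Longrightarrow>
              norm ((gmap n \<sigma> ?Z (loo d i (of_mat (W \<omega>))) ^^ n) ?Z - ?Z) \<le> 6 * h * sn \<Longrightarrow>
              norm (blk d i (of_mat (W \<omega>)) * ((gmap n \<sigma> ?Z (loo d i (of_mat (W \<omega>))) ^^ n) ?Z - ?Z)) \<le> 2 * ((6 * h * sn) * \<tau> * \<Delta>)"
          using good_event[OF n2 assms s12 Zd(2,1), of \<sigma>] unfolding \<tau>_def[symmetric] \<Delta>_def[symmetric] by blast
        show ?thesis
        proof (intro exI[of _ "G ?Z"] conjI impI allI bexI[of _ A] ballI)
          show "gaussian_matrix M d (G ?Z i)" if "i < n" for i
            by (rule gaussian_G[OF n2 that Zd(2,1) ZZ Zs(2)[OF that]])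
          show "A \<in> sets M" "1 - real n powr (- \<gamma>) \<le> prob A" by fact+
          fix \<omega> P S
          assume \<omega>: "\<omega> \<in> A" and P: "polar_retraction d P" and S: "eig_solution n d (observation \<sigma> Z (W \<omega>)) S"
          define \<kappa> where "\<kappa> = cond_number n d S"
          define Q where "Q = P (Z\<^sup>T * stack n d (\<lambda>i. P (row_block d S i)))"
          let ?W = "of_mat (W \<omega>)"
          have "\<kappa> \<le> (1 + c' * inverse (snr n d \<sigma>)) / (1 - c' * inverse (snr n d \<sigma>)) \<and>
                (\<exists>E. \<forall>i<n. E i \<in> carrier_mat d d \<and>
                   P (row_block d S i) =
                     (1\<^sub>m d + (\<sigma> * sqrt (real (n - 1)) / (2 * real n)) \<cdot>\<^sub>m (G ?Z i \<omega> - (G ?Z i \<omega>)\<^sup>T))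
                       * row_block d Z i * Q + E i \<and>
                   frob_norm (E i) \<le> C * sqrt \<kappa> * inverse ((snr n d \<sigma>)\<^sup>2) * \<Delta>\<^sup>2)"
            if fin: "cond_finite n d S" and snr: "C\<^sub>0 * sqrt \<kappa> * \<Delta> \<le> snr n d \<sigma>"
          proof -
            have Wc: "W \<omega> \<in> carrier_mat (n * d) (n * d)" using W AA(1)[OF \<omega>] by (simp add: noise_matrix_def)
            have obs: "observation \<sigma> Z (W \<omega>) \<in> carrier_mat (n * d) (n * d)"
              using Wc Zs(1) by (simp add: observation_def)
            have Sc: "S \<in> carrier_mat (n * d) d" by (rule eig_solution_maximal(1)[OF S obs])
            have \<kappa>1: "1 \<le> \<kappa>" unfolding \<kappa>_def using n1 d2 by (intro cond_number_ge_1 Sc fin) auto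
            define sd where "sd = sqrt (real d)"
            have sd: "1 \<le> sd" "sd * sd = real d" using d2 by (simp_all add: sd_def)
            have snr_eq: "snr n d \<sigma> = sn / (\<sigma> * sd)"
              by (simp add: snr_def sn_def sd_def real_sqrt_divide field_simps)
            have "C\<^sub>0 * 1 * \<Delta> \<le> C\<^sub>0 * sqrt \<kappa> * \<Delta>"
              using \<kappa>1 pos \<Delta>0 by (intro mult_right_mono mult_left_mono) auto
            also have "\<dots> \<le> sn / (\<sigma> * sd)" using snr by (simp add: snr_eq)
            also have "\<dots> \<le> sn / (\<sigma> * 1)" using sd \<sigma> sn by (intro divide_left_mono mult_left_mono mult_pos_pos) auto
            finally have h1: "h \<le> 1/100"
              using \<sigma> sn by (simp add: C\<^sub>0_def h_def field_simps)
            have W_small: "\<sigma> * norm ?W \<le> n * h"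
            proof -
              have "\<sigma> * norm ?W \<le> \<sigma> * (4 * \<tau> * sqrt (real (n * d)))" using AA(2)[OF \<omega>] \<sigma> by (intro mult_left_mono) auto
              also have "\<dots> = 4 * (\<tau> * \<sigma> * sn) * sd" by (simp add: real_sqrt_mult sn_def sd_def)
              also have "\<dots> \<le> 12 * (\<tau> * \<sigma> * sn) * \<Delta>"
                using \<Delta>d \<tau> \<sigma> sn sd by (intro mult_mono) (auto simp: sd_def)
              also have "\<dots> = n * h" by (simp add: nh)
              finally show ?thesis .
            qed
            have WZ: "\<sigma> * norm (blk d i ?W * ?Z) \<le> n * h" if i: "i < n" for i
            proof -
              have "\<sigma> * norm (blk d i ?W * ?Z) \<le> \<sigma> * (2 * (sn * \<tau> * \<Delta>))"
                using AA(3)[OF \<omega> i] nZ \<sigma> by (intro mult_left_mono) (auto simp: sn_def)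
              also have "\<dots> = 2 * (\<sigma> * sn * \<tau> * \<Delta>)" by simp
              also have "\<dots> \<le> 12 * (\<sigma> * sn * \<tau> * \<Delta>)" using \<sigma> sn \<tau> \<Delta>0 by (intro mult_right_mono) auto
              also have "\<dots> = n * h" by (simp add: nh)
              finally show ?thesis .
            qed
            have WU: "\<sigma> * norm (blk d i ?W * ((gmap n \<sigma> ?Z (loo d i ?W) ^^ n) ?Z - ?Z)) \<le> n * h\<^sup>2"
              if i: "i < n" and b: "norm ((gmap n \<sigma> ?Z (loo d i ?W) ^^ n) ?Z - ?Z) \<le> 6 * h * sqrt n" for i
            proof -
              have "\<sigma> * norm (blk d i ?W * ((gmap n \<sigma> ?Z (loo d i ?W) ^^ n) ?Z - ?Z)) \<le> \<sigma> * (2 * ((6 * h * sn) * \<tau> * \<Delta>))"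
                using AA(4)[OF \<omega> i] b \<sigma> by (intro mult_left_mono) (auto simp: sn_def)
              also have "\<dots> = (real n * h) * h" by (simp add: nh)
              finally show ?thesis by (simp add: power2_eq_square mult.assoc)
            qed
            note det = deterministic_decomposition[OF _ _ \<sigma> less_imp_le[OF h0] h1 Z Wc of_mat_W[OF AA(1)[OF \<omega>]] W_small WZ WU P S,
                folded Q_def]
            have n0: "0 < n" and d0: "0 < d" using n1 d2 by auto
            have c'h: "c' * inverse (snr n d \<sigma>) = 15 * h"
            proof -
              have "sqrt (ln (real n) / real d) = sqrt (ln (real n)) / sd" by (simp add: real_sqrt_divide sd_def)
              then have "c' * sd = K * \<Delta>" using sd by (simp add: c'_def \<Delta>_def sd_def[symmetric] field_simps)
              then have "c' * sd * (\<sigma> / sn) = K * \<Delta> * (\<sigma> / sn)" by simp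
              then show ?thesis by (simp add: snr_eq K_def h_def field_simps)
            qed
            have "\<kappa> \<le> (1 + 15 * h) / (1 - 15 * h)"
              unfolding \<kappa>_def using det(1)[OF n0 d0] h1 by (intro cond_number_le Sc n0 d0) auto
            then have k: "\<kappa> \<le> (1 + c' * inverse (snr n d \<sigma>)) / (1 - c' * inverse (snr n d \<sigma>))"
              by (simp only: c'h)
            define X where "X i = (1\<^sub>m d + (\<sigma> * sqrt (real (n - 1)) / (2 * real n)) \<cdot>\<^sub>m (G ?Z i \<omega> - (G ?Z i \<omega>)\<^sup>T))
                       * row_block d Z i * Q" for i
            define E where "E i = P (row_block d S i) - X i" for i
            have "E i \<in> carrier_mat d d \<and> P (row_block d S i) = X i + E i \<and>
              frob_norm (E i) \<le> C * sqrt \<kappa> * inverse ((snr n d \<sigma>)\<^sup>2) * \<Delta>\<^sup>2" if i: "i < n" for i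
            proof -
              have Qc: "Q \<in> carrier_mat d d" and Pc: "P (row_block d S i) \<in> carrier_mat d d"
                using det(2,3)[OF n0 d0 _ _ _ i] by auto
              have Gc: "G ?Z i \<omega> \<in> carrier_mat d d" by (simp add: G_def)
              let ?F = "1\<^sub>m d + (\<sigma> * sqrt (real (n - 1)) / (2 * real n)) \<cdot>\<^sub>m (G ?Z i \<omega> - (G ?Z i \<omega>)\<^sup>T)"
              have Gd: "G ?Z i \<omega> - (G ?Z i \<omega>)\<^sup>T \<in> carrier_mat d d" using Gc by (intro minus_carrier_mat) simp
              have Fc: "?F \<in> carrier_mat d d" by (intro add_carrier_mat smult_carrier_mat Gd)
              have Zc: "row_block d Z i \<in> carrier_mat d d" by (simp add: block_def)
              have Xc: "X i \<in> carrier_mat d d" using Fc Zc Qc by (simp add: X_def)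
              have Ec: "E i \<in> carrier_mat d d" unfolding E_def by (rule minus_carrier_mat[OF Xc])
              have PE: "P (row_block d S i) = X i + E i"
                using Xc Pc by (intro eq_matI) (auto simp: E_def)
              let ?A = "blk d i ?W * ?Z * tp (blk d i ?Z)"
              have oG: "of_mat (G ?Z i \<omega>) = (1 / sqrt (real (n - 1))) *\<^sub>R ?A"
              proof -
                have "tp (blk d i ?Z) * idm d = tp (blk d i ?Z)" using orthfD[OF Zs(2)[OF i]] by simp
                then show ?thesis
                  by (simp add: G_def of_mat_to_mat of_mat_W[OF AA(1)[OF \<omega>], symmetric] mult.assoc idm_blk
                      flip: mult.assoc[of "idm d" "blk d i ?W"])
              qed
              have oF: "of_mat ?F = idm d + (\<sigma> / (2 * real n)) *\<^sub>R (?A - tp ?A)"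
              proof -
                have "of_mat ?F = idm d + (\<sigma> * sqrt (real (n - 1)) / (2 * real n)) *\<^sub>R (of_mat (G ?Z i \<omega>) - tp (of_mat (G ?Z i \<omega>)))"
                  using Gc by (subst of_mat_add[of _ d d]) (auto simp: of_mat_minus[of _ d d])
                also have "\<dots> = idm d + (\<sigma> / (2 * real n)) *\<^sub>R (?A - tp ?A)"
                  unfolding oG using n2 by (simp add: scaleR_diff_right)
                finally show ?thesis .
              qed
              have "of_mat (X i) = of_mat ?F * blk d i ?Z * of_mat Q"
                using Fc Zc Qc by (simp add: X_def of_mat_mult[of _ d d _ d] of_mat_row_block[OF Zs(1) i] mult.assoc)
              then have "of_mat (E i) = of_mat (P (row_block d S i)) - (idm d + (\<sigma> / (2 * real n)) *\<^sub>R (?A - tp ?A)) * blk d i ?Z * of_mat Q"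
                unfolding E_def of_mat_minus[OF Pc Xc] oF by (rule arg_cong)
              then have nE: "norm (of_mat (E i)) \<le> 5000 * h\<^sup>2"
                using det(4)[OF n0 d0 _ _ _ i] by simp
              have "frob_norm (E i) \<le> sd * norm (of_mat (E i))"
                unfolding frob_norm_eq_fr sd_def by (rule fr_le_sqrt_norm[OF of_mat_dims(2)[OF Ec]])
              also have "\<dots> \<le> sd * (5000 * h\<^sup>2)" using nE sd by (intro mult_left_mono) auto
              also have "\<dots> \<le> (sqrt \<kappa> * (sd * sd)) * (5000 * h\<^sup>2)"
              proof (rule mult_right_mono)
                have "1 * (1 * sd) \<le> sqrt \<kappa> * (sd * sd)" using \<kappa>1 sd by (intro mult_mono) auto
                then show "sd \<le> sqrt \<kappa> * (sd * sd)" by simp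
              qed simp
              also have "\<dots> = C * sqrt \<kappa> * inverse ((snr n d \<sigma>)\<^sup>2) * \<Delta>\<^sup>2"
                by (simp add: snr_eq C_def h_def power_mult_distrib power_divide field_simps power2_eq_square)
              finally show ?thesis using Ec PE by blast
            qed
            then show ?thesis using k unfolding X_def by blast
          qed
          then show "let \<kappa> = cond_number n d S;
                 \<Delta> = sqrt (real d) + sqrt (ln (real n));
                 Zhat = stack n d (\<lambda>i. P (row_block d S i));
                 Q = P (Z\<^sup>T * Zhat)
             in cond_finite n d S \<longrightarrow> snr n d \<sigma> \<ge> C\<^sub>0 * sqrt \<kappa> * \<Delta> \<longrightarrow>
                \<kappa> \<le> (1 + c' * inverse (snr n d \<sigma>)) / (1 - c' * inverse (snr n d \<sigma>)) \<and>
                (\<exists>E. \<forall>i<n. E i \<in> carrier_mat d d \<and>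
                   P (row_block d S i) =
                     (1\<^sub>m d + (\<sigma> * sqrt (real (n - 1)) / (2 * real n)) \<cdot>\<^sub>m (G ?Z i \<omega> - (G ?Z i \<omega>)\<^sup>T))
                       * row_block d Z i * Q + E i \<and>
                   frob_norm (E i) \<le> C * sqrt \<kappa> * inverse ((snr n d \<sigma>)\<^sup>2) * \<Delta>\<^sup>2)"
            unfolding Let_def \<kappa>_def Q_def \<Delta>_def by blast
        qed
      qed
    qed
  qed
qed

end
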